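(* Let $S$ be a finite alphabet. If $X \subset S^{\mathbb{Z}}$ is a quasiminimal $\Pi^0_1$ subshift, then the model-checking problem of $X$ for elementary piecewise testable languages is decidable.
   Context: A subshift is a closed (product topology) set $X \subset S^{\mathbb{Z}}$ with $\sigma(X)=X$, where $\sigma(x)_i=x_{i+1}$; it is quasiminimal if it contains only finitely many proper subshifts. The language $\mathcal{L}(X) \subset S^*$ is the set of finite words occurring as contiguous subwords of points of $X$; $X$ is $\Pi^0_1$ if $S^*\setminus \mathcal{L}(X)$ is recursively enumerable. An elementary piecewise testable language over the alphabet $[1,m]=\{1,\dots,m\}$ is one of the form $a_1 T^* a_2 T^* a_3 \cdots T^* a_k$ with $T=[1,m]$ and $a_i \in T$. For a finite set $C$ of words of a common length $n$, $[C]$ is the clopen set of points $x$ with $x_{[0,n-1]} \in C$; clopen sets are given in such a finite form (up to a shift of coordinates). The model-checking problem of $X$ for a class of languages is: given $m$, a language $L$ over $[1,m]$ in the class and a partition of $X$ into $m$ clopen sets $X=[C_1]\,\dot\cup\cdots\dot\cup\,[C_m]$ (each $[C_i]$ intersected with $X$), decide whether there exist a word $w \in L$ and a point $x \in X$ such that $\sigma^i(x) \in [C_{w_i}]$ for all $i \in [0,|w|-1]$ (words are $0$-indexed). The subshift $X$ is fixed (decidability is not claimed to be uniform in $X$). *)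

theory Defs
  imports "HOL-Analysis.Abstract_Topology" "HOL-Analysis.Function_Topology"
    "HOL-Library.Nat_Bijection" "HOL-Library.Disjoint_Sets"
begin

text \<open>
  Kleene's mu-recursive functions. The relation \<open>computes p xs y\<close> says that the partial
  function denoted by \<open>p\<close> is defined at the argument tuple \<open>xs\<close> and has value \<open>y\<close> there.
  Arities are not recorded in the terms: \<open>Zero\<close> and \<open>Proj i\<close> stand for the constant and the
  projection of every suitable arity.
\<close>

datatype recf =
    Zero
  | Succ
  | Proj nat
  | Comp recf "recf list"
  | PrimRec recf recf
  | Mu recf

inductive computes :: "recf \<Rightarrow> nat list \<Rightarrow> nat \<Rightarrow> bool" where
  computes_Zero: "computes Zero xs 0"
| computes_Succ: "computes Succ [x] (Suc x)"
| computes_Proj: "i < length xs \<Longrightarrow> computes (Proj i) xs (xs ! i)"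
| computes_Comp:
    "list_all2 (\<lambda>g y. computes g xs y) gs ys \<Longrightarrow> computes f ys z \<Longrightarrow> computes (Comp f gs) xs z"
| computes_PrimRec_0: "computes f xs y \<Longrightarrow> computes (PrimRec f g) (0 # xs) y"
| computes_PrimRec_Suc:
    "computes (PrimRec f g) (n # xs) y \<Longrightarrow> computes g (n # y # xs) z \<Longrightarrow>
     computes (PrimRec f g) (Suc n # xs) z"
| computes_Mu:
    "computes f (n # xs) 0 \<Longrightarrow> (\<And>i. i < n \<Longrightarrow> \<exists>y. computes f (i # xs) y \<and> y > 0) \<Longrightarrow>
     computes (Mu f) xs n"

inductive_cases computes_ZeroE: "computes Zero xs y"
inductive_cases computes_SuccE: "computes Succ xs y"
inductive_cases computes_ProjE: "computes (Proj i) xs y"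
inductive_cases computes_CompE: "computes (Comp f gs) xs y"
inductive_cases computes_PrimRec_0E: "computes (PrimRec f g) (0 # xs) y"
inductive_cases computes_PrimRec_SucE: "computes (PrimRec f g) (Suc n # xs) y"
inductive_cases computes_MuE: "computes (Mu f) xs y"

lemma computes_deterministic:
  "computes p xs y \<Longrightarrow> computes p xs z \<Longrightarrow> y = z"
proof (induction p xs y arbitrary: z rule: computes.induct)
  case (computes_Zero xs)
  then show ?case by (rule computes_ZeroE) simp
next
  case (computes_Succ x)
  then show ?case by (rule computes_SuccE) simp
next
  case (computes_Proj i xs)
  from computes_Proj.prems show ?case by (rule computes_ProjE) simp
next
  case (computes_Comp xs gs ys f v)
  from computes_Comp.prems obtain ys' where
    ys': "list_all2 (\<lambda>g y. computes g xs y) gs ys'" "computes f ys' z"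
    by (rule computes_CompE)
  have "ys = ys'"
    using computes_Comp.IH(1) ys'(1) by (auto simp: list_all2_conv_all_nth intro!: nth_equalityI)
  then show ?case using computes_Comp.IH(2) ys'(2) by blast
next
  case (computes_PrimRec_0 f xs y g)
  from computes_PrimRec_0.prems have "computes f xs z" by (rule computes_PrimRec_0E)
  then show ?case by (rule computes_PrimRec_0.IH)
next
  case (computes_PrimRec_Suc f g n xs y v)
  from computes_PrimRec_Suc.prems obtain y' where
    "computes (PrimRec f g) (n # xs) y'" "computes g (n # y' # xs) z"
    by (rule computes_PrimRec_SucE)
  then show ?case using computes_PrimRec_Suc.IH by blast
next
  case (computes_Mu f n xs)
  from computes_Mu.prems have
    z: "computes f (z # xs) 0" "\<And>i. i < z \<Longrightarrow> \<exists>y. computes f (i # xs) y \<and> y > 0"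
    by (rule computes_MuE, blast)+
  show ?case
  proof (rule linorder_cases[of n z])
    assume "n < z"
    then obtain y where "computes f (n # xs) y" "y > 0" using z(2) by blast
    then show ?thesis using computes_Mu.IH(1)[of y] by simp
  next
    assume "z < n"
    then obtain y where "y > 0" "\<And>v. computes f (z # xs) v \<Longrightarrow> y = v"
      using computes_Mu.IH(2) by blast
    then show ?thesis using z(1) by blast
  qed
qed

definition recursively_enumerable :: "nat set \<Rightarrow> bool" where
  "recursively_enumerable A \<longleftrightarrow> (\<exists>p. \<forall>n. n \<in> A \<longleftrightarrow> (\<exists>y. computes p [n] y))"

text \<open>
  A decision problem consists of a set \<open>I\<close> of admissible instances, a coding of instances by
  natural numbers and a property \<open>P\<close>. An algorithm has to halt with the correct answer on
  every admissible instance; inputs that are not (codes of) instances are irrelevant.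
\<close>

definition decidable_problem :: "('i \<Rightarrow> nat) \<Rightarrow> 'i set \<Rightarrow> ('i \<Rightarrow> bool) \<Rightarrow> bool" where
  "decidable_problem code I P \<longleftrightarrow>
     (\<exists>p. \<forall>i\<in>I. computes p [code i] (if P i then 1 else 0))"

definition shift :: "(int \<Rightarrow> 'a) \<Rightarrow> int \<Rightarrow> 'a" where
  "shift x = (\<lambda>i. x (i + 1))"

text \<open>The topological space below has \<open>S\<^sup>\<int>\<close> as its underlying set, so \<open>X \<subseteq> S\<^sup>\<int>\<close> is implied.\<close>

definition subshift :: "'a set \<Rightarrow> (int \<Rightarrow> 'a) set \<Rightarrow> bool" where
  "subshift S X \<longleftrightarrow>
     closedin (product_topology (\<lambda>_::int. discrete_topology S) UNIV) X \<and> shift ` X = X"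

definition quasiminimal :: "'a set \<Rightarrow> (int \<Rightarrow> 'a) set \<Rightarrow> bool" where
  "quasiminimal S X \<longleftrightarrow> subshift S X \<and> finite {Y. subshift S Y \<and> Y \<subset> X}"

text \<open>The word \<open>x\<^bsub>[k, k+n-1]\<^esub>\<close>.\<close>

definition factor :: "(int \<Rightarrow> 'a) \<Rightarrow> int \<Rightarrow> nat \<Rightarrow> 'a list" where
  "factor x k n = map (\<lambda>j. x (k + int j)) [0..<n]"

definition language :: "(int \<Rightarrow> 'a) set \<Rightarrow> 'a list set" where
  "language X = {factor x k n | x k n. x \<in> X}"

text \<open>Words are coded by numbers via a numbering \<open>enc\<close> of the alphabet (injective on \<open>S\<close>).\<close>

definition encode_word :: "('a \<Rightarrow> nat) \<Rightarrow> 'a list \<Rightarrow> nat" where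
  "encode_word enc u = list_encode (map enc u)"

definition Pi01 :: "('a \<Rightarrow> nat) \<Rightarrow> 'a set \<Rightarrow> (int \<Rightarrow> 'a) set \<Rightarrow> bool" where
  "Pi01 enc S X \<longleftrightarrow> recursively_enumerable (encode_word enc ` (lists S - language X))"

text \<open>
  The language \<open>a\<^sub>1 T\<^sup>* a\<^sub>2 T\<^sup>* \<dots> T\<^sup>* a\<^sub>k\<close>. Only the case \<open>k \<ge> 1\<close> is relevant; the
  first equation merely makes the function total.
\<close>

fun elementary_pt :: "'b set \<Rightarrow> 'b list \<Rightarrow> 'b list set" where
  "elementary_pt T [] = {[]}"
| "elementary_pt T [a] = {[a]}"
| "elementary_pt T (a # b # as) = {a # u @ v | u v. u \<in> lists T \<and> v \<in> elementary_pt T (b # as)}"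

text \<open>
  A clopen set is presented by a list \<open>us\<close> enumerating a finite set of words of a common length
  \<open>n\<close>, and an offset \<open>k\<close>: it consists of the points \<open>x\<close> with \<open>x\<^bsub>[k, k+n-1]\<^esub> \<in> set us\<close>.
\<close>

type_synonym 'a clopen = "int \<times> 'a list list"

definition clopen_pres :: "'a set \<Rightarrow> 'a clopen \<Rightarrow> bool" where
  "clopen_pres S c \<longleftrightarrow> set (snd c) \<subseteq> lists S \<and> (\<exists>n. \<forall>u\<in>set (snd c). length u = n)"

definition clopen_set :: "'a clopen \<Rightarrow> (int \<Rightarrow> 'a) set" where
  "clopen_set c = {x. \<exists>u\<in>set (snd c). factor x (fst c) (length u) = u}"

text \<open>The list \<open>cs\<close> presents the sets \<open>[C\<^sub>1], \<dots>, [C\<^sub>m]\<close>; the numbering starts from 1.\<close>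

definition part :: "'a clopen list \<Rightarrow> nat \<Rightarrow> (int \<Rightarrow> 'a) set" where
  "part cs i = clopen_set (cs ! (i - 1))"

definition clopen_partition ::
    "'a set \<Rightarrow> (int \<Rightarrow> 'a) set \<Rightarrow> nat \<Rightarrow> 'a clopen list \<Rightarrow> bool" where
  "clopen_partition S X m cs \<longleftrightarrow>
     length cs = m \<and> (\<forall>c\<in>set cs. clopen_pres S c) \<and>
     (\<Union>i\<in>{1..m}. X \<inter> part cs i) = X \<and>
     disjoint_family_on (\<lambda>i. X \<inter> part cs i) {1..m}"

definition models :: "(int \<Rightarrow> 'a) set \<Rightarrow> nat list set \<Rightarrow> 'a clopen list \<Rightarrow> bool" where
  "models X L cs \<longleftrightarrow>
     (\<exists>w\<in>L. \<exists>x\<in>X. \<forall>i<length w. (shift ^^ i) x \<in> part cs (w ! i))"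

text \<open>
  An instance \<open>(m, as, cs)\<close> consists of the alphabet size \<open>m\<close>, the letters \<open>as\<close> determining an
  elementary piecewise testable language over \<open>{1..m}\<close>, and a clopen partition of \<open>X\<close>.
\<close>

type_synonym 'a mc_instance = "nat \<times> nat list \<times> 'a clopen list"

definition ept_instances :: "'a set \<Rightarrow> (int \<Rightarrow> 'a) set \<Rightarrow> 'a mc_instance set" where
  "ept_instances S X =
     {(m, as, cs). as \<noteq> [] \<and> set as \<subseteq> {1..m} \<and> clopen_partition S X m cs}"

definition ept_models :: "(int \<Rightarrow> 'a) set \<Rightarrow> 'a mc_instance \<Rightarrow> bool" where
  "ept_models X = (\<lambda>(m, as, cs). models X (elementary_pt {1..m} as) cs)"

definition encode_clopen :: "('a \<Rightarrow> nat) \<Rightarrow> 'a clopen \<Rightarrow> nat" where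
  "encode_clopen enc = (\<lambda>(k, us). prod_encode (int_encode k, list_encode (map (encode_word enc) us)))"

definition encode_instance :: "('a \<Rightarrow> nat) \<Rightarrow> 'a mc_instance \<Rightarrow> nat" where
  "encode_instance enc = (\<lambda>(m, as, cs).
     prod_encode (m, prod_encode (list_encode as, list_encode (map (encode_clopen enc) cs))))"

end

theory Submission
  imports Defs
begin

text \<open>
  The partition labels every position of a point by the number of the part that its translate
  lies in. Since the parts cover the subshift, the gaps \<open>T\<^sup>*\<close> of an elementary piecewise
  testable language impose nothing, and the question becomes whether the labels \<open>a\<^sub>1, \<dots>, a\<^sub>k\<close>
  occur in this order, at increasing positions, in the label sequence of some point
  (\<open>models_iff_in_order\<close>). It is decidable because both the presence and the absence of such an
  occurrence are semidecidable.

  All infinite searches have one form, the predicate \<open>forced\<close>: every point with a fixed word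
  at a fixed place shows one of finitely many fixed words near the origin, or its labels on a given
  window do (or do not) contain the pattern. A statement of this kind about all points has, by
  compactness, a finite witness: a window so large that each word over it either lies outside the
  language of the subshift or exhibits what is claimed. Words outside the language are enumerable,
  so \<open>forced\<close> is semidecidable (\<open>forced_code_iff\<close>, \<open>semidecidable_forced_code\<close>).

  Presence (\<open>occurrence_certificate\<close>): the points in which the pattern does not occur form a
  subshift. There are only finitely many subshifts inside the given one, so there is a finite set of
  words of its language such that each proper subshift lacks one of them. Hence the pattern occurs
  in some point iff one of these words forces it.

  Absence: whether the pattern occurs in \<open>x\<close> depends only on the orbit closure of \<open>x\<close>, so finitely
  many \<open>x\<close> suffice. Each subshift inside the given one consists of the points avoiding finitely
  many words (\<open>exclusion_words\<close>); this applies to the orbit closure of \<open>x\<close> and to its two limit sets.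
  If \<open>x\<close> lies in one of its limit sets, every label of \<open>x\<close> recurs in that direction, and the pattern
  is absent iff one of its labels is absent from the orbit closure (\<open>recurrent_certificate\<close>).
  Otherwise \<open>x\<close> is isolated in its orbit closure, so that one fixed word determines it up to
  translation. An initial segment of the pattern whose labels occur in the left limit set can be
  found arbitrarily far to the left, and likewise for final segments on the right; the question is
  about the remaining middle segment. Its first label does not occur in the left limit set, hence
  forces within some distance \<open>l\<close> a word that the left limit set avoids, and such words do not occur
  in \<open>x\<close> to the left of some constant. With the mirror image of this on the right, the search is
  confined to a bounded window around the isolating word (\<open>isolated_certificate\<close>).

  The finite sets of words, the representatives and the constants depend on the subshift and are
  chosen, not computed; this is where the algorithm is not uniform.
\<close>

section \<open>Total computable functions\<close>

text \<open>
  Argument tuples are what the programs take; they serve to derive pairing and the closure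
  properties of unary functions, which then receive several arguments as one code.
\<close>

definition computable_tuple :: "nat \<Rightarrow> (nat list \<Rightarrow> nat) \<Rightarrow> bool" where
  "computable_tuple k f \<longleftrightarrow> (\<exists>p. \<forall>xs. length xs = k \<longrightarrow> computes p xs (f xs))"

lemma computable_tuple_cong:
  assumes "computable_tuple k f" "\<And>xs. length xs = k \<Longrightarrow> f xs = g xs"
  shows "computable_tuple k g"
  using assms unfolding computable_tuple_def by metis

lemma computable_tuple_proj: "i < k \<Longrightarrow> computable_tuple k (\<lambda>xs. xs ! i)"
  unfolding computable_tuple_def by (metis computes_Proj)

lemma computable_tuple_zero: "computable_tuple k (\<lambda>xs. 0)"
  unfolding computable_tuple_def by (metis computes_Zero)

lemma computable_tuple_comp1:
  assumes "computable_tuple 1 f" "computable_tuple k g"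
  shows "computable_tuple k (\<lambda>xs. f [g xs])"
proof -
  obtain p q where p: "\<And>xs. length xs = 1 \<Longrightarrow> computes p xs (f xs)"
    and q: "\<And>xs. length xs = k \<Longrightarrow> computes q xs (g xs)"
    using assms unfolding computable_tuple_def by auto
  have "computes (Comp p [q]) xs (f [g xs])" if "length xs = k" for xs
    by (rule computes_Comp[of _ _ "[g xs]"]) (use that in \<open>auto intro: p q\<close>)
  then show ?thesis unfolding computable_tuple_def by blast
qed

lemma computable_tuple_comp2:
  assumes "computable_tuple 2 f" "computable_tuple k g" "computable_tuple k h"
  shows "computable_tuple k (\<lambda>xs. f [g xs, h xs])"
proof -
  obtain p q r where p: "\<And>xs. length xs = 2 \<Longrightarrow> computes p xs (f xs)"
    and q: "\<And>xs. length xs = k \<Longrightarrow> computes q xs (g xs)"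
    and r: "\<And>xs. length xs = k \<Longrightarrow> computes r xs (h xs)"
    using assms unfolding computable_tuple_def by auto
  have "computes (Comp p [q, r]) xs (f [g xs, h xs])" if "length xs = k" for xs
    by (rule computes_Comp[of _ _ "[g xs, h xs]"]) (use that in \<open>auto intro: p q r\<close>)
  then show ?thesis unfolding computable_tuple_def by blast
qed

lemma computable_tuple_Suc:
  assumes "computable_tuple k g"
  shows "computable_tuple k (\<lambda>xs. Suc (g xs))"
proof -
  have "computes Succ xs (Suc (hd xs))" if "length xs = 1" for xs
    using that computes_Succ by (cases xs) auto
  then have "computable_tuple 1 (\<lambda>xs. Suc (hd xs))" unfolding computable_tuple_def by blast
  from computable_tuple_comp1[OF this assms] show ?thesis by simp
qed

lemma computable_tuple_rec:
  assumes "computable_tuple k a" "computable_tuple (Suc (Suc k)) h"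
  shows "computable_tuple (Suc k) (\<lambda>xs. rec_nat (a (tl xs)) (\<lambda>i r. h (i # r # tl xs)) (hd xs))"
proof -
  obtain p q where p: "\<And>xs. length xs = k \<Longrightarrow> computes p xs (a xs)"
    and q: "\<And>xs. length xs = Suc (Suc k) \<Longrightarrow> computes q xs (h xs)"
    using assms unfolding computable_tuple_def by auto
  have *: "computes (PrimRec p q) (n # xs) (rec_nat (a xs) (\<lambda>i r. h (i # r # xs)) n)"
    if "length xs = k" for xs n
  proof (induction n)
    case 0
    then show ?case using computes_PrimRec_0[OF p[OF that]] by simp
  next
    case (Suc n)
    show ?case using computes_PrimRec_Suc[OF Suc q] that by simp
  qed
  have "computes (PrimRec p q) xs (rec_nat (a (tl xs)) (\<lambda>i r. h (i # r # tl xs)) (hd xs))"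
    if "length xs = Suc k" for xs
    using that *[of "tl xs" "hd xs"] by (cases xs) auto
  then show ?thesis unfolding computable_tuple_def by blast
qed

text \<open>
  Unlike \<open>computable_tuple_Least\<close>, this asks for values of \<open>p\<close> only up to the minimum, as needed
  for a search that halts on admissible inputs only.
\<close>

lemma computes_Mu_Least:
  assumes "\<exists>n. P n" and "\<And>n. n \<le> (LEAST n. P n) \<Longrightarrow> computes p (n # xs) (if P n then 0 else 1)"
  shows "computes (Mu p) xs (LEAST n. P n)"
proof (rule computes_Mu)
  show "computes p ((LEAST n. P n) # xs) 0"
    using assms(2)[of "LEAST n. P n"] LeastI_ex[OF assms(1)] by simp
  show "\<exists>y. computes p (i # xs) y \<and> y > 0" if "i < (LEAST n. P n)" for i
    using assms(2)[of i] not_less_Least[OF that] that by auto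
qed

lemma computable_tuple_Least:
  assumes "computable_tuple (Suc k) f" and ex: "\<And>xs. length xs = k \<Longrightarrow> \<exists>n. f (n # xs) = 0"
  shows "computable_tuple k (\<lambda>xs. LEAST n. f (n # xs) = 0)"
proof -
  obtain p where p: "\<And>xs. length xs = Suc k \<Longrightarrow> computes p xs (f xs)"
    using assms unfolding computable_tuple_def by auto
  have "computes (Mu p) xs (LEAST n. f (n # xs) = 0)" if l: "length xs = k" for xs
  proof (rule computes_Mu)
    show "computes p ((LEAST n. f (n # xs) = 0) # xs) 0"
      using p[of "(LEAST n. f (n # xs) = 0) # xs"] LeastI_ex[OF ex[OF l]] l by simp
    show "\<exists>y. computes p (i # xs) y \<and> y > 0" if "i < (LEAST n. f (n # xs) = 0)" for i
      using p[of "i # xs"] not_less_Least[OF that] l by auto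
  qed
  then show ?thesis unfolding computable_tuple_def by blast
qed

lemma computable_tuple_rec2:
  assumes "computable_tuple 1 a" "computable_tuple 3 h"
  shows "computable_tuple 2 (\<lambda>xs. rec_nat (a [xs ! 1]) (\<lambda>i r. h [i, r, xs ! 1]) (xs ! 0))"
proof (rule computable_tuple_cong)
  show "computable_tuple 2 (\<lambda>xs. rec_nat (a (tl xs)) (\<lambda>i r. h (i # r # tl xs)) (hd xs))"
    using computable_tuple_rec[of 1 a h] assms by (simp add: numeral_2_eq_2 numeral_3_eq_3)
  show "rec_nat (a (tl xs)) (\<lambda>i r. h (i # r # tl xs)) (hd xs) =
        rec_nat (a [xs ! 1]) (\<lambda>i r. h [i, r, xs ! 1]) (xs ! 0)" if l: "length xs = 2" for xs
    using l by (auto simp: length_Suc_conv numeral_2_eq_2)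
qed

lemma computable_tuple_rec1:
  assumes "computable_tuple 2 h"
  shows "computable_tuple 1 (\<lambda>xs. rec_nat c (\<lambda>i r. h [i, r]) (xs ! 0))"
proof (rule computable_tuple_cong)
  have c: "computable_tuple 0 (\<lambda>xs. c)" by (induction c) (auto intro: computable_tuple_zero computable_tuple_Suc)
  show "computable_tuple 1 (\<lambda>xs. rec_nat c (\<lambda>i r. h (i # r # tl xs)) (hd xs))"
    using computable_tuple_rec[OF c, of h] assms by (simp add: numeral_2_eq_2)
  show "rec_nat c (\<lambda>i r. h (i # r # tl xs)) (hd xs) =
        rec_nat c (\<lambda>i r. h [i, r]) (xs ! 0)" if l: "length xs = 1" for xs
    using l by (auto simp: length_Suc_conv)
qed

lemma computable_tuple_add: assumes "computable_tuple k f" "computable_tuple k g" shows "computable_tuple k (\<lambda>xs. f xs + g xs)"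
proof -
  have e: "rec_nat y (\<lambda>i. Suc) x = x + y" for x y by (induction x) auto
  have "computable_tuple 2 (\<lambda>xs. rec_nat (xs ! 1) (\<lambda>i r. Suc r) (xs ! 0))"
    using computable_tuple_rec2[OF computable_tuple_proj[of 0 1] computable_tuple_Suc[OF computable_tuple_proj[of 1 3]]] by simp
  from computable_tuple_comp2[OF this assms] show ?thesis by (simp add: e)
qed

lemma computable_tuple_pred: assumes "computable_tuple k f" shows "computable_tuple k (\<lambda>xs. f xs - 1)"
proof -
  have e: "rec_nat 0 (\<lambda>i r. i) x = x - Suc 0" for x by (induction x) auto
  have "computable_tuple 1 (\<lambda>xs. rec_nat 0 (\<lambda>i r. i) (xs ! 0))"
    using computable_tuple_rec1[OF computable_tuple_proj[of 0 2]] by simp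
  from computable_tuple_comp1[OF this assms] show ?thesis by (simp add: e)
qed

lemma computable_tuple_diff: assumes "computable_tuple k f" "computable_tuple k g" shows "computable_tuple k (\<lambda>xs. f xs - g xs)"
proof -
  have e: "rec_nat y (\<lambda>i r. r - Suc 0) x = y - x" for x y by (induction x) auto
  have "computable_tuple 2 (\<lambda>xs. rec_nat (xs ! 1) (\<lambda>i r. r - 1) (xs ! 0))"
    using computable_tuple_rec2[OF computable_tuple_proj[of 0 1] computable_tuple_pred[OF computable_tuple_proj[of 1 3]]] by simp
  from computable_tuple_comp2[OF this assms(2,1)] show ?thesis by (simp add: e)
qed

lemma computable_tuple_triangle: assumes "computable_tuple k f" shows "computable_tuple k (\<lambda>xs. triangle (f xs))"
proof -
  have e: "rec_nat 0 (\<lambda>i r. Suc (r + i)) x = triangle x" for x by (induction x) auto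
  have "computable_tuple 1 (\<lambda>xs. rec_nat 0 (\<lambda>i r. Suc (r + i)) (xs ! 0))"
    using computable_tuple_rec1[OF computable_tuple_Suc[OF computable_tuple_add[OF computable_tuple_proj[of 1 2] computable_tuple_proj[of 0 2]]]] by simp
  from computable_tuple_comp1[OF this assms] show ?thesis by (simp add: e)
qed

definition pfst :: "nat \<Rightarrow> nat" where "pfst n = fst (prod_decode n)"
definition psnd :: "nat \<Rightarrow> nat" where "psnd n = snd (prod_decode n)"

lemma pfst_encode [simp]: "pfst (prod_encode (a, b)) = a"
  and psnd_encode [simp]: "psnd (prod_encode (a, b)) = b"
  and prod_encode_pfst_psnd [simp]: "prod_encode (pfst n, psnd n) = n"
  by (simp_all add: pfst_def psnd_def)

lemma triangle_mono: "a \<le> b \<Longrightarrow> triangle a \<le> triangle b"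
  by (induction rule: dec_induct) auto

text \<open>
  The pairs with sum \<open>k\<close> occupy the codes from \<open>triangle k\<close> up to \<open>triangle (Suc k)\<close>, so
  unpairing amounts to a search for the sum of the two components.
\<close>

lemma Least_triangle:
  "(LEAST k. Suc (prod_encode (a, b)) - triangle (Suc k) = 0) = a + b"
proof (rule Least_equality)
  show "Suc (prod_encode (a, b)) - triangle (Suc (a + b)) = 0"
    by (simp add: prod_encode_def)
  fix k assume k: "Suc (prod_encode (a, b)) - triangle (Suc k) = 0"
  show "a + b \<le> k"
  proof (rule ccontr)
    assume "\<not> a + b \<le> k"
    then have "triangle (Suc k) \<le> triangle (a + b)" by (intro triangle_mono) simp
    then show False using k by (simp add: prod_encode_def)
  qed
qed

lemma computable_tuple_prod_encode:
  assumes "computable_tuple k f" "computable_tuple k g"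
  shows "computable_tuple k (\<lambda>xs. prod_encode (f xs, g xs))"
  unfolding prod_encode_def prod.case by (intro computable_tuple_add computable_tuple_triangle assms)

lemma computable_tuple_unpair_sum: "computable_tuple 1 (\<lambda>xs. pfst (xs ! 0) + psnd (xs ! 0))"
proof (rule computable_tuple_cong)
  show "computable_tuple 1 (\<lambda>xs. LEAST k. Suc ((k # xs) ! 1) - triangle (Suc ((k # xs) ! 0)) = 0)"
  proof (rule computable_tuple_Least)
    show "computable_tuple (Suc 1) (\<lambda>xs. Suc (xs ! 1) - triangle (Suc (xs ! 0)))"
      by (intro computable_tuple_diff computable_tuple_Suc computable_tuple_triangle computable_tuple_proj) auto
    show "\<exists>k. Suc ((k # xs) ! 1) - triangle (Suc ((k # xs) ! 0)) = 0" for xs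
      by (rule exI[of _ "xs ! 0"]) simp
  qed
  show "(LEAST k. Suc ((k # xs) ! 1) - triangle (Suc ((k # xs) ! 0)) = 0)
      = pfst (xs ! 0) + psnd (xs ! 0)" for xs
    using Least_triangle[of "pfst (xs ! 0)" "psnd (xs ! 0)"] by simp
qed

lemma computable_tuple_pfst: assumes "computable_tuple k f" shows "computable_tuple k (\<lambda>xs. pfst (f xs))"
proof -
  have "computable_tuple 1 (\<lambda>xs. (xs ! 0) - triangle (pfst (xs ! 0) + psnd (xs ! 0)))"
    by (intro computable_tuple_diff computable_tuple_proj computable_tuple_triangle computable_tuple_unpair_sum) auto
  moreover have "n - triangle (pfst n + psnd n) = pfst n" for n
    using arg_cong[OF prod_encode_pfst_psnd[of n], of "\<lambda>m. m - triangle (pfst n + psnd n)"]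
    unfolding prod_encode_def by simp
  ultimately have "computable_tuple 1 (\<lambda>xs. pfst (xs ! 0))" by simp
  from computable_tuple_comp1[OF this assms] show ?thesis by simp
qed

lemma computable_tuple_psnd: assumes "computable_tuple k f" shows "computable_tuple k (\<lambda>xs. psnd (f xs))"
proof -
  have "computable_tuple 1 (\<lambda>xs. (pfst (xs ! 0) + psnd (xs ! 0)) - pfst (xs ! 0))"
    by (intro computable_tuple_diff computable_tuple_proj computable_tuple_pfst computable_tuple_unpair_sum) auto
  from computable_tuple_comp1[OF this assms] show ?thesis by simp
qed

text \<open>
  A function of several variables is treated as a unary function of a nested pair, the context.
  Rules that bind a variable, such as the one for \<^const>\<open>rec_nat\<close> below, pair it with the
  context; their premises then mention \<^term>\<open>pfst n\<close> for the old context and \<^term>\<open>psnd n\<close> for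
  the new variable. The rules collected in \<open>computable_intros\<close> derive computability by following
  the syntax of a term.
\<close>

definition computable :: "(nat \<Rightarrow> nat) \<Rightarrow> bool" where
  "computable f \<longleftrightarrow> (\<exists>p. \<forall>n. computes p [n] (f n))"

lemma computable_iff_tuple: "computable f \<longleftrightarrow> computable_tuple 1 (\<lambda>xs. f (xs ! 0))"
proof -
  have "(\<forall>n. computes p [n] (f n)) \<longleftrightarrow> (\<forall>xs. length xs = 1 \<longrightarrow> computes p xs (f (xs ! 0)))" for p
    by (auto simp: length_Suc_conv)
  then show ?thesis unfolding computable_def computable_tuple_def by simp
qed

lemma computable_cong: "computable f \<Longrightarrow> (\<And>n. f n = g n) \<Longrightarrow> computable g"
  unfolding computable_def by simp

named_theorems computable_intros

lemma computable_id [computable_intros]: "computable (\<lambda>n. n)"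
  unfolding computable_iff_tuple by (rule computable_tuple_proj) simp

lemma computable_Suc [computable_intros]: "computable f \<Longrightarrow> computable (\<lambda>n. Suc (f n))"
  unfolding computable_iff_tuple by (rule computable_tuple_Suc)

lemma computable_const [computable_intros]: "computable (\<lambda>n. c)"
proof (induction c)
  case 0 then show ?case unfolding computable_iff_tuple by (rule computable_tuple_zero)
next
  case (Suc c) then show ?case by (rule computable_Suc)
qed

lemma computable_add [computable_intros]: "computable f \<Longrightarrow> computable g \<Longrightarrow> computable (\<lambda>n. f n + g n)"
  unfolding computable_iff_tuple by (rule computable_tuple_add)

lemma computable_diff [computable_intros]: "computable f \<Longrightarrow> computable g \<Longrightarrow> computable (\<lambda>n. f n - g n)"
  unfolding computable_iff_tuple by (rule computable_tuple_diff)

lemma computable_prod_encode [computable_intros]: "computable f \<Longrightarrow> computable g \<Longrightarrow> computable (\<lambda>n. prod_encode (f n, g n))"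
  unfolding computable_iff_tuple by (rule computable_tuple_prod_encode)

lemma computable_pfst [computable_intros]: "computable f \<Longrightarrow> computable (\<lambda>n. pfst (f n))"
  unfolding computable_iff_tuple by (rule computable_tuple_pfst)

lemma computable_psnd [computable_intros]: "computable f \<Longrightarrow> computable (\<lambda>n. psnd (f n))"
  unfolding computable_iff_tuple by (rule computable_tuple_psnd)

lemma computable_comp: assumes "computable f" "computable g" shows "computable (\<lambda>n. f (g n))"
  using computable_tuple_comp1[of "\<lambda>xs. f (xs ! 0)" 1 "\<lambda>xs. g (xs ! 0)"] assms
  unfolding computable_iff_tuple by simp

lemma computable_rec [computable_intros]:
  assumes a: "computable a" and h: "computable (\<lambda>n. h (pfst (pfst n)) (psnd (pfst n)) (psnd n))" and b: "computable b"
  shows "computable (\<lambda>n. rec_nat (a n) (h n) (b n))"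
proof -
  let ?H = "\<lambda>n. h (pfst (pfst n)) (psnd (pfst n)) (psnd n)"
  have "computable_tuple 3 (\<lambda>xs. ?H ([prod_encode (prod_encode (xs ! 2, xs ! 0), xs ! 1)] ! 0))"
    by (rule computable_tuple_comp1[of "\<lambda>xs. ?H (xs ! 0)"])
       (use h in \<open>auto simp: computable_iff_tuple intro!: computable_tuple_prod_encode computable_tuple_proj\<close>)
  then have "computable_tuple 3 (\<lambda>xs. h (xs ! 2) (xs ! 0) (xs ! 1))" by simp
  from computable_tuple_rec2[OF a[unfolded computable_iff_tuple] this]
  have "computable_tuple 2 (\<lambda>xs. rec_nat (a (xs ! 1)) (h (xs ! 1)) (xs ! 0))" by simp
  from computable_tuple_comp2[OF this b[unfolded computable_iff_tuple] computable_tuple_proj[of 0 1]]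
  show ?thesis unfolding computable_iff_tuple by simp
qed

lemma computable_Least_eq_0:
  assumes f: "computable (\<lambda>n. f (pfst n) (psnd n))" and ex: "\<And>n. \<exists>m. f n m = 0"
  shows "computable (\<lambda>n. LEAST m. f n m = 0)"
proof -
  have "computable_tuple 2 (\<lambda>xs. (\<lambda>n. f (pfst n) (psnd n)) ([prod_encode (xs ! 1, xs ! 0)] ! 0))"
    by (rule computable_tuple_comp1[of "\<lambda>xs. (\<lambda>n. f (pfst n) (psnd n)) (xs ! 0)"])
       (use f in \<open>auto simp: computable_iff_tuple intro!: computable_tuple_prod_encode computable_tuple_proj\<close>)
  then have "computable_tuple (Suc 1) (\<lambda>xs. f (xs ! 1) (xs ! 0))" by (simp add: numeral_2_eq_2)
  from computable_tuple_Least[OF this] ex show ?thesis unfolding computable_iff_tuple by simp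
qed

section \<open>Decidable predicates\<close>

definition decidable :: "(nat \<Rightarrow> bool) \<Rightarrow> bool" where
  "decidable P \<longleftrightarrow> computable (\<lambda>n. if P n then 1 else 0)"

lemma computable_mult [computable_intros]: assumes "computable f" "computable g" shows "computable (\<lambda>n. f n * g n)"
proof -
  have e: "rec_nat 0 (\<lambda>i r. r + y) x = x * y" for x y :: nat by (induction x) auto
  have "computable (\<lambda>n. rec_nat 0 (\<lambda>i r. r + g n) (f n))"
    by (intro computable_intros computable_comp[OF assms(2)] assms)
  then show ?thesis by (simp add: e)
qed

lemma computable_power [computable_intros]: assumes "computable f" "computable g" shows "computable (\<lambda>n. f n ^ g n)"
proof -
  have e: "rec_nat (Suc 0) (\<lambda>i r. r * x) y = x ^ y" for x y :: nat by (induction y) auto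
  have "computable (\<lambda>n. rec_nat (Suc 0) (\<lambda>i r. r * f n) (g n))"
    by (intro computable_intros computable_comp[OF assms(1)] assms)
  then show ?thesis by (simp add: e)
qed

lemma decidable_cong: "decidable P \<Longrightarrow> (\<And>n. P n \<longleftrightarrow> Q n) \<Longrightarrow> decidable Q"
  unfolding decidable_def by simp

lemma decidable_comp: "decidable P \<Longrightarrow> computable g \<Longrightarrow> decidable (\<lambda>n. P (g n))"
  unfolding decidable_def by (rule computable_comp)

lemma decidable_comp2:
  assumes "decidable (\<lambda>n. D (pfst n) (psnd n))" "computable a" "computable b"
  shows "decidable (\<lambda>n. D (a n) (b n))"
  using decidable_comp[OF assms(1) computable_prod_encode[OF assms(2,3)]] by simp

lemma decidable_not [computable_intros]: assumes "decidable P" shows "decidable (\<lambda>n. \<not> P n)"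
proof -
  have "computable (\<lambda>n. 1 - (if P n then 1 else 0))"
    using assms unfolding decidable_def by (intro computable_intros)
  then show ?thesis unfolding decidable_def by (rule computable_cong) auto
qed

lemma decidable_conj [computable_intros]: assumes "decidable P" "decidable Q" shows "decidable (\<lambda>n. P n \<and> Q n)"
proof -
  have "computable (\<lambda>n. (if P n then 1 else 0) * (if Q n then 1 else 0))"
    using assms unfolding decidable_def by (intro computable_intros)
  then show ?thesis unfolding decidable_def by (rule computable_cong) auto
qed

lemma decidable_disj [computable_intros]: assumes "decidable P" "decidable Q" shows "decidable (\<lambda>n. P n \<or> Q n)"
  by (rule decidable_cong[OF decidable_not[OF decidable_conj[OF decidable_not[OF assms(1)] decidable_not[OF assms(2)]]]]) blast

lemma decidable_imp [computable_intros]: assumes "decidable P" "decidable Q" shows "decidable (\<lambda>n. P n \<longrightarrow> Q n)"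
  by (rule decidable_cong[OF decidable_disj[OF decidable_not[OF assms(1)] assms(2)]]) blast

lemma decidable_iff [computable_intros]: assumes "decidable P" "decidable Q" shows "decidable (\<lambda>n. P n \<longleftrightarrow> Q n)"
  by (rule decidable_cong[OF decidable_conj[OF decidable_imp[OF assms] decidable_imp[OF assms(2,1)]]]) blast

lemma decidable_const [computable_intros]: "decidable (\<lambda>n. c)"
  unfolding decidable_def by (rule computable_const)

lemma decidable_le [computable_intros]: assumes "computable f" "computable g" shows "decidable (\<lambda>n. f n \<le> g n)"
proof -
  have "computable (\<lambda>n. 1 - (f n - g n))" using assms by (intro computable_intros)
  then show ?thesis unfolding decidable_def by (rule computable_cong) auto
qed

lemma decidable_less [computable_intros]: assumes "computable f" "computable g" shows "decidable (\<lambda>n. f n < g n)"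
  by (rule decidable_cong[OF decidable_le[OF computable_Suc[OF assms(1)] assms(2)]]) auto

lemma decidable_eq [computable_intros]: assumes "computable f" "computable g" shows "decidable (\<lambda>n. f n = g n)"
  by (rule decidable_cong[OF decidable_conj[OF decidable_le[OF assms] decidable_le[OF assms(2,1)]]]) auto

lemma computable_if [computable_intros]:
  assumes "decidable P" "computable f" "computable g" shows "computable (\<lambda>n. if P n then f n else g n)"
proof -
  have "computable (\<lambda>n. (if P n then 1 else 0) * f n + (1 - (if P n then 1 else 0)) * g n)"
    using assms unfolding decidable_def by (intro computable_intros)
  then show ?thesis by (rule computable_cong) auto
qed

lemma decidable_all_less [computable_intros]:
  assumes "decidable (\<lambda>n. P (pfst n) (psnd n))" "computable b"
  shows "decidable (\<lambda>n. \<forall>m<b n. P n m)"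
proof -
  have e: "rec_nat 1 (\<lambda>i r. if P n i then r else 0) x = (if \<forall>m<x. P n m then 1 else 0 :: nat)"
    for x n by (induction x) (auto simp: less_Suc_eq)
  have "computable (\<lambda>n. rec_nat 1 (\<lambda>i r. if P n i then r else 0) (b n))"
    by (intro computable_intros decidable_comp[OF assms(1), of "\<lambda>n. pfst n", simplified] assms)
  then show ?thesis unfolding e decidable_def .
qed

lemma decidable_ex_less [computable_intros]:
  assumes "decidable (\<lambda>n. P (pfst n) (psnd n))" "computable b"
  shows "decidable (\<lambda>n. \<exists>m<b n. P n m)"
  by (rule decidable_cong[OF decidable_not[OF decidable_all_less[OF decidable_not[OF assms(1)] assms(2)]]]) blast

lemma decidable_finite_mem:
  assumes "finite A" "computable f" shows "decidable (\<lambda>n. f n \<in> A)"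
  using assms(1)
proof (induction A)
  case empty then show ?case by (simp add: decidable_const)
next
  case (insert a A)
  then show ?case using decidable_disj[OF decidable_eq[OF assms(2) computable_const[of a]]] by simp
qed

lemma computable_Least:
  assumes P: "decidable (\<lambda>n. P (pfst n) (psnd n))" and ex: "\<And>n. \<exists>m. P n m"
  shows "computable (\<lambda>n. LEAST m. P n m)"
proof -
  have "computable (\<lambda>n. LEAST m. (if P n m then 0 else 1 :: nat) = 0)"
    using P ex by (intro computable_Least_eq_0 computable_if computable_const) auto
  then show ?thesis by (rule computable_cong) (simp cong: if_cong)
qed

lemma computable_div [computable_intros]: assumes "computable f" "computable g" shows "computable (\<lambda>n. f n div g n)"
proof -
  have e: "(LEAST q. y = 0 \<or> x < Suc q * y) = x div y" for x y :: nat
  proof (cases "y = 0")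
    case False
    show ?thesis
    proof (rule Least_equality)
      show "y = 0 \<or> x < Suc (x div y) * y"
        using dividend_less_div_times[of y x] False by simp
      show "x div y \<le> q" if "y = 0 \<or> x < Suc q * y" for q
        using that False less_mult_imp_div_less[of x "Suc q" y] by simp
    qed
  qed (simp add: Least_eq_0)
  have "computable (\<lambda>n. LEAST q. g n = 0 \<or> f n < Suc q * g n)"
  proof (rule computable_Least)
    show "decidable (\<lambda>n. g (pfst n) = 0 \<or> f (pfst n) < Suc (psnd n) * g (pfst n))"
      by (intro computable_intros computable_comp[OF assms(1)] computable_comp[OF assms(2)])
    show "\<exists>m. g n = 0 \<or> f n < Suc m * g n" for n
      by (rule exI[of _ "f n"]) (cases "g n", auto)
  qed
  then show ?thesis unfolding e .
qed

lemma computable_mod [computable_intros]: assumes "computable f" "computable g" shows "computable (\<lambda>n. f n mod g n)"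
  using computable_diff[OF assms(1) computable_mult[OF computable_div[OF assms] assms(2)]]
  by (simp add: minus_div_mult_eq_mod)

section \<open>Semidecidable predicates\<close>

text \<open>
  These are the \<open>\<Sigma>\<^sub>1\<close> predicates. The closure under bounded universal quantification below
  allows the quantification over all words of a given length.
\<close>

definition semidecidable :: "(nat \<Rightarrow> bool) \<Rightarrow> bool" where
  "semidecidable P \<longleftrightarrow> (\<exists>D. decidable (\<lambda>n. D (pfst n) (psnd n)) \<and> (\<forall>n. P n \<longleftrightarrow> (\<exists>m. D n m)))"

lemma semidecidableI:
  assumes "decidable (\<lambda>n. D (pfst n) (psnd n))" "\<And>n. P n \<longleftrightarrow> (\<exists>m. D n m)"
  shows "semidecidable P"
  using assms unfolding semidecidable_def by blast

lemma semidecidable_comp: assumes "semidecidable P" "computable f" shows "semidecidable (\<lambda>n. P (f n))"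
proof -
  obtain D where D: "decidable (\<lambda>n. D (pfst n) (psnd n))" "\<And>n. P n \<longleftrightarrow> (\<exists>m. D n m)"
    using assms(1) unfolding semidecidable_def by blast
  have "decidable (\<lambda>n. D (f (pfst n)) (psnd n))"
    by (intro decidable_comp2[OF D(1)] computable_intros computable_comp[OF assms(2)])
  then show ?thesis using D(2) by (rule semidecidableI[of "\<lambda>n. D (f n)"])
qed

lemma semidecidable_dec: assumes "decidable P" shows "semidecidable P"
  by (rule semidecidableI[of "\<lambda>n m. P n"]) (auto intro!: decidable_comp[OF assms] computable_intros)

lemma semidecidable_ex [computable_intros]:
  assumes "semidecidable (\<lambda>n. P (pfst n) (psnd n))"
  shows "semidecidable (\<lambda>n. \<exists>m. P n m)"
proof -
  obtain D where D: "decidable (\<lambda>n. D (pfst n) (psnd n))"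
    "\<And>n. P (pfst n) (psnd n) \<longleftrightarrow> (\<exists>m. D n m)"
    using assms unfolding semidecidable_def by blast
  show ?thesis
  proof (rule semidecidableI)
    show "decidable (\<lambda>n. D (prod_encode (pfst n, pfst (psnd n))) (psnd (psnd n)))"
      by (intro decidable_comp2[OF D(1)] computable_intros)
    show "(\<exists>m. P n m) \<longleftrightarrow> (\<exists>m. D (prod_encode (n, pfst m)) (psnd m))" for n
      using D(2)[of "prod_encode (n, _)"] by (metis pfst_encode psnd_encode)
  qed
qed

lemma semidecidable_conj [computable_intros]: assumes "semidecidable P" "semidecidable Q" shows "semidecidable (\<lambda>n. P n \<and> Q n)"
proof -
  obtain D where D: "decidable (\<lambda>n. D (pfst n) (psnd n))" "\<And>n. P n \<longleftrightarrow> (\<exists>m. D n m)"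
    using assms(1) unfolding semidecidable_def by blast
  obtain E where E: "decidable (\<lambda>n. E (pfst n) (psnd n))" "\<And>n. Q n \<longleftrightarrow> (\<exists>m. E n m)"
    using assms(2) unfolding semidecidable_def by blast
  show ?thesis
  proof (rule semidecidableI)
    show "decidable (\<lambda>n. D (pfst n) (pfst (psnd n)) \<and> E (pfst n) (psnd (psnd n)))"
      by (intro decidable_comp2[OF D(1)] decidable_comp2[OF E(1)] computable_intros)
    show "(P n \<and> Q n) \<longleftrightarrow> (\<exists>m. D n (pfst m) \<and> E n (psnd m))" for n
      unfolding D(2) E(2) by (metis pfst_encode psnd_encode)
  qed
qed

lemma semidecidable_disj [computable_intros]: assumes "semidecidable P" "semidecidable Q" shows "semidecidable (\<lambda>n. P n \<or> Q n)"
proof -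
  obtain D where D: "decidable (\<lambda>n. D (pfst n) (psnd n))" "\<And>n. P n \<longleftrightarrow> (\<exists>m. D n m)"
    using assms(1) unfolding semidecidable_def by blast
  obtain E where E: "decidable (\<lambda>n. E (pfst n) (psnd n))" "\<And>n. Q n \<longleftrightarrow> (\<exists>m. E n m)"
    using assms(2) unfolding semidecidable_def by blast
  show ?thesis
    by (rule semidecidableI[OF decidable_disj[OF D(1) E(1)]]) (auto simp: D(2) E(2))
qed

text \<open>
  Finitely many witnesses have a common bound.
\<close>

lemma semidecidable_all_less [computable_intros]:
  assumes "semidecidable (\<lambda>n. P (pfst n) (psnd n))" "computable b"
  shows "semidecidable (\<lambda>n. \<forall>m<b n. P n m)"
proof -
  obtain D where D: "decidable (\<lambda>n. D (pfst n) (psnd n))"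
    "\<And>n. P (pfst n) (psnd n) \<longleftrightarrow> (\<exists>m. D n m)"
    using assms(1) unfolding semidecidable_def by blast
  have D2: "P n i \<longleftrightarrow> (\<exists>m. D (prod_encode (n, i)) m)" for n i
    using D(2)[of "prod_encode (n, i)"] by simp
  show ?thesis
  proof (rule semidecidableI)
    have *: "decidable (\<lambda>n. D (prod_encode (pfst (pfst (pfst n)), psnd (pfst n))) (psnd n))"
      by (intro decidable_comp2[OF D(1)] computable_intros)
    show "decidable (\<lambda>n. \<forall>i<b (pfst n). \<exists>m<psnd n. D (prod_encode (pfst n, i)) m)"
      by (intro computable_intros computable_comp[OF assms(2)] *)
    show "(\<forall>i<b n. P n i) \<longleftrightarrow> (\<exists>M. \<forall>i<b n. \<exists>m<M. D (prod_encode (n, i)) m)" for n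
    proof
      assume "\<forall>i<b n. P n i"
      then obtain f where f: "\<And>i. i < b n \<Longrightarrow> D (prod_encode (n, i)) (f i)"
        unfolding D2 by metis
      have "f i < Suc (Max (f ` {..<b n}))" if "i < b n" for i
        using that by (simp add: less_Suc_eq_le)
      then show "\<exists>M. \<forall>i<b n. \<exists>m<M. D (prod_encode (n, i)) m" using f by blast
    qed (auto simp: D2)
  qed
qed

lemma semidecidable_ex_less [computable_intros]:
  assumes "semidecidable (\<lambda>n. P (pfst n) (psnd n))" "computable b"
  shows "semidecidable (\<lambda>n. \<exists>m<b n. P n m)"
  by (intro semidecidable_ex semidecidable_conj assms semidecidable_dec decidable_less computable_psnd computable_comp[OF assms(2)] computable_pfst computable_id)

lemma semidecidable_finite_ex [computable_intros]:
  assumes "finite A" "\<And>a. a \<in> A \<Longrightarrow> semidecidable (\<lambda>n. P a n)"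
  shows "semidecidable (\<lambda>n. \<exists>a\<in>A. P a n)"
  using assms
proof (induction A)
  case empty then show ?case by (simp add: semidecidable_dec decidable_const)
qed (auto intro: semidecidable_disj)

lemma semidecidable_finite_all [computable_intros]:
  assumes "finite A" "\<And>a. a \<in> A \<Longrightarrow> semidecidable (\<lambda>n. P a n)"
  shows "semidecidable (\<lambda>n. \<forall>a\<in>A. P a n)"
  using assms
proof (induction A)
  case empty then show ?case by (simp add: semidecidable_dec decidable_const)
qed (auto intro: semidecidable_conj)

text \<open>Post's theorem.\<close>

text \<open>
  Post's theorem: search for a witness of either predicate. The search need only halt on codes
  of instances, where one of the two holds.
\<close>

lemma decidable_problem_if_semidecidable:
  assumes "semidecidable Y" "semidecidable N"
    and "\<And>i. i \<in> I \<Longrightarrow> Y (code i) \<longleftrightarrow> P i" "\<And>i. i \<in> I \<Longrightarrow> N (code i) \<longleftrightarrow> \<not> P i"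
  shows "decidable_problem code I P"
proof -
  obtain D where D: "decidable (\<lambda>n. D (pfst n) (psnd n))" "\<And>n. Y n \<longleftrightarrow> (\<exists>m. D n m)"
    using assms(1) unfolding semidecidable_def by blast
  obtain E where E: "decidable (\<lambda>n. E (pfst n) (psnd n))" "\<And>n. N n \<longleftrightarrow> (\<exists>m. E n m)"
    using assms(2) unfolding semidecidable_def by blast
  have "decidable (\<lambda>n. D (psnd n) (pfst n) \<or> E (psnd n) (pfst n))"
    by (intro decidable_comp2[OF D(1)] decidable_comp2[OF E(1)] computable_intros)
  then have "computable (\<lambda>n. if D (psnd n) (pfst n) \<or> E (psnd n) (pfst n) then 0 else 1)"
    by (intro computable_if computable_const)
  then have "computable_tuple 2 (\<lambda>xs. (\<lambda>n. if D (psnd n) (pfst n) \<or> E (psnd n) (pfst n) then 0 else 1)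
      ([prod_encode (xs ! 0, xs ! 1)] ! 0))"
    unfolding computable_iff_tuple
    by (rule computable_tuple_comp1[of "\<lambda>xs. (\<lambda>n. if D (psnd n) (pfst n) \<or> E (psnd n) (pfst n) then 0 else 1) (xs ! 0)"])
       (auto intro!: computable_tuple_prod_encode computable_tuple_proj)
  then obtain p where "\<And>xs. length xs = 2 \<Longrightarrow>
      computes p xs (if D (xs ! 1) (xs ! 0) \<or> E (xs ! 1) (xs ! 0) then 0 else 1)"
    unfolding computable_tuple_def by auto
  from this[of "[_, _]"] have p: "computes p [m, n] (if D n m \<or> E n m then 0 else 1)" for m n
    by simp
  have "computable_tuple 2 (\<lambda>xs. (\<lambda>n. if D (pfst n) (psnd n) then 1 else 0) ([prod_encode (xs ! 0, xs ! 1)] ! 0))"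
    using D(1) unfolding decidable_def computable_iff_tuple
    by (rule computable_tuple_comp1[of "\<lambda>xs. (\<lambda>n. if D (pfst n) (psnd n) then 1 else 0) (xs ! 0)"])
       (auto intro!: computable_tuple_prod_encode computable_tuple_proj)
  then obtain q where "\<And>xs. length xs = 2 \<Longrightarrow>
      computes q xs (if D (xs ! 0) (xs ! 1) then 1 else 0)"
    unfolding computable_tuple_def by auto
  from this[of "[_, _]"] have q: "computes q [n, m] (if D n m then 1 else 0)" for m n
    by simp
  have "computes (Comp q [Proj 0, Mu p]) [code i] (if P i then 1 else 0)" if i: "i \<in> I" for i
  proof -
    let ?n = "code i"
    define m where "m = (LEAST m. D ?n m \<or> E ?n m)"
    have ex: "\<exists>m. D ?n m \<or> E ?n m"
      using assms(3,4)[OF i] D(2)[of ?n] E(2)[of ?n] by blast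
    have "computes (Mu p) [?n] m"
      unfolding m_def using ex p by (intro computes_Mu_Least) auto
    then have "computes (Comp q [Proj 0, Mu p]) [?n] (if D ?n m then 1 else 0)"
      by (intro computes_Comp[of _ _ "[?n, m]"] q) (use computes_Proj[of 0 "[?n]"] in auto)
    moreover have "D ?n m \<longleftrightarrow> P i"
      using LeastI_ex[OF ex] assms(3,4)[OF i] D(2)[of ?n] E(2)[of ?n] unfolding m_def by blast
    ultimately show ?thesis by simp
  qed
  then show ?thesis unfolding decidable_problem_def by blast
qed

lemma semidecidable_cong: "semidecidable P \<Longrightarrow> (\<And>n. P n \<longleftrightarrow> Q n) \<Longrightarrow> semidecidable Q"
  unfolding semidecidable_def by simp

lemma semidecidable_comp2:
  assumes "semidecidable (\<lambda>n. P (pfst n) (psnd n))" "computable a" "computable b"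
  shows "semidecidable (\<lambda>n. P (a n) (b n))"
  using semidecidable_comp[OF assms(1) computable_prod_encode[OF assms(2,3)]] by simp

section \<open>Lists and integers\<close>

definition code_drop :: "nat \<Rightarrow> nat \<Rightarrow> nat" where
  "code_drop c i = list_encode (drop i (list_decode c))"

definition code_length :: "nat \<Rightarrow> nat" where
  "code_length c = length (list_decode c)"

definition code_nth :: "nat \<Rightarrow> nat \<Rightarrow> nat" where
  "code_nth c i = pfst (code_drop c i - 1)"

lemma code_length_encode [simp]: "code_length (list_encode xs) = length xs"
  by (simp add: code_length_def)

lemma code_nth_encode [simp]: "i < length xs \<Longrightarrow> code_nth (list_encode xs) i = xs ! i"
  by (simp add: code_nth_def code_drop_def Cons_nth_drop_Suc[symmetric])

lemma code_nth_eq_nth: "i < code_length c \<Longrightarrow> code_nth c i = list_decode c ! i"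
  by (simp add: code_length_def code_nth_def code_drop_def Cons_nth_drop_Suc[symmetric])

lemma list_decode_Suc_prod_encode [simp]:
  "list_decode (Suc (prod_encode (x, c))) = x # list_decode c"
  by simp

lemma computable_code_drop [computable_intros]: assumes "computable f" "computable g" shows "computable (\<lambda>n. code_drop (f n) (g n))"
proof -
  have t: "psnd (list_encode xs - 1) = list_encode (tl xs)" for xs
  proof (cases xs)
    case Nil
    have "psnd 0 = 0" using psnd_encode[of 0 0] by (simp add: prod_encode_def)
    then show ?thesis using Nil by simp
  qed simp
  have e: "rec_nat c (\<lambda>i r. psnd (r - 1)) i = code_drop c i" for c i
    by (induction i) (use t in \<open>simp_all add: code_drop_def drop_Suc drop_tl\<close>)
  have "computable (\<lambda>n. rec_nat (f n) (\<lambda>i r. psnd (r - 1)) (g n))"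
    by (intro computable_intros assms)
  then show ?thesis unfolding e .
qed

lemma computable_code_nth [computable_intros]: assumes "computable f" "computable g" shows "computable (\<lambda>n. code_nth (f n) (g n))"
  unfolding code_nth_def by (intro computable_intros assms)

lemma computable_code_length [computable_intros]: assumes "computable f" shows "computable (\<lambda>n. code_length (f n))"
proof (rule computable_cong)
  show "computable (\<lambda>n. LEAST i. code_drop (f n) i = 0)"
  proof (rule computable_Least)
    show "decidable (\<lambda>n. code_drop (f (pfst n)) (psnd n) = 0)"
      by (intro computable_intros computable_comp[OF assms])
    show "\<exists>i. code_drop (f n) i = 0" for n
      by (rule exI[of _ "code_length (f n)"]) (simp add: code_drop_def code_length_def)
  qed
  have "list_encode xs = 0 \<longleftrightarrow> xs = []" for xs by (cases xs) auto
  then have "code_drop c i = 0 \<longleftrightarrow> code_length c \<le> i" for c i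
    by (simp add: code_drop_def code_length_def)
  then show "(LEAST i. code_drop (f n) i = 0) = code_length (f n)" for n
    by (auto intro: Least_equality)
qed

text \<open>
  Representing an integer function by a difference avoids case distinctions on signs.
\<close>

definition computable_int :: "(nat \<Rightarrow> int) \<Rightarrow> bool" where
  "computable_int f \<longleftrightarrow> (\<exists>a b. computable a \<and> computable b \<and> (\<forall>n. f n = int (a n) - int (b n)))"

lemma computable_intI: "computable a \<Longrightarrow> computable b \<Longrightarrow> (\<And>n. f n = int (a n) - int (b n)) \<Longrightarrow> computable_int f"
  unfolding computable_int_def by blast

lemma computable_int_int [computable_intros]: "computable f \<Longrightarrow> computable_int (\<lambda>n. int (f n))"
  by (rule computable_intI[of f "\<lambda>n. 0"]) (auto intro: computable_const)

lemma computable_int_const [computable_intros]: "computable_int (\<lambda>n. c)"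
  by (rule computable_intI[of "\<lambda>n. nat c" "\<lambda>n. nat (- c)"]) (auto intro: computable_const)

lemma computable_int_add [computable_intros]: assumes "computable_int f" "computable_int g" shows "computable_int (\<lambda>n. f n + g n)"
proof -
  obtain a b c d where *: "computable a" "computable b" "computable c" "computable d"
    "\<And>n. f n = int (a n) - int (b n)" "\<And>n. g n = int (c n) - int (d n)"
    using assms unfolding computable_int_def by metis
  show ?thesis
    by (rule computable_intI[of "\<lambda>n. a n + c n" "\<lambda>n. b n + d n"]) (auto simp: * intro!: computable_intros *(1-4))
qed

lemma computable_int_uminus [computable_intros]: assumes "computable_int f" shows "computable_int (\<lambda>n. - f n)"
proof -
  obtain a b where *: "computable a" "computable b" "\<And>n. f n = int (a n) - int (b n)"
    using assms unfolding computable_int_def by metis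
  show ?thesis by (rule computable_intI[OF *(2,1)]) (simp add: *)
qed

lemma computable_int_diff [computable_intros]: assumes "computable_int f" "computable_int g" shows "computable_int (\<lambda>n. f n - g n)"
  using computable_int_add[OF assms(1) computable_int_uminus[OF assms(2)]] by simp

lemma computable_nat [computable_intros]: assumes "computable_int f" shows "computable (\<lambda>n. nat (f n))"
proof -
  obtain a b where *: "computable a" "computable b" "\<And>n. f n = int (a n) - int (b n)"
    using assms unfolding computable_int_def by metis
  show ?thesis by (rule computable_cong[OF computable_diff[OF *(1,2)]]) (simp add: *)
qed

lemma decidable_int_le [computable_intros]: assumes "computable_int f" "computable_int g" shows "decidable (\<lambda>n. f n \<le> g n)"
  by (rule decidable_cong[OF decidable_eq[OF computable_nat[OF computable_int_diff[OF assms]] computable_const[of 0]]]) auto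

lemma computable_int_comp: assumes "computable_int f" "computable g" shows "computable_int (\<lambda>n. f (g n))"
proof -
  obtain a b where ab: "computable a" "computable b" "\<And>n. f n = int (a n) - int (b n)"
    using assms(1) unfolding computable_int_def by blast
  show ?thesis
    by (rule computable_intI[OF computable_comp[OF ab(1) assms(2)] computable_comp[OF ab(2) assms(2)]]) (simp add: ab)
qed

lemma computable_int_int_decode [computable_intros]: assumes "computable f" shows "computable_int (\<lambda>n. int_decode (f n))"
proof (rule computable_intI)
  show "computable (\<lambda>n. if f n mod 2 = 0 then f n div 2 else 0)"
    "computable (\<lambda>n. if f n mod 2 = 0 then 0 else Suc (f n div 2))"
    by (intro computable_intros assms)+
  show "int_decode (f n) = int (if f n mod 2 = 0 then f n div 2 else 0) -
      int (if f n mod 2 = 0 then 0 else Suc (f n div 2))" for n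
    by (auto simp: int_decode_def sum_decode_def even_iff_mod_2_eq_zero)
qed

section \<open>Recursively enumerable sets\<close>

lemma computes_Comp_iff:
  "computes (Comp f gs) xs z \<longleftrightarrow>
     (\<exists>ys. length ys = length gs \<and> (\<forall>j<length gs. computes (gs ! j) xs (ys ! j)) \<and> computes f ys z)"
proof
  assume "computes (Comp f gs) xs z"
  then show "\<exists>ys. length ys = length gs \<and> (\<forall>j<length gs. computes (gs ! j) xs (ys ! j)) \<and> computes f ys z"
    by (rule computes_CompE) (auto simp: list_all2_conv_all_nth)
next
  assume "\<exists>ys. length ys = length gs \<and> (\<forall>j<length gs. computes (gs ! j) xs (ys ! j)) \<and> computes f ys z"
  then obtain ys where "length ys = length gs" "\<forall>j<length gs. computes (gs ! j) xs (ys ! j)"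
    "computes f ys z" by blast
  then show "computes (Comp f gs) xs z"
    by (intro computes_Comp[of _ _ ys]) (auto simp: list_all2_conv_all_nth)
qed

lemma computes_PrimRec_iff:
  "computes (PrimRec f g) (n # xs) z \<longleftrightarrow>
     (\<exists>ys. length ys = Suc n \<and> computes f xs (ys ! 0) \<and>
        (\<forall>i<n. computes g (i # ys ! i # xs) (ys ! Suc i)) \<and> ys ! n = z)"
proof (induction n arbitrary: z)
  case 0
  show ?case
    by (auto elim!: computes_PrimRec_0E intro: computes_PrimRec_0 intro!: exI[of _ "[z]"])
next
  case (Suc n)
  show ?case
  proof
    assume "computes (PrimRec f g) (Suc n # xs) z"
    then obtain y where y: "computes (PrimRec f g) (n # xs) y" "computes g (n # y # xs) z"
      by (rule computes_PrimRec_SucE)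
    then obtain ys where ys: "length ys = Suc n" "computes f xs (ys ! 0)"
      "\<forall>i<n. computes g (i # ys ! i # xs) (ys ! Suc i)" "ys ! n = y"
      unfolding Suc by blast
    show "\<exists>ys. length ys = Suc (Suc n) \<and> computes f xs (ys ! 0) \<and>
        (\<forall>i<Suc n. computes g (i # ys ! i # xs) (ys ! Suc i)) \<and> ys ! Suc n = z"
      using ys y by (intro exI[of _ "ys @ [z]"]) (auto simp: nth_append less_Suc_eq)
  next
    assume "\<exists>ys. length ys = Suc (Suc n) \<and> computes f xs (ys ! 0) \<and>
        (\<forall>i<Suc n. computes g (i # ys ! i # xs) (ys ! Suc i)) \<and> ys ! Suc n = z"
    then obtain ys where ys: "length ys = Suc (Suc n)" "computes f xs (ys ! 0)"
      "\<forall>i<Suc n. computes g (i # ys ! i # xs) (ys ! Suc i)" "ys ! Suc n = z" by blast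
    have "computes (PrimRec f g) (n # xs) (ys ! n)"
      unfolding Suc using ys by (intro exI[of _ "butlast ys"]) (auto simp: nth_butlast)
    then show "computes (PrimRec f g) (Suc n # xs) z"
      using ys by (auto intro: computes_PrimRec_Suc)
  qed
qed

lemma computes_Mu_iff:
  "computes (Mu f) xs n \<longleftrightarrow>
     computes f (n # xs) 0 \<and> (\<forall>i<n. \<exists>y. computes f (i # xs) y \<and> y > 0)"
  by (auto elim!: computes_MuE intro: computes_Mu)

text \<open>
  The graph of a partial recursive function is \<open>\<Sigma>\<^sub>1\<close>: by induction on the program, a computation
  is described by existential quantifiers over the intermediate results and bounded universal
  quantifiers over the steps. This replaces an evaluation with bounded running time.
\<close>

lemma semidecidable_computes: "semidecidable (\<lambda>n. computes p (list_decode (pfst n)) (psnd n))"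
proof (induction p)
  case Zero
  have "semidecidable (\<lambda>n. psnd n = 0)" by (intro semidecidable_dec computable_intros)
  then show ?case by (rule semidecidable_cong) (auto elim: computes_ZeroE intro: computes_Zero)
next
  case Succ
  have "semidecidable (\<lambda>n. code_length (pfst n) = 1 \<and> psnd n = Suc (code_nth (pfst n) 0))"
    by (intro semidecidable_dec computable_intros)
  then show ?case
  proof (rule semidecidable_cong)
    fix n
    show "(code_length (pfst n) = 1 \<and> psnd n = Suc (code_nth (pfst n) 0)) \<longleftrightarrow>
      computes Succ (list_decode (pfst n)) (psnd n)"
      using code_nth_eq_nth[of 0 "pfst n"]
      by (auto elim!: computes_SuccE intro: computes_Succ simp: code_length_def length_Suc_conv)
  qed
next
  case (Proj i)
  have "semidecidable (\<lambda>n. i < code_length (pfst n) \<and> psnd n = code_nth (pfst n) i)"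
    by (intro semidecidable_dec computable_intros)
  then show ?case
    by (rule semidecidable_cong)
       (auto elim!: computes_ProjE intro: computes_Proj simp: code_length_def code_nth_eq_nth)
next
  case (Comp f gs)
  have f: "computable a \<Longrightarrow> computable b \<Longrightarrow> semidecidable (\<lambda>n. computes f (list_decode (a n)) (b n))" for a b
    by (rule semidecidable_comp2[OF Comp.IH(1)])
  have g: "computable a \<Longrightarrow> computable b \<Longrightarrow> semidecidable (\<lambda>n. computes g (list_decode (a n)) (b n))"
    if "g \<in> set gs" for a b g
    by (rule semidecidable_comp2[OF Comp.IH(2)[OF that]])
  have "semidecidable (\<lambda>n. \<exists>c. code_length c = length gs \<and>
      (\<forall>j\<in>{..<length gs}. computes (gs ! j) (list_decode (pfst n)) (code_nth c j)) \<and>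
      computes f (list_decode c) (psnd n))"
    by (intro semidecidable_ex semidecidable_conj semidecidable_finite_all f g semidecidable_dec[OF decidable_eq] computable_intros) auto
  then show ?case
  proof (rule semidecidable_cong)
    fix n
    show "(\<exists>c. code_length c = length gs \<and>
      (\<forall>j\<in>{..<length gs}. computes (gs ! j) (list_decode (pfst n)) (code_nth c j)) \<and>
      computes f (list_decode c) (psnd n)) \<longleftrightarrow>
      computes (Comp f gs) (list_decode (pfst n)) (psnd n)" (is "?l \<longleftrightarrow> ?r")
    proof
      show "?l \<Longrightarrow> ?r" unfolding computes_Comp_iff
        by (auto simp: code_nth_eq_nth) (metis lessThan_iff code_length_def code_nth_eq_nth)
      assume ?r
      then obtain ys where "length ys = length gs" "computes f ys (psnd n)"
        "\<forall>j<length gs. computes (gs ! j) (list_decode (pfst n)) (ys ! j)"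
        unfolding computes_Comp_iff by blast
      then show ?l by (intro exI[of _ "list_encode ys"]) auto
    qed
  qed
next
  case (PrimRec f g)
  have f: "computable a \<Longrightarrow> computable b \<Longrightarrow> semidecidable (\<lambda>n. computes f (list_decode (a n)) (b n))" for a b
    by (rule semidecidable_comp2[OF PrimRec.IH(1)])
  have g: "computable a \<Longrightarrow> computable b \<Longrightarrow> computable c \<Longrightarrow> computable d \<Longrightarrow>
      semidecidable (\<lambda>n. computes g (a n # b n # list_decode (c n)) (d n))" for a b c d
    using semidecidable_comp2[OF PrimRec.IH(2)
        computable_Suc[OF computable_prod_encode[of a "\<lambda>n. Suc (prod_encode (b n, c n))"]], of d]
    by (simp add: computable_Suc computable_prod_encode)
  have "semidecidable (\<lambda>n. \<exists>m. \<exists>c. \<exists>ys. pfst n = Suc (prod_encode (m, c)) \<and> code_length ys = Suc m \<and>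
      computes f (list_decode c) (code_nth ys 0) \<and>
      (\<forall>i<m. computes g (i # code_nth ys i # list_decode c) (code_nth ys (Suc i))) \<and> code_nth ys m = psnd n)"
    by (intro semidecidable_ex semidecidable_conj semidecidable_all_less f g semidecidable_dec[OF decidable_eq] computable_intros)
  then show ?case
  proof (rule semidecidable_cong)
    fix n
    show "(\<exists>m. \<exists>c. \<exists>ys. pfst n = Suc (prod_encode (m, c)) \<and> code_length ys = Suc m \<and>
      computes f (list_decode c) (code_nth ys 0) \<and>
      (\<forall>i<m. computes g (i # code_nth ys i # list_decode c) (code_nth ys (Suc i))) \<and> code_nth ys m = psnd n)
      \<longleftrightarrow> computes (PrimRec f g) (list_decode (pfst n)) (psnd n)" (is "?l \<longleftrightarrow> ?r")
    proof
      assume ?l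
      then obtain m c ys where *: "pfst n = Suc (prod_encode (m, c))" "code_length ys = Suc m"
        "computes f (list_decode c) (code_nth ys 0)" "code_nth ys m = psnd n"
        "\<forall>i<m. computes g (i # code_nth ys i # list_decode c) (code_nth ys (Suc i))" by blast
      then show ?r
        by (auto simp: computes_PrimRec_iff code_nth_eq_nth code_length_def intro!: exI[of _ "list_decode ys"])
    next
      assume r: ?r
      then obtain m xs where mx: "list_decode (pfst n) = m # xs"
        by (cases "list_decode (pfst n)") (auto elim: computes.cases)
      then have p: "pfst n = Suc (prod_encode (m, list_encode xs))"
        by (metis list_decode_inverse list_encode.simps(2))
      from r obtain ys where "length ys = Suc m" "computes f xs (ys ! 0)"
        "\<forall>i<m. computes g (i # ys ! i # xs) (ys ! Suc i)" "ys ! m = psnd n"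
        unfolding mx computes_PrimRec_iff by blast
      then show ?l
        by (intro exI[of _ m] exI[of _ "list_encode xs"] exI[of _ "list_encode ys"])
           (auto simp: p)
    qed
  qed
next
  case (Mu f)
  have f: "computable a \<Longrightarrow> computable b \<Longrightarrow> computable c \<Longrightarrow>
      semidecidable (\<lambda>n. computes f (a n # list_decode (b n)) (c n))" for a b c
    using semidecidable_comp2[OF Mu.IH computable_Suc[OF computable_prod_encode[of a b]], of c] by simp
  show ?case unfolding computes_Mu_iff
    by (intro semidecidable_conj semidecidable_all_less semidecidable_ex f semidecidable_dec[OF decidable_less] computable_intros)
qed

lemma semidecidable_mem_recursively_enumerable:
  assumes "recursively_enumerable A" "computable f"
  shows "semidecidable (\<lambda>n. f n \<in> A)"
proof -
  obtain p where p: "\<And>n. n \<in> A \<longleftrightarrow> (\<exists>y. computes p [n] y)"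
    using assms(1) unfolding recursively_enumerable_def by blast
  have "semidecidable (\<lambda>n. \<exists>y. computes p (list_decode (Suc (prod_encode (f n, 0)))) y)"
    by (intro semidecidable_ex semidecidable_comp2[OF semidecidable_computes] computable_intros computable_comp[OF assms(2)])
  then show ?thesis by (rule semidecidable_cong) (simp add: p)
qed

section \<open>Subshifts\<close>

text \<open>
  Agreement on centred windows describes the product topology: it gives the basic
  neighbourhoods of a point.
\<close>

definition agree :: "nat \<Rightarrow> (int \<Rightarrow> 'a) \<Rightarrow> (int \<Rightarrow> 'a) \<Rightarrow> bool" where
  "agree n x y \<longleftrightarrow> (\<forall>i. \<bar>i\<bar> \<le> int n \<longrightarrow> x i = y i)"

definition translate :: "int \<Rightarrow> (int \<Rightarrow> 'a) \<Rightarrow> int \<Rightarrow> 'a" where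
  "translate t x = (\<lambda>i. x (i + t))"

lemma translate_apply [simp]: "translate t x i = x (i + t)"
  by (simp add: translate_def)

lemma translate_0 [simp]: "translate 0 x = x"
  by (simp add: translate_def)

lemma translate_translate [simp]: "translate s (translate t x) = translate (s + t) x"
  by (simp add: translate_def fun_eq_iff add_ac)

lemma shift_eq_translate: "shift = translate 1"
  by (simp add: shift_def translate_def fun_eq_iff)

lemma shift_power_eq_translate: "(shift ^^ i) x = translate (int i) x"
proof (induction i)
  case (Suc i)
  then show ?case by (simp only: funpow.simps o_apply shift_eq_translate translate_translate) simp
qed simp

lemma agree_refl [simp]: "agree n x x"
  by (simp add: agree_def)

lemma agree_sym: "agree n x y \<Longrightarrow> agree n y x"
  by (simp add: agree_def)

lemma agree_trans: "agree n x y \<Longrightarrow> agree n y z \<Longrightarrow> agree n x z"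
  by (simp add: agree_def)

lemma agree_mono: "m \<le> n \<Longrightarrow> agree n x y \<Longrightarrow> agree m x y"
  by (simp add: agree_def)

lemma agree_translate: "agree (n + nat \<bar>t\<bar>) x y \<Longrightarrow> agree n (translate t x) (translate t y)"
  by (simp add: agree_def)

lemma agree_all: "(\<And>n. agree n x y) \<Longrightarrow> x = y"
  unfolding agree_def by (metis abs_ge_zero nat_0_le order_refl ext)

lemma length_factor [simp]: "length (factor x k n) = n"
  by (simp add: factor_def)

lemma factor_translate [simp]: "factor (translate t x) k n = factor x (k + t) n"
  by (simp add: factor_def add_ac)

lemma factor_eq_iff:
  "factor x k n = u \<longleftrightarrow> length u = n \<and> (\<forall>j<n. x (k + int j) = u ! j)"
  by (auto simp: factor_def list_eq_iff_nth_eq)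

lemma factor_agree_cong:
  assumes "agree s x y" "\<bar>k\<bar> + int n \<le> int s"
  shows "factor x k n = factor y k n"
  using assms by (auto simp: factor_def agree_def)

lemma factor_window_eq_iff:
  "factor y (- int n) (Suc (2 * n)) = factor x (- int n) (Suc (2 * n)) \<longleftrightarrow> agree n y x"
proof
  assume *: "factor y (- int n) (Suc (2 * n)) = factor x (- int n) (Suc (2 * n))"
  show "agree n y x" unfolding agree_def
  proof (intro allI impI)
    fix i :: int assume i: "\<bar>i\<bar> \<le> int n"
    then have "nat (i + int n) < Suc (2 * n)" by auto
    with * have "y (- int n + int (nat (i + int n))) = x (- int n + int (nat (i + int n)))"
      unfolding factor_def map_eq_conv by (metis atLeastLessThan_iff le0 set_upt)
    moreover have "int (nat (i + int n)) = i + int n" using i by auto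
    ultimately show "y i = x i" by simp
  qed
qed (auto simp: factor_def agree_def)

lemma closedin_iff_agree:
  "closedin (product_topology (\<lambda>_::int. discrete_topology S) UNIV) X \<longleftrightarrow>
     (\<forall>x\<in>X. \<forall>i. x i \<in> S) \<and> (\<forall>x. (\<forall>n. \<exists>y\<in>X. agree n x y) \<longrightarrow> x \<in> X)"
    (is "closedin ?T X \<longleftrightarrow> ?R")
proof
  assume cl: "closedin ?T X"
  then have val: "\<forall>x\<in>X. \<forall>i. x i \<in> S"
    using closedin_subset[OF cl] by (auto simp: PiE_iff subset_iff)
  have "x \<in> X" if app: "\<forall>n. \<exists>y\<in>X. agree n x y" for x
  proof (rule ccontr)
    assume nx: "x \<notin> X"
    have "x i \<in> S" for i
    proof -
      obtain y where "y \<in> X" "agree (nat \<bar>i\<bar>) x y" using app by blast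
      then show ?thesis using val by (auto simp: agree_def)
    qed
    with nx have xT: "x \<in> topspace ?T - X" by (simp add: PiE_iff)
    have op: "openin ?T (topspace ?T - X)" using cl by (simp add: closedin_def)
    obtain V where V: "finite {i \<in> UNIV. V i \<noteq> topspace (discrete_topology S)}"
      "x \<in> PiE UNIV V" "PiE UNIV V \<subseteq> topspace ?T - X"
      using bspec[OF op[unfolded openin_product_topology_alt] xT] by blast
    define J where "J = {i. V i \<noteq> S}"
    have J: "finite J" using V(1) by (simp add: J_def)
    define n where "n = nat (Max (insert 0 (abs ` J)))"
    have n: "\<bar>i\<bar> \<le> int n" if "i \<in> J" for i
    proof -
      have "\<bar>i\<bar> \<le> Max (insert 0 (abs ` J))" using J that by (intro Max_ge) auto
      then show ?thesis unfolding n_def by linarith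
    qed
    obtain y where y: "y \<in> X" "agree n x y" using app by blast
    have "y i \<in> V i" for i
    proof (cases "i \<in> J")
      case True
      then have "x i = y i" using n[OF True] y(2) unfolding agree_def by blast
      moreover have "x i \<in> V i" using V(2) by (simp add: PiE_iff)
      ultimately show ?thesis by simp
    next
      case False
      then show ?thesis using val y(1) by (auto simp: J_def)
    qed
    then show False using V(3) y(1) by (auto simp: PiE_iff)
  qed
  then show ?R using val by blast
next
  assume R: ?R
  have "openin ?T (topspace ?T - X)"
    unfolding openin_product_topology_alt
  proof
    fix x assume x: "x \<in> topspace ?T - X"
    then obtain n where n: "\<And>y. y \<in> X \<Longrightarrow> \<not> agree n x y" using R by blast
    define V where "V = (\<lambda>i::int. if \<bar>i\<bar> \<le> int n then {x i} else S)"
    have xS: "x i \<in> S" for i using x by (auto simp: PiE_iff)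
    have "finite {i \<in> UNIV. V i \<noteq> topspace (discrete_topology S)}"
      by (rule finite_subset[of _ "{- int n..int n}"]) (auto simp: V_def split: if_splits)
    moreover have "\<forall>i\<in>UNIV. openin (discrete_topology S) (V i)"
      using xS by (auto simp: V_def)
    moreover have "x \<in> PiE UNIV V" using xS by (auto simp: PiE_iff V_def)
    moreover have "PiE UNIV V \<subseteq> topspace ?T - X"
    proof
      fix y assume y: "y \<in> PiE UNIV V"
      have "y i \<in> V i" for i using y by (simp add: PiE_iff)
      then have "agree n x y" unfolding agree_def V_def by (metis singletonD)
      moreover have "y i \<in> S" for i
      proof -
        have "y i \<in> V i" using y by (simp add: PiE_iff)
        then show ?thesis using xS[of i] by (simp add: V_def split: if_splits)
      qed
      ultimately show "y \<in> topspace ?T - X" using n by (auto simp: PiE_iff)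
    qed
    ultimately show "\<exists>V. finite {i \<in> UNIV. V i \<noteq> topspace (discrete_topology S)} \<and>
        (\<forall>i\<in>UNIV. openin (discrete_topology S) (V i)) \<and> x \<in> PiE UNIV V \<and> PiE UNIV V \<subseteq> topspace ?T - X"
      by blast
  qed
  then show "closedin ?T X" using R by (auto simp: closedin_def PiE_iff)
qed

lemma subshift_iff:
  "subshift S X \<longleftrightarrow> (\<forall>x\<in>X. \<forall>i. x i \<in> S) \<and> (\<forall>x. (\<forall>n. \<exists>y\<in>X. agree n x y) \<longrightarrow> x \<in> X) \<and>
     (\<forall>x\<in>X. \<forall>t. translate t x \<in> X)"
proof -
  have "shift ` X = X \<longleftrightarrow> (\<forall>x\<in>X. \<forall>t. translate t x \<in> X)"
  proof
    assume eq: "shift ` X = X"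
    have pos: "translate (int k) x \<in> X" if "x \<in> X" for k x
      using that
    proof (induction k)
      case (Suc k)
      have "translate (int (Suc k)) x = shift (translate (int k) x)" by (simp add: shift_eq_translate)
      then show ?case using Suc eq by blast
    qed simp
    have neg: "translate (- int k) x \<in> X" if "x \<in> X" for k x
      using that
    proof (induction k)
      case (Suc k)
      then obtain y where y: "y \<in> X" "translate (- int k) x = translate 1 y"
        using eq unfolding shift_eq_translate by blast
      then have "translate (-1) (translate (- int k) x) = y" by simp
      then have "translate (- int (Suc k)) x = y" by (simp add: algebra_simps)
      then show ?case using y by simp
    qed simp
    show "\<forall>x\<in>X. \<forall>t. translate t x \<in> X"
    proof (intro ballI allI)
      fix x t assume "x \<in> X"
      then show "translate t x \<in> X" using pos neg by (cases t rule: int_cases2) auto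
    qed
  next
    assume inv: "\<forall>x\<in>X. \<forall>t. translate t x \<in> X"
    show "shift ` X = X"
    proof
      show "shift ` X \<subseteq> X" using inv by (auto simp: shift_eq_translate)
      show "X \<subseteq> shift ` X"
      proof
        fix x assume "x \<in> X"
        then have "translate (-1) x \<in> X" "x = shift (translate (-1) x)"
          using inv by (auto simp: shift_eq_translate)
        then show "x \<in> shift ` X" by blast
      qed
    qed
  qed
  then show ?thesis unfolding subshift_def closedin_iff_agree by blast
qed

lemma subshift_translate: "subshift S X \<Longrightarrow> x \<in> X \<Longrightarrow> translate t x \<in> X"
  by (simp add: subshift_iff)

lemma subshift_limit: "subshift S X \<Longrightarrow> (\<And>n. \<exists>y\<in>X. agree n x y) \<Longrightarrow> x \<in> X"
  by (simp add: subshift_iff)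

lemma subshift_value: "subshift S X \<Longrightarrow> x \<in> X \<Longrightarrow> x i \<in> S"
  by (simp add: subshift_iff)

lemma subshift_subsetI:
  assumes "subshift S X" "Y \<subseteq> X"
    and "\<And>x t. x \<in> Y \<Longrightarrow> translate t x \<in> Y"
    and "\<And>x. x \<in> X \<Longrightarrow> (\<And>n. \<exists>y\<in>Y. agree n x y) \<Longrightarrow> x \<in> Y"
  shows "subshift S Y"
proof -
  have "x \<in> Y" if x: "\<forall>n. \<exists>y\<in>Y. agree n x y" for x
  proof (rule assms(4))
    show "x \<in> X" using x assms(1,2) by (intro subshift_limit) blast+
  qed (use x in blast)
  then show ?thesis using assms(1-3) unfolding subshift_iff by blast
qed

text \<open>
  Compactness for an increasing sequence of relatively open predicates that covers the subshift:
  the complements are nested closed sets with empty intersection.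
\<close>

lemma subshift_compact:
  assumes X: "subshift S X" and S: "finite S"
    and mono: "\<And>m n y. m \<le> n \<Longrightarrow> G m y \<Longrightarrow> G n y"
    and opn: "\<And>n y. y \<in> X \<Longrightarrow> G n y \<Longrightarrow> \<exists>s. \<forall>z\<in>X. agree s y z \<longrightarrow> G n z"
    and cover: "\<And>y. y \<in> X \<Longrightarrow> \<exists>n. G n y"
  shows "\<exists>n::nat. \<forall>y\<in>X. G n y"
proof (rule ccontr)
  assume neg: "\<nexists>n. \<forall>y\<in>X. G n y"
  define C where "C = (\<lambda>n. {y \<in> X. \<not> G n y})"
  have "(\<Inter>n. C n) \<noteq> {}"
  proof (rule compact_space_imp_nest)
    show "compact_space (product_topology (\<lambda>_::int. discrete_topology S) UNIV)"
      using S by (intro compact_space_product_topology[THEN iffD2])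
        (simp add: compact_space_discrete_topology)
    show "closedin (product_topology (\<lambda>_::int. discrete_topology S) UNIV) (C n)" for n
      unfolding closedin_iff_agree
    proof (intro conjI allI impI)
      show "\<forall>x\<in>C n. \<forall>i. x i \<in> S" using subshift_value[OF X] by (auto simp: C_def)
      fix x assume x: "\<forall>k. \<exists>y\<in>C n. agree k x y"
      then have xX: "x \<in> X" by (intro subshift_limit[OF X]) (auto simp: C_def)
      moreover have "\<not> G n x"
      proof
        assume "G n x"
        then obtain s where s: "\<forall>z\<in>X. agree s x z \<longrightarrow> G n z" using opn[OF xX] by blast
        then show False using x by (auto simp: C_def)
      qed
      ultimately show "x \<in> C n" by (simp add: C_def)
    qed
    show "C n \<noteq> {}" for n using neg by (auto simp: C_def)
    show "decseq C" using mono by (auto simp: C_def decseq_def)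
  qed
  then show False using cover by (auto simp: C_def)
qed

lemma language_iff:
  assumes "subshift S X"
  shows "r \<in> language X \<longleftrightarrow> (\<exists>x\<in>X. factor x t (length r) = r)"
proof
  assume "r \<in> language X"
  then obtain x k where x: "x \<in> X" "factor x k (length r) = r"
    unfolding language_def by auto
  then show "\<exists>x\<in>X. factor x t (length r) = r"
    by (intro bexI[of _ "translate (k - t) x"] subshift_translate[OF assms]) auto
next
  assume "\<exists>x\<in>X. factor x t (length r) = r"
  then obtain x where "x \<in> X" "r = factor x t (length r)" by metis
  then show "r \<in> language X" unfolding language_def by blast
qed

lemma language_lists:
  assumes "subshift S X" shows "language X \<subseteq> lists S"
  using subshift_value[OF assms] by (auto simp: language_def factor_def)

lemma separating_word:
  assumes Y: "subshift S Y" and Z: "subshift S Z" and nsub: "\<not> Z \<subseteq> Y"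
  shows "\<exists>r. r \<in> language Z \<and> r \<notin> language Y"
proof -
  obtain z where z: "z \<in> Z" "z \<notin> Y" using nsub by blast
  then obtain n where n: "\<And>y. y \<in> Y \<Longrightarrow> \<not> agree n z y"
    using subshift_limit[OF Y] by blast
  define r where "r = factor z (- int n) (Suc (2 * n))"
  have "r \<in> language Z" unfolding r_def language_def using z by blast
  moreover have "r \<notin> language Y"
    unfolding language_iff[OF Y, of _ "- int n"] r_def
    using n agree_sym by (fastforce simp: factor_window_eq_iff)
  ultimately show ?thesis by blast
qed

lemma finite_subshifts:
  assumes "quasiminimal S X"
  shows "finite {Y. subshift S Y \<and> Y \<subseteq> X}"
proof -
  have "{Y. subshift S Y \<and> Y \<subseteq> X} \<subseteq> insert X {Y. subshift S Y \<and> Y \<subset> X}" by auto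
  then show ?thesis using assms unfolding quasiminimal_def by (meson finite_insert finite_subset)
qed

definition excluded :: "(int \<Rightarrow> 'a) set \<Rightarrow> (int \<Rightarrow> 'a) set \<Rightarrow> 'a list set \<Rightarrow> bool" where
  "excluded X Y W \<longleftrightarrow> Y = {x \<in> X. \<forall>r\<in>W. \<forall>t. factor x t (length r) \<noteq> r}"

text \<open>
  Choose for each of the finitely many subshifts \<open>Z \<subseteq> X\<close> not contained in \<open>Y\<close> a word of \<open>Z\<close> that does
  not occur in \<open>Y\<close>. The points of \<open>X\<close> avoiding these words form a subshift that contains \<open>Y\<close>; were
  it not contained in \<open>Y\<close>, it would contain one of the avoided words.
\<close>

lemma exclusion_words:
  assumes q: "quasiminimal S X" and Y: "subshift S Y" "Y \<subseteq> X"
  shows "\<exists>W. finite W \<and> W \<subseteq> lists S \<and> excluded X Y W"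
proof -
  have X: "subshift S X" using q by (simp add: quasiminimal_def)
  define \<Z> where "\<Z> = {Z. subshift S Z \<and> Z \<subseteq> X \<and> \<not> Z \<subseteq> Y}"
  have fin: "finite \<Z>"
    unfolding \<Z>_def by (rule finite_subset[OF _ finite_subshifts[OF q]]) blast
  have "\<forall>Z\<in>\<Z>. \<exists>r. r \<in> language Z \<and> r \<notin> language Y"
    using separating_word[OF Y(1)] by (auto simp: \<Z>_def)
  then obtain r where r: "\<And>Z. Z \<in> \<Z> \<Longrightarrow> r Z \<in> language Z \<and> r Z \<notin> language Y" by metis
  define W where "W = r ` \<Z>"
  define Y' where "Y' = {x \<in> X. \<forall>r\<in>W. \<forall>t. factor x t (length r) \<noteq> r}"
  have Y': "subshift S Y'"
  proof (rule subshift_subsetI[OF X])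
    show "Y' \<subseteq> X" by (auto simp: Y'_def)
    show "translate t x \<in> Y'" if "x \<in> Y'" for x t
      using that subshift_translate[OF X] by (auto simp: Y'_def)
    fix x assume x: "x \<in> X" "\<And>n. \<exists>y\<in>Y'. agree n x y"
    have "factor x t (length u) \<noteq> u" if u: "u \<in> W" for u t
    proof -
      obtain y where y: "y \<in> Y'" "agree (nat \<bar>t\<bar> + length u) x y" using x(2) by blast
      have "factor x t (length u) = factor y t (length u)"
        by (rule factor_agree_cong[OF y(2)]) simp
      then show ?thesis using y(1) u by (simp add: Y'_def)
    qed
    then show "x \<in> Y'" using x(1) by (simp add: Y'_def)
  qed
  have "Y \<subseteq> Y'"
  proof
    fix x assume x: "x \<in> Y"
    have "factor x t (length u) \<noteq> u" if "u \<in> W" for u t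
    proof
      assume "factor x t (length u) = u"
      then have "u \<in> language Y" unfolding language_iff[OF Y(1), of u t] using x by blast
      then show False using that r by (auto simp: W_def)
    qed
    then show "x \<in> Y'" using x Y(2) by (auto simp: Y'_def)
  qed
  moreover have "Y' \<subseteq> Y"
  proof (rule ccontr)
    assume "\<not> Y' \<subseteq> Y"
    then have mem: "Y' \<in> \<Z>" using Y' by (auto simp: \<Z>_def Y'_def)
    then have "r Y' \<in> language Y'" "r Y' \<in> W" using r by (auto simp: W_def)
    then show False unfolding language_iff[OF Y', of _ 0] by (auto simp: Y'_def)
  qed
  ultimately have "Y = Y'" by blast
  moreover have "finite W" using fin by (simp add: W_def)
  moreover have "W \<subseteq> lists S"
  proof
    fix u assume "u \<in> W"
    then obtain Z where "Z \<in> \<Z>" "u \<in> language Z" using r unfolding W_def by blast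
    then show "u \<in> lists S" using language_lists unfolding \<Z>_def by blast
  qed
  ultimately show ?thesis unfolding Y'_def excluded_def by blast
qed

lemma detecting_words:
  assumes q: "quasiminimal S X"
  shows "\<exists>P. finite P \<and> P \<subseteq> language X \<and> (\<forall>Y. subshift S Y \<longrightarrow> Y \<subset> X \<longrightarrow> (\<exists>p\<in>P. p \<notin> language Y))"
proof -
  define \<Z> where "\<Z> = {Y. subshift S Y \<and> Y \<subset> X}"
  have X: "subshift S X" and fin: "finite \<Z>" using q by (auto simp: quasiminimal_def \<Z>_def)
  have "\<forall>Z\<in>\<Z>. \<exists>r. r \<in> language X \<and> r \<notin> language Z"
    using separating_word[OF _ X] by (fastforce simp: \<Z>_def)
  then obtain r where r: "\<And>Z. Z \<in> \<Z> \<Longrightarrow> r Z \<in> language X \<and> r Z \<notin> language Z" by metis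
  show ?thesis using fin r by (intro exI[of _ "r ` \<Z>"]) (auto simp: \<Z>_def)
qed

section \<open>Limit sets\<close>

text \<open>
  The sets \<open>F n\<close> restrict the translations that may be used to approximate a point: with
  \<open>everywhere\<close> this is the orbit closure, with \<open>leftwards\<close> and \<open>rightwards\<close> the \<open>\<alpha>\<close>- and
  \<open>\<omega>\<close>-limit set of \<open>x\<close>.
\<close>

definition limset :: "(nat \<Rightarrow> int set) \<Rightarrow> (int \<Rightarrow> 'a) \<Rightarrow> (int \<Rightarrow> 'a) set" where
  "limset F x = {y. \<forall>n. \<exists>m\<in>F n. agree n y (translate m x)}"

definition tails :: "(nat \<Rightarrow> int set) \<Rightarrow> bool" where
  "tails F \<longleftrightarrow> (\<forall>m n. m \<le> n \<longrightarrow> F n \<subseteq> F m) \<and> (\<forall>c n. \<exists>k. \<forall>m\<in>F k. m + c \<in> F n)"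

abbreviation everywhere :: "nat \<Rightarrow> int set" where "everywhere \<equiv> \<lambda>n. UNIV"
abbreviation leftwards :: "nat \<Rightarrow> int set" where "leftwards \<equiv> \<lambda>n. {..<- int n}"
abbreviation rightwards :: "nat \<Rightarrow> int set" where "rightwards \<equiv> \<lambda>n. {int n<..}"

lemma tailsI:
  assumes "\<And>m n. m \<le> n \<Longrightarrow> F n \<subseteq> F m" "\<And>c n m. m \<in> F (n + nat \<bar>c\<bar>) \<Longrightarrow> m + c \<in> F n"
  shows "tails F"
  using assms unfolding tails_def by blast

lemma tails [simp]: "tails everywhere" "tails leftwards" "tails rightwards"
  by (rule tailsI; auto)+

lemma limset_subset:
  assumes "subshift S X" "x \<in> X" shows "limset F x \<subseteq> X"
proof
  fix y assume y: "y \<in> limset F x"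
  show "y \<in> X"
  proof (rule subshift_limit[OF assms(1)])
    fix n
    obtain m where "agree n y (translate m x)" using y unfolding limset_def by blast
    then show "\<exists>z\<in>X. agree n y z" using subshift_translate[OF assms] by blast
  qed
qed

lemma limset_subshift:
  assumes X: "subshift S X" "x \<in> X" and F: "tails F"
  shows "subshift S (limset F x)"
proof (rule subshift_subsetI[OF X(1) limset_subset[OF X]])
  fix y t assume y: "y \<in> limset F x"
  show "translate t y \<in> limset F x" unfolding limset_def
  proof (rule CollectI, rule allI)
    fix n
    obtain k where k: "\<And>m. m \<in> F k \<Longrightarrow> m + t \<in> F n" using F unfolding tails_def by meson
    let ?N = "max k (n + nat \<bar>t\<bar>)"
    obtain m where m: "m \<in> F ?N" "agree ?N y (translate m x)" using y unfolding limset_def by blast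
    have "m \<in> F k" using m(1) F unfolding tails_def by (meson max.cobounded1 subsetD)
    moreover have "agree n (translate t y) (translate t (translate m x))"
      by (rule agree_translate) (rule agree_mono[OF _ m(2)], simp)
    ultimately show "\<exists>m\<in>F n. agree n (translate t y) (translate m x)"
      using k by (intro bexI[of _ "m + t"]) (auto simp: add.commute)
  qed
next
  fix y assume y: "\<And>n. \<exists>z\<in>limset F x. agree n y z"
  show "y \<in> limset F x" unfolding limset_def
  proof (rule CollectI, rule allI)
    fix n
    obtain z where z: "z \<in> limset F x" "agree n y z" using y by blast
    then obtain m where "m \<in> F n" "agree n z (translate m x)" unfolding limset_def by blast
    then show "\<exists>m\<in>F n. agree n y (translate m x)" using agree_trans[OF z(2)] by blast
  qed
qed

lemma orbit_subset_limset_everywhere: "translate t x \<in> limset everywhere x"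
  by (auto simp: limset_def intro: exI[of _ t])

text \<open>
  If \<open>r\<close> occurred in \<open>x\<close> at positions in each \<open>F n\<close>, the translates of \<open>x\<close> by these positions would
  accumulate at a point of the limit set with \<open>r\<close> at the origin.
\<close>

lemma word_leaves:
  assumes X: "subshift S X" "finite S" "x \<in> X" and F: "tails F"
    and none: "\<And>y. y \<in> limset F x \<Longrightarrow> factor y 0 (length r) \<noteq> r"
  shows "\<exists>n. \<forall>t\<in>F n. factor x t (length r) \<noteq> r"
proof -
  have dec: "F n \<subseteq> F m" if "m \<le> n" for m n using F that by (auto simp: tails_def)
  define G where "G = (\<lambda>n y. \<forall>t\<in>F n. factor x t (length r) = r \<longrightarrow> \<not> agree n y (translate t x))"
  have "\<exists>n. \<forall>y\<in>X. G n y"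
  proof (rule subshift_compact[OF X(1,2)])
    show "G n y" if "m \<le> n" "G m y" for m n y
      using that dec agree_mono unfolding G_def by blast
    show "\<exists>s. \<forall>z\<in>X. agree s y z \<longrightarrow> G n z" if "G n y" for n y
      using that agree_trans unfolding G_def by blast
    show "\<exists>n. G n y" if "y \<in> X" for y
    proof (rule ccontr)
      assume "\<nexists>n. G n y"
      then have bad: "\<And>n. \<exists>t\<in>F n. factor x t (length r) = r \<and> agree n y (translate t x)"
        unfolding G_def by blast
      then have "y \<in> limset F x" unfolding limset_def by blast
      moreover have "factor y 0 (length r) = r"
      proof -
        obtain t where t: "factor x t (length r) = r" "agree (length r) y (translate t x)"
          using bad by blast
        then show ?thesis using factor_agree_cong[OF t(2), of 0 "length r"] by simp
      qed
      ultimately show False using none by blast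
    qed
  qed
  then obtain n where n: "\<And>y. y \<in> X \<Longrightarrow> G n y" by blast
  have "factor x t (length r) \<noteq> r" if "t \<in> F n" for t
    using n[OF subshift_translate[OF X(1,3), of t]] that unfolding G_def by auto
  then show ?thesis by blast
qed

lemma excluded_words_leave:
  assumes X: "subshift S X" "finite S" "x \<in> X" and F: "tails F"
    and W: "finite W" "excluded X (limset F x) W"
  shows "\<exists>n. \<forall>r\<in>W. \<forall>t\<in>F n. factor x t (length r) \<noteq> r"
proof -
  have "\<exists>n. \<forall>t\<in>F n. factor x t (length r) \<noteq> r" if "r \<in> W" for r
    by (rule word_leaves[OF X F]) (use W(2) that in \<open>auto simp: excluded_def\<close>)
  then obtain f where f: "\<And>r t. r \<in> W \<Longrightarrow> t \<in> F (f r) \<Longrightarrow> factor x t (length r) \<noteq> r" by metis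
  have "t \<in> F (f r)" if "r \<in> W" "t \<in> F (Max (f ` W))" for r t
  proof -
    have "f r \<le> Max (f ` W)" using W(1) that(1) by (intro Max_ge) auto
    then show ?thesis using F that(2) unfolding tails_def by blast
  qed
  then show ?thesis using f by blast
qed

text \<open>
  The central window of \<open>x\<close> of a suitable size reoccurs in \<open>x\<close> at finitely many positions only. A point of the
  orbit closure with this window is therefore a limit of finitely many translates of \<open>x\<close>, so
  it is one of them.
\<close>

lemma isolated_in_orbit_closure:
  assumes "x \<notin> limset leftwards x" "x \<notin> limset rightwards x"
  shows "\<exists>n. \<forall>y\<in>limset everywhere x. agree n y x \<longrightarrow> (\<exists>m. y = translate m x)"
proof -
  obtain n1 n2 where n1: "\<And>m. m < - int n1 \<Longrightarrow> \<not> agree n1 x (translate m x)"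
    and n2: "\<And>m. m > int n2 \<Longrightarrow> \<not> agree n2 x (translate m x)"
    using assms unfolding limset_def by auto
  define n where "n = max n1 n2"
  have n: "\<bar>m\<bar> \<le> int n" if "agree n x (translate m x)" for m
    using n1[of m] n2[of m] agree_mono[OF _ that, of n1] agree_mono[OF _ that, of n2]
    unfolding n_def by fastforce
  have "\<exists>m. y = translate m x" if y: "y \<in> limset everywhere x" and a: "agree n y x" for y
  proof (rule ccontr)
    assume "\<nexists>m. y = translate m x"
    then have "\<forall>m. \<exists>k. \<not> agree k y (translate m x)" using agree_all by blast
    then obtain k where k: "\<And>m. \<not> agree (k m) y (translate m x)" by metis
    define K where "K = Max (insert n (k ` {- int n..int n}))"
    have K1: "n \<le> K" unfolding K_def by (rule Max_ge) auto
    have K2: "k m \<le> K" if "\<bar>m\<bar> \<le> int n" for m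
    proof -
      have "m \<in> {- int n..int n}" using that by auto
      then have "k m \<in> insert n (k ` {- int n..int n})" by blast
      then show ?thesis unfolding K_def by (intro Max_ge) simp_all
    qed
    obtain m where m: "agree K y (translate m x)" using y unfolding limset_def by blast
    have "agree n x (translate m x)"
      using agree_trans[OF agree_sym[OF a] agree_mono[OF K1 m]] .
    then show False using k[of m] agree_mono[OF K2[OF n] m] by blast
  qed
  then show ?thesis by blast
qed

lemma finite_orbit_closure_representatives:
  assumes q: "quasiminimal S X"
  shows "\<exists>R. finite R \<and> R \<subseteq> X \<and> (\<forall>x\<in>X. \<exists>y\<in>R. limset everywhere y = limset everywhere x)"
proof -
  have X: "subshift S X" using q by (simp add: quasiminimal_def)
  have "limset everywhere ` X \<subseteq> {Y. subshift S Y \<and> Y \<subseteq> X}"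
    using limset_subshift[OF X] limset_subset[OF X] by fastforce
  then have "finite (limset everywhere ` X)"
    using finite_subshifts[OF q] finite_subset by blast
  then obtain R where R: "R \<subseteq> X" "finite R" "limset everywhere ` X = limset everywhere ` R"
    using finite_subset_image[of "limset everywhere ` X" "limset everywhere" X] by blast
  have "\<exists>y\<in>R. limset everywhere y = limset everywhere x" if "x \<in> X" for x
  proof -
    have "limset everywhere x \<in> limset everywhere ` R"
      using imageI[OF that, of "limset everywhere"] unfolding R(3) .
    then show ?thesis by (rule imageE) blast
  qed
  then show ?thesis using R(1,2) by blast
qed

section \<open>Occurrences in order\<close>

definition in_order :: "(int \<Rightarrow> 'b) \<Rightarrow> int set \<Rightarrow> 'b list \<Rightarrow> bool" where
  "in_order f D as \<longleftrightarrow> (\<exists>ps. sorted_wrt (<) ps \<and> set ps \<subseteq> D \<and> map f ps = as)"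

lemma in_order_mono: "in_order f D as \<Longrightarrow> D \<subseteq> E \<Longrightarrow> in_order f E as"
  unfolding in_order_def by blast

lemma in_order_cong:
  assumes "\<And>p. p \<in> D \<Longrightarrow> f p = g p"
  shows "in_order f D as \<longleftrightarrow> in_order g D as"
proof -
  have "map f ps = map g ps" if "set ps \<subseteq> D" for ps using that assms by auto
  then show ?thesis unfolding in_order_def by metis
qed

lemma in_order_translate:
  assumes "in_order (\<lambda>p. f (p + t)) UNIV as" shows "in_order f UNIV as"
proof -
  obtain ps where "sorted_wrt (<) ps" "map (\<lambda>p. f (p + t)) ps = as"
    using assms unfolding in_order_def by blast
  then show ?thesis unfolding in_order_def
    by (intro exI[of _ "map (\<lambda>p. p + t) ps"]) (auto simp: sorted_wrt_map o_def)
qed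

lemma in_order_append:
  assumes "in_order f D as" "in_order f E bs" "\<And>s t. s \<in> D \<Longrightarrow> t \<in> E \<Longrightarrow> s < t"
  shows "in_order f (D \<union> E) (as @ bs)"
proof -
  obtain ps qs where "sorted_wrt (<) ps" "set ps \<subseteq> D" "map f ps = as"
    "sorted_wrt (<) qs" "set qs \<subseteq> E" "map f qs = bs"
    using assms(1,2) unfolding in_order_def by blast
  then show ?thesis unfolding in_order_def
    using assms(3) by (intro exI[of _ "ps @ qs"]) (auto simp: sorted_wrt_append)
qed

lemma in_order_infix:
  assumes "in_order f D (as @ bs @ cs)" shows "in_order f D bs"
proof -
  obtain ps where "sorted_wrt (<) ps" "set ps \<subseteq> D" "map f ps = as @ bs @ cs"
    using assms unfolding in_order_def by blast
  then show ?thesis unfolding in_order_def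
    by (intro exI[of _ "take (length bs) (drop (length as) ps)"])
       (auto simp: sorted_wrt_take sorted_wrt_drop take_map[symmetric] drop_map[symmetric]
         dest!: in_set_takeD in_set_dropD)
qed

lemma in_order_bounded:
  assumes "in_order f UNIV as"
  shows "\<exists>N. in_order f {- int N..int N} as"
proof -
  obtain ps where ps: "sorted_wrt (<) ps" "map f ps = as"
    using assms unfolding in_order_def by blast
  define N where "N = nat (Max (insert 0 (abs ` set ps)))"
  have "p \<in> {- int N..int N}" if "p \<in> set ps" for p
  proof -
    have "\<bar>p\<bar> \<le> Max (insert 0 (abs ` set ps))" using that by (intro Max_ge) auto
    then have "\<bar>p\<bar> \<le> int N" unfolding N_def by linarith
    then show ?thesis by auto
  qed
  then have "set ps \<subseteq> {- int N..int N}" by blast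
  then show ?thesis using ps unfolding in_order_def by blast
qed

text \<open>
  Labels that recur to the left can be placed from right to left.
\<close>

lemma in_order_leftwards:
  assumes "\<And>a N. a \<in> set as \<Longrightarrow> \<exists>t<N. f t = a"
  shows "in_order f {..<N} as"
  using assms
proof (induction as arbitrary: N rule: rev_induct)
  case Nil then show ?case by (auto simp: in_order_def)
next
  case (snoc a as)
  obtain t where t: "t < N" "f t = a" using snoc.prems by fastforce
  have "in_order f {..<t} as" by (rule snoc.IH) (use snoc.prems in auto)
  then obtain ps where "sorted_wrt (<) ps" "set ps \<subseteq> {..<t}" "map f ps = as"
    unfolding in_order_def by blast
  then show ?case unfolding in_order_def
    using t by (intro exI[of _ "ps @ [t]"]) (auto simp: sorted_wrt_append)
qed

lemma in_order_rightwards: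
  assumes "\<And>a N. a \<in> set as \<Longrightarrow> \<exists>t>N. f t = a"
  shows "in_order f {N<..} as"
  using assms
proof (induction as arbitrary: N)
  case Nil then show ?case by (auto simp: in_order_def)
next
  case (Cons a as)
  obtain t where t: "t > N" "f t = a" using Cons.prems by fastforce
  have "in_order f {t<..} as" by (rule Cons.IH) (use Cons.prems in auto)
  then obtain ps where "sorted_wrt (<) ps" "set ps \<subseteq> {t<..}" "map f ps = as"
    unfolding in_order_def by blast
  then show ?case unfolding in_order_def
    using t by (intro exI[of _ "t # ps"]) auto
qed

section \<open>The labelling\<close>

definition label :: "'a clopen list \<Rightarrow> (int \<Rightarrow> 'a) \<Rightarrow> int \<Rightarrow> nat" where
  "label cs x n = (THE i. i \<in> {1..length cs} \<and> translate n x \<in> part cs i)"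

lemma part_agree:
  assumes "translate n x \<in> part cs i"
  shows "\<exists>s. \<forall>y. agree s x y \<longrightarrow> translate n y \<in> part cs i"
proof -
  obtain k us where c: "cs ! (i - 1) = (k, us)" by (cases "cs ! (i - 1)")
  then obtain u where u: "u \<in> set us" "factor (translate n x) k (length u) = u"
    using assms by (auto simp: part_def clopen_set_def)
  have "translate n y \<in> part cs i" if "agree (nat \<bar>k + n\<bar> + length u) x y" for y
    using u factor_agree_cong[OF that, of "k + n" "length u"] c
    by (auto simp: part_def clopen_set_def)
  then show ?thesis by blast
qed

text \<open>
  With \<open>W\<close> the words that a subshift excludes, this is a statement about the points of that subshift
  that contain \<open>w\<close>, in a form that finite windows of points of \<open>X\<close> can confirm. The flag \<open>b\<close> covers
  both the presence and the absence of the pattern.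
\<close>

definition forced :: "(int \<Rightarrow> 'a) set \<Rightarrow> 'a clopen list \<Rightarrow> int \<Rightarrow> 'a list \<Rightarrow> 'a list set \<Rightarrow>
    nat \<Rightarrow> nat \<Rightarrow> nat list \<Rightarrow> bool \<Rightarrow> bool" where
  "forced X cs p w W l N as b \<longleftrightarrow>
     (\<forall>y\<in>X. factor y p (length w) = w \<longrightarrow>
        (\<exists>r\<in>W. \<exists>t. \<bar>t\<bar> \<le> int l \<and> factor y t (length r) = r) \<or>
        in_order (label cs y) {- int N..int N} as = b)"

locale labelled_subshift =
  fixes S :: "'a set" and X :: "(int \<Rightarrow> 'a) set" and m :: nat and cs :: "'a clopen list"
  assumes finS: "finite S" and quasi: "quasiminimal S X" and partition: "clopen_partition S X m cs"
begin

lemma subX: "subshift S X"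
  using quasi by (simp add: quasiminimal_def)

lemma len_cs: "length cs = m"
  using partition by (simp add: clopen_partition_def)

lemma label_props:
  assumes "x \<in> X"
  shows label_range: "label cs x n \<in> {1..m}"
    and label_part: "translate n x \<in> part cs (label cs x n)"
    and label_unique: "i \<in> {1..m} \<Longrightarrow> translate n x \<in> part cs i \<Longrightarrow> label cs x n = i"
proof -
  have tX: "translate n x \<in> X" by (rule subshift_translate[OF subX assms])
  have "translate n x \<in> (\<Union>i\<in>{1..m}. X \<inter> part cs i)"
    using partition tX unfolding clopen_partition_def by blast
  then have ex: "\<exists>i. i \<in> {1..length cs} \<and> translate n x \<in> part cs i"
    using len_cs by blast
  have uniq: "i = j" if "i \<in> {1..length cs} \<and> translate n x \<in> part cs i"
    "j \<in> {1..length cs} \<and> translate n x \<in> part cs j" for i j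
  proof -
    have disj: "disjoint_family_on (\<lambda>i. X \<inter> part cs i) {1..m}"
      using partition unfolding clopen_partition_def by blast
    show ?thesis
    proof (rule ccontr)
      assume "i \<noteq> j"
      then have "(X \<inter> part cs i) \<inter> (X \<inter> part cs j) = {}"
        using disj that len_cs unfolding disjoint_family_on_def by blast
      then show False using that tX by blast
    qed
  qed
  have "\<exists>!i. i \<in> {1..length cs} \<and> translate n x \<in> part cs i" using ex uniq by blast
  from theI'[OF this] show "label cs x n \<in> {1..m}" "translate n x \<in> part cs (label cs x n)"
    unfolding label_def len_cs by auto
  then show "i \<in> {1..m} \<Longrightarrow> translate n x \<in> part cs i \<Longrightarrow> label cs x n = i"
    using uniq len_cs by blast
qed

lemma label_translate: "label cs (translate t x) n = label cs x (n + t)"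
  by (simp add: label_def)

lemma label_agree:
  assumes "x \<in> X"
  shows "\<exists>s. \<forall>y\<in>X. agree s x y \<longrightarrow> label cs y n = label cs x n"
proof -
  obtain s where s: "\<And>y. agree s x y \<Longrightarrow> translate n y \<in> part cs (label cs x n)"
    using part_agree[OF label_part[OF assms, of n]] by blast
  have "label cs y n = label cs x n" if "y \<in> X" "agree s x y" for y
    by (rule label_unique[OF that(1) label_range[OF assms] s[OF that(2)]])
  then show ?thesis by blast
qed

lemma labels_agree:
  assumes "x \<in> X" "finite D"
  shows "\<exists>s. \<forall>y\<in>X. agree s x y \<longrightarrow> (\<forall>n\<in>D. label cs y n = label cs x n)"
  using assms(2)
proof induction
  case (insert n D)
  then obtain s where s: "\<forall>y\<in>X. agree s x y \<longrightarrow> (\<forall>n\<in>D. label cs y n = label cs x n)" by blast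
  obtain t where t: "\<forall>y\<in>X. agree t x y \<longrightarrow> label cs y n = label cs x n"
    using label_agree[OF assms(1)] by blast
  have "\<forall>k\<in>insert n D. label cs y k = label cs x k" if "y \<in> X" "agree (max s t) x y" for y
    using s t that(1) agree_mono[OF _ that(2), of s] agree_mono[OF _ that(2), of t] by simp
  then show ?case by blast
qed auto

lemma in_order_agree:
  assumes "x \<in> X" "finite D"
  shows "\<exists>s. \<forall>y\<in>X. agree s x y \<longrightarrow> in_order (label cs y) D as = in_order (label cs x) D as"
proof -
  obtain s where s: "\<forall>y\<in>X. agree s x y \<longrightarrow> (\<forall>n\<in>D. label cs y n = label cs x n)"
    using labels_agree[OF assms] by blast
  have "in_order (label cs y) D as = in_order (label cs x) D as" if "y \<in> X" "agree s x y" for y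
    by (rule in_order_cong) (use s that in blast)
  then show ?thesis by blast
qed

lemma in_order_agree_UNIV:
  assumes "x \<in> X" "in_order (label cs x) UNIV as"
  shows "\<exists>s. \<forall>y\<in>X. agree s x y \<longrightarrow> in_order (label cs y) UNIV as"
proof -
  obtain N where N: "in_order (label cs x) {- int N..int N} as"
    using in_order_bounded[OF assms(2)] by blast
  obtain s where "\<forall>y\<in>X. agree s x y \<longrightarrow>
      in_order (label cs y) {- int N..int N} as = in_order (label cs x) {- int N..int N} as"
    using in_order_agree[OF assms(1) finite_atLeastAtMost_int] by blast
  then show ?thesis using N in_order_mono[OF _ subset_UNIV] by blast
qed

lemma in_order_label_translate:
  "in_order (label cs (translate t x)) UNIV as \<longleftrightarrow> in_order (label cs x) UNIV as"
proof -
  have *: "in_order (label cs x) UNIV as" if "in_order (label cs (translate t x)) UNIV as" for x t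
  proof -
    have "label cs (translate t x) = (\<lambda>p. label cs x (p + t))"
      by (simp add: fun_eq_iff label_translate)
    then show ?thesis using that in_order_translate[of "label cs x" t as] by simp
  qed
  show ?thesis using *[of t x] *[of "- t" "translate t x"] by auto
qed

text \<open>
  An occurrence involves a finite window of \<open>y\<close>, which also appears in \<open>x\<close>.
\<close>

lemma in_order_orbit_closure:
  assumes "x \<in> X" "y \<in> limset everywhere x" "in_order (label cs y) UNIV as"
  shows "in_order (label cs x) UNIV as"
proof -
  have "y \<in> X" using limset_subset[OF subX assms(1)] assms(2) by blast
  then obtain s where s: "\<forall>z\<in>X. agree s y z \<longrightarrow> in_order (label cs z) UNIV as"
    using in_order_agree_UNIV assms(3) by blast
  obtain t where "agree s y (translate t x)" using assms(2) unfolding limset_def by blast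
  then have "in_order (label cs (translate t x)) UNIV as"
    using s subshift_translate[OF subX assms(1)] by blast
  then show ?thesis by (simp add: in_order_label_translate)
qed

lemma label_recurs:
  assumes "x \<in> X" "y \<in> limset F x" "tails F"
  shows "\<exists>t\<in>F n. label cs x t = label cs y 0"
proof -
  have "y \<in> X" using limset_subset[OF subX assms(1)] assms(2) by blast
  then obtain s where s: "\<forall>z\<in>X. agree s y z \<longrightarrow> label cs z 0 = label cs y 0"
    using label_agree by blast
  obtain t where t: "t \<in> F (max s n)" "agree (max s n) y (translate t x)"
    using assms(2) unfolding limset_def by blast
  have "label cs (translate t x) 0 = label cs y 0"
    using s subshift_translate[OF subX assms(1)] agree_mono[OF _ t(2), of s] by simp
  moreover have "t \<in> F n" using t(1) assms(3) unfolding tails_def by (meson max.cobounded2 subsetD)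
  ultimately show ?thesis by (auto simp: label_translate)
qed

subsection \<open>Forced labels\<close>

text \<open>
  It suffices to consider points without any word of \<open>W\<close>; compactness then bounds the
  distance at which such a word shows up in the others.
\<close>

lemma ex_forced:
  assumes "\<And>y. y \<in> X \<Longrightarrow> factor y p (length w) = w \<Longrightarrow>
      (\<And>r t. r \<in> W \<Longrightarrow> factor y t (length r) \<noteq> r) \<Longrightarrow>
      in_order (label cs y) {- int N..int N} as = b"
  shows "\<exists>l. forced X cs p w W l N as b"
  unfolding forced_def
proof (rule subshift_compact[OF subX finS])
  fix l l' :: nat and y :: "int \<Rightarrow> 'a"
  assume "l \<le> l'" "factor y p (length w) = w \<longrightarrow>
        (\<exists>r\<in>W. \<exists>t. \<bar>t\<bar> \<le> int l \<and> factor y t (length r) = r) \<or>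
        in_order (label cs y) {- int N..int N} as = b"
  then show "factor y p (length w) = w \<longrightarrow>
        (\<exists>r\<in>W. \<exists>t. \<bar>t\<bar> \<le> int l' \<and> factor y t (length r) = r) \<or>
        in_order (label cs y) {- int N..int N} as = b"
    by (meson of_nat_le_iff order_trans)
next
  fix y assume "y \<in> X"
  show "\<exists>l. factor y p (length w) = w \<longrightarrow>
        (\<exists>r\<in>W. \<exists>t. \<bar>t\<bar> \<le> int l \<and> factor y t (length r) = r) \<or>
        in_order (label cs y) {- int N..int N} as = b"
  proof (cases "\<exists>r\<in>W. \<exists>t. factor y t (length r) = r")
    case True
    then obtain r t where "r \<in> W" "factor y t (length r) = r" by blast
    then show ?thesis by (intro exI[of _ "nat \<bar>t\<bar>"]) auto
  next
    case False
    then show ?thesis using assms[OF \<open>y \<in> X\<close>] by blast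
  qed
next
  fix l y
  assume y: "y \<in> X" and G: "factor y p (length w) = w \<longrightarrow>
        (\<exists>r\<in>W. \<exists>t. \<bar>t\<bar> \<le> int l \<and> factor y t (length r) = r) \<or>
        in_order (label cs y) {- int N..int N} as = b"
  define Q where "Q = (\<lambda>z. factor z p (length w) = w \<longrightarrow>
        (\<exists>r\<in>W. \<exists>t. \<bar>t\<bar> \<le> int l \<and> factor z t (length r) = r) \<or>
        in_order (label cs z) {- int N..int N} as = b)"
  consider "factor y p (length w) \<noteq> w"
    | r t where "r \<in> W" "\<bar>t\<bar> \<le> int l" "factor y t (length r) = r"
    | "in_order (label cs y) {- int N..int N} as = b" using G by blast
  then have "\<exists>s. \<forall>z\<in>X. agree s y z \<longrightarrow> Q z"
  proof cases
    case 1
    have "Q z" if "agree (nat \<bar>p\<bar> + length w) y z" for z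
      using 1 factor_agree_cong[OF that, of p "length w"] by (simp add: Q_def)
    then show ?thesis by blast
  next
    case 2
    have "Q z" if "agree (nat \<bar>t\<bar> + length r) y z" for z
    proof -
      have "factor z t (length r) = r"
        using 2 factor_agree_cong[OF that, of t "length r"] by simp
      then show ?thesis using 2 unfolding Q_def by blast
    qed
    then show ?thesis by blast
  next
    case 3
    obtain s where "\<forall>z\<in>X. agree s y z \<longrightarrow>
        in_order (label cs z) {- int N..int N} as = in_order (label cs y) {- int N..int N} as"
      using in_order_agree[OF y finite_atLeastAtMost_int] by blast
    then show ?thesis using 3 unfolding Q_def by blast
  qed
  then show "\<exists>s. \<forall>z\<in>X. agree s y z \<longrightarrow> (factor z p (length w) = w \<longrightarrow>
        (\<exists>r\<in>W. \<exists>t. \<bar>t\<bar> \<le> int l \<and> factor z t (length r) = r) \<or>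
        in_order (label cs z) {- int N..int N} as = b)"
    unfolding Q_def .
qed

lemma forcedD:
  assumes "forced X cs p w W l N as b" "y \<in> X" "factor y p (length w) = w"
    "\<And>r t. r \<in> W \<Longrightarrow> \<bar>t\<bar> \<le> int l \<Longrightarrow> factor y t (length r) \<noteq> r"
  shows "in_order (label cs y) {- int N..int N} as = b"
  using assms unfolding forced_def by blast

lemma in_order_single_0: "in_order f {- int 0..int 0} [a] \<longleftrightarrow> f 0 = a"
proof
  assume "in_order f {- int 0..int 0} [a]"
  then obtain ps where ps: "sorted_wrt (<) ps" "set ps \<subseteq> {- int 0..int 0}" "map f ps = [a]"
    unfolding in_order_def by (elim exE conjE)
  from ps(3) obtain q where q: "ps = [q]" "f q = a" by (auto simp: map_eq_Cons_conv)
  with ps(2) have "q = 0" by simp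
  with q show "f 0 = a" by simp
next
  assume "f 0 = a"
  then show "in_order f {- int 0..int 0} [a]"
    unfolding in_order_def by (intro exI[of _ "[0]"]) auto
qed

text \<open>
  The instance used for absent labels: the empty word at the origin is no condition, and a window of
  radius \<open>0\<close> with a single label speaks about the label of the origin.
\<close>

lemma forced_absence:
  assumes "forced X cs 0 [] W l 0 [a] False" "x \<in> X"
    "\<And>r t. r \<in> W \<Longrightarrow> \<bar>t - n\<bar> \<le> int l \<Longrightarrow> factor x t (length r) \<noteq> r"
  shows "label cs x n \<noteq> a"
proof -
  have "in_order (label cs (translate n x)) {- int 0..int 0} [a] = False"
  proof (rule forcedD[OF assms(1) subshift_translate[OF subX assms(2)]])
    show "factor (translate n x) 0 (length []) = []" by (simp add: factor_def)
    show "factor (translate n x) t (length r) \<noteq> r" if "r \<in> W" "\<bar>t\<bar> \<le> int l" for r t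
      using assms(3)[OF that(1), of "t + n"] that(2) by simp
  qed
  then show ?thesis unfolding in_order_single_0 by (simp add: label_translate)
qed

subsection \<open>Certificates\<close>

text \<open>
  The set \<open>P\<close> detects proper subshifts. If the pattern occurs somewhere, the points without it form a
  proper subshift \<open>Y\<close>, so some \<open>p \<in> P\<close> does not occur in \<open>Y\<close>. Then every point with \<open>p\<close> at the
  origin has the pattern, and compactness makes the window uniform.
\<close>

lemma occurrence_certificate:
  assumes P: "P \<subseteq> language X" "\<And>Y. subshift S Y \<Longrightarrow> Y \<subset> X \<Longrightarrow> \<exists>p\<in>P. p \<notin> language Y"
  shows "(\<exists>x\<in>X. in_order (label cs x) UNIV as) \<longleftrightarrow> (\<exists>p\<in>P. \<exists>N. forced X cs 0 p {} 0 N as True)"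
proof
  assume ex: "\<exists>x\<in>X. in_order (label cs x) UNIV as"
  define Y where "Y = {x \<in> X. \<not> in_order (label cs x) UNIV as}"
  have "subshift S Y"
  proof (rule subshift_subsetI[OF subX])
    show "Y \<subseteq> X" by (auto simp: Y_def)
    show "translate t x \<in> Y" if "x \<in> Y" for x t
      using that subshift_translate[OF subX] by (auto simp: Y_def in_order_label_translate)
    fix x assume x: "x \<in> X" "\<And>n. \<exists>y\<in>Y. agree n x y"
    then show "x \<in> Y" unfolding Y_def using in_order_agree_UNIV[OF x(1)] by blast
  qed
  moreover have "Y \<subset> X" using ex by (auto simp: Y_def)
  ultimately obtain p where p: "p \<in> P" "p \<notin> language Y" using P(2) by blast
  have "\<exists>N. \<forall>y\<in>X. factor y 0 (length p) = p \<longrightarrow> in_order (label cs y) {- int N..int N} as"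
  proof (rule subshift_compact[OF subX finS])
    fix M N :: nat and y
    assume "M \<le> N" "factor y 0 (length p) = p \<longrightarrow> in_order (label cs y) {- int M..int M} as"
    then show "factor y 0 (length p) = p \<longrightarrow> in_order (label cs y) {- int N..int N} as"
      by (auto elim: in_order_mono)
  next
    fix y assume y: "y \<in> X"
    have "in_order (label cs y) UNIV as" if "factor y 0 (length p) = p"
    proof (rule ccontr)
      assume "\<not> in_order (label cs y) UNIV as"
      then have "y \<in> Y" using y by (simp add: Y_def)
      then show False using p(2) that language_iff[OF \<open>subshift S Y\<close>, of p 0] by blast
    qed
    then show "\<exists>N. factor y 0 (length p) = p \<longrightarrow> in_order (label cs y) {- int N..int N} as"
      using in_order_bounded by blast
  next
    fix N y
    assume y: "y \<in> X" "factor y 0 (length p) = p \<longrightarrow> in_order (label cs y) {- int N..int N} as"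
    obtain s where s: "\<forall>z\<in>X. agree s y z \<longrightarrow>
        in_order (label cs z) {- int N..int N} as = in_order (label cs y) {- int N..int N} as"
      using in_order_agree[OF y(1) finite_atLeastAtMost_int] by blast
    have "factor z 0 (length p) = p \<longrightarrow> in_order (label cs z) {- int N..int N} as"
      if "z \<in> X" "agree (max s (length p)) y z" for z
      using y(2) s that agree_mono[of s "max s (length p)" y z]
        factor_agree_cong[OF that(2), of 0 "length p"] by simp
    then show "\<exists>s. \<forall>z\<in>X. agree s y z \<longrightarrow>
        (factor z 0 (length p) = p \<longrightarrow> in_order (label cs z) {- int N..int N} as)" by blast
  qed
  then show "\<exists>p\<in>P. \<exists>N. forced X cs 0 p {} 0 N as True"
    using p(1) by (auto simp: forced_def)
next
  assume "\<exists>p\<in>P. \<exists>N. forced X cs 0 p {} 0 N as True"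
  then obtain p N where pN: "p \<in> P" "forced X cs 0 p {} 0 N as True" by blast
  then obtain y where y: "y \<in> X" "factor y 0 (length p) = p"
    using P(1) language_iff[OF subX] by blast
  have "in_order (label cs y) {- int N..int N} as = True"
    using forcedD[OF pN(2) y] by blast
  then show "\<exists>x\<in>X. in_order (label cs x) UNIV as"
    using y(1) in_order_mono[OF _ subset_UNIV] by blast
qed

lemma representatives_suffice:
  assumes "R \<subseteq> X" "\<And>x. x \<in> X \<Longrightarrow> \<exists>y\<in>R. limset everywhere y = limset everywhere x"
  shows "(\<exists>x\<in>X. in_order (label cs x) UNIV as) \<longleftrightarrow> (\<exists>x\<in>R. in_order (label cs x) UNIV as)"
proof
  assume "\<exists>x\<in>X. in_order (label cs x) UNIV as"
  then obtain x where x: "x \<in> X" "in_order (label cs x) UNIV as" by blast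
  obtain y where y: "y \<in> R" "limset everywhere y = limset everywhere x" using assms(2) x(1) by blast
  have "x \<in> limset everywhere y" using orbit_subset_limset_everywhere[of 0 x] y(2) by simp
  then have "in_order (label cs y) UNIV as"
    using in_order_orbit_closure x(2) y(1) assms(1) by blast
  then show "\<exists>x\<in>R. in_order (label cs x) UNIV as" using y(1) by blast
qed (use assms(1) in blast)

text \<open>
  A label that occurs in \<open>x\<close> at all occurs infinitely often in the direction in which \<open>x\<close> returns to
  itself, so labels that all occur also occur in any prescribed order.
\<close>

lemma recurrent_certificate:
  assumes x: "x \<in> X"
    and rec: "x \<in> limset leftwards x \<or> x \<in> limset rightwards x"
    and W: "excluded X (limset everywhere x) W"
  shows "\<not> in_order (label cs x) UNIV as \<longleftrightarrow>
    (\<exists>i<length as. \<exists>l. forced X cs 0 [] W l 0 [as ! i] False)"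
proof
  assume none: "\<not> in_order (label cs x) UNIV as"
  have sub: "subshift S (limset F x)" if "tails F" for F by (rule limset_subshift[OF subX x that])
  have "\<exists>i<length as. \<forall>t. label cs x t \<noteq> as ! i"
  proof (rule ccontr)
    assume "\<not> (\<exists>i<length as. \<forall>t. label cs x t \<noteq> as ! i)"
    then have occ: "\<exists>t. label cs x t = a" if "a \<in> set as" for a
      using that by (metis in_set_conv_nth)
    from rec show False
    proof
      assume "x \<in> limset leftwards x"
      then have mem: "translate t x \<in> limset leftwards x" for t
        using subshift_translate[OF sub[of leftwards]] by simp
      have "\<exists>t<N. label cs x t = a" if a: "a \<in> set as" for a N
      proof -
        obtain t0 where t0: "label cs x t0 = a" using occ[OF a] by blast
        obtain t where "t \<in> leftwards (nat \<bar>N\<bar>)" "label cs x t = label cs (translate t0 x) 0"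
          using label_recurs[OF x mem] by fastforce
        then show ?thesis using t0 by (intro exI[of _ t]) (auto simp: label_translate)
      qed
      then show False using none in_order_leftwards in_order_mono[OF _ subset_UNIV] by blast
    next
      assume "x \<in> limset rightwards x"
      then have mem: "translate t x \<in> limset rightwards x" for t
        using subshift_translate[OF sub[of rightwards]] by simp
      have "\<exists>t>N. label cs x t = a" if a: "a \<in> set as" for a N
      proof -
        obtain t0 where t0: "label cs x t0 = a" using occ[OF a] by blast
        obtain t where "t \<in> rightwards (nat \<bar>N\<bar>)" "label cs x t = label cs (translate t0 x) 0"
          using label_recurs[OF x mem] by fastforce
        then show ?thesis using t0 by (intro exI[of _ t]) (auto simp: label_translate)
      qed
      then show False using none in_order_rightwards in_order_mono[OF _ subset_UNIV] by blast
    qed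
  qed
  then obtain i where i: "i < length as" "\<And>t. label cs x t \<noteq> as ! i" by blast
  have "\<exists>l. forced X cs 0 [] W l 0 [as ! i] False"
  proof (rule ex_forced)
    fix y assume "y \<in> X" "\<And>r t. r \<in> W \<Longrightarrow> factor y t (length r) \<noteq> r"
    then have "y \<in> limset everywhere x" using W unfolding excluded_def by blast
    then obtain t where "label cs x t = label cs y 0"
      using label_recurs[OF x, of y everywhere] by auto
    then show "in_order (label cs y) {- int 0..int 0} [as ! i] = False"
      using i(2)[of t] unfolding in_order_single_0 by simp
  qed
  then show "\<exists>i<length as. \<exists>l. forced X cs 0 [] W l 0 [as ! i] False" using i(1) by blast
next
  assume "\<exists>i<length as. \<exists>l. forced X cs 0 [] W l 0 [as ! i] False"
  then obtain i l where i: "i < length as" and f: "forced X cs 0 [] W l 0 [as ! i] False" by blast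
  have "x \<in> limset everywhere x" using orbit_subset_limset_everywhere[of 0 x] by simp
  then have "factor x t (length r) \<noteq> r" if "r \<in> W" for r t
    using W that unfolding excluded_def by blast
  then have no: "label cs x n \<noteq> as ! i" for n by (rule forced_absence[OF f x])
  show "\<not> in_order (label cs x) UNIV as"
  proof
    assume "in_order (label cs x) UNIV as"
    then obtain ps where "map (label cs x) ps = as" unfolding in_order_def by blast
    then have "label cs x (ps ! i) = as ! i" using i by (metis length_map nth_map)
    then show False using no by blast
  qed
qed

lemma ex_forced_absence:
  assumes x: "x \<in> X" and W: "excluded X (limset F x) W"
    and none: "\<And>y. y \<in> limset F x \<Longrightarrow> label cs y 0 \<noteq> a"
  shows "\<exists>l. forced X cs 0 [] W l 0 [a] False"
proof (rule ex_forced)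
  fix y assume "y \<in> X" "\<And>r t. r \<in> W \<Longrightarrow> factor y t (length r) \<noteq> r"
  then have "y \<in> limset F x" using W unfolding excluded_def by blast
  then show "in_order (label cs y) {- int 0..int 0} [a] = False"
    using none unfolding in_order_single_0 by simp
qed

lemma forced_mono_radius: "forced X cs p w W l N as b \<Longrightarrow> l \<le> l' \<Longrightarrow> forced X cs p w W l' N as b"
  unfolding forced_def by (meson of_nat_le_iff order_trans)

text \<open>
  The indices \<open>i\<close> and \<open>j\<close> delimit the middle segment of the pattern: its first label is foreign to the left
  limit set and its last label to the right one. Beyond distance \<open>N0 + l\<close> these two labels do
  not occur in \<open>x\<close> on their respective sides, so an occurrence of the middle segment lies in the
  window of this radius, where the word \<open>w\<close> determines the labels.
\<close>

lemma isolated_certificate: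
  assumes x: "x \<in> X"
    and iso: "\<And>y. y \<in> limset everywhere x \<Longrightarrow> factor y p (length w) = w \<Longrightarrow> \<exists>m. y = translate m x"
    and w: "factor x p (length w) = w"
    and W: "excluded X (limset everywhere x) W"
    and WL: "excluded X (limset leftwards x) WL" "\<And>r t. r \<in> WL \<Longrightarrow> t < - int N0 \<Longrightarrow> factor x t (length r) \<noteq> r"
    and WR: "excluded X (limset rightwards x) WR" "\<And>r t. r \<in> WR \<Longrightarrow> t > int N0 \<Longrightarrow> factor x t (length r) \<noteq> r"
  shows "\<not> in_order (label cs x) UNIV as \<longleftrightarrow>
    (\<exists>i j l l'. i < j \<and> j \<le> length as \<and>
       forced X cs 0 [] WL l 0 [as ! i] False \<and> forced X cs 0 [] WR l 0 [as ! (j - 1)] False \<and>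
       forced X cs p w W l' (N0 + l) (drop i (take j as)) False)"
proof
  assume none: "\<not> in_order (label cs x) UNIV as"
  define L where "L = (\<lambda>a. \<exists>y\<in>limset leftwards x. label cs y 0 = a)"
  define R where "R = (\<lambda>a. \<exists>y\<in>limset rightwards x. label cs y 0 = a)"
  have L: "\<exists>t<N. label cs x t = a" if a: "L a" for a N
  proof -
    obtain y where y: "y \<in> limset leftwards x" "label cs y 0 = a" using a unfolding L_def by blast
    obtain t where "t \<in> leftwards (nat \<bar>N\<bar>)" "label cs x t = label cs y 0"
      using label_recurs[OF x y(1)] by fastforce
    then show ?thesis using y(2) by (intro exI[of _ t]) auto
  qed
  have R: "\<exists>t>N. label cs x t = a" if a: "R a" for a N
  proof -
    obtain y where y: "y \<in> limset rightwards x" "label cs y 0 = a" using a unfolding R_def by blast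
    obtain t where "t \<in> rightwards (nat \<bar>N\<bar>)" "label cs x t = label cs y 0"
      using label_recurs[OF x y(1)] by fastforce
    then show ?thesis using y(2) by (intro exI[of _ t]) auto
  qed
  \<comment> \<open>\<open>as1\<close> can be placed arbitrarily far to the left and \<open>as3\<close> arbitrarily far to the right; the
    segment between them cannot occur in \<open>x\<close>.\<close>
  define as1 where "as1 = takeWhile L as"
  define as3 where "as3 = rev (takeWhile R (rev as))"
  define i where "i = length as1"
  define j where "j = length as - length as3"
  have t1: "take i as = as1" unfolding i_def as1_def by (rule takeWhile_eq_take[symmetric])
  have t3: "drop j as = as3"
  proof -
    have "rev (drop j as) = take (length as3) (rev as)"
      unfolding j_def take_rev by (simp add: as3_def length_takeWhile_le)
    also have "\<dots> = rev as3" unfolding as3_def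
      by (simp add: takeWhile_eq_take[symmetric])
    finally show ?thesis by simp
  qed
  have L1: "in_order (label cs x) {..<N} as1" for N
    by (rule in_order_leftwards) (use L in \<open>auto simp: as1_def dest: set_takeWhileD\<close>)
  have R3: "in_order (label cs x) {N<..} as3" for N
    by (rule in_order_rightwards) (use R in \<open>auto simp: as3_def dest: set_takeWhileD\<close>)
  \<comment> \<open>Otherwise \<open>as1\<close> and \<open>as3\<close> exhaust the pattern, which would then occur.\<close>
  have ij: "i < j"
  proof (rule ccontr)
    assume "\<not> i < j"
    then have "drop i as = drop (i - j) as3" by (simp add: t3[symmetric])
    moreover have "in_order (label cs x) {0<..} (drop (i - j) as3)"
      using in_order_infix[of "label cs x" "{0<..}" "take (i - j) as3" "drop (i - j) as3" "[]"] R3 by simp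
    ultimately have "in_order (label cs x) ({..<0} \<union> {0<..}) (take i as @ drop i as)"
      using L1[of 0] unfolding t1 by (intro in_order_append) auto
    then have "in_order (label cs x) ({..<0} \<union> {0<..}) as" by simp
    from in_order_mono[OF this subset_UNIV] show False using none by blast
  qed
  have jl: "j \<le> length as" unfolding j_def by simp
  have "\<not> L (as ! i)"
    using nth_length_takeWhile[of L as] ij jl unfolding i_def as1_def by simp
  then obtain l1 where l1: "forced X cs 0 [] WL l1 0 [as ! i] False"
    using ex_forced_absence[OF x WL(1)] unfolding L_def by blast
  have "\<not> R (as ! (j - 1))"
  proof -
    let ?k = "length (takeWhile R (rev as))"
    have k: "j = length as - ?k" "?k < length as" using ij by (auto simp: j_def as3_def)
    then have "\<not> R (rev as ! ?k)" by (intro nth_length_takeWhile) simp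
    then show ?thesis using k by (simp add: rev_nth)
  qed
  then obtain l2 where l2: "forced X cs 0 [] WR l2 0 [as ! (j - 1)] False"
    using ex_forced_absence[OF x WR(1)] unfolding R_def by blast
  define l where "l = max l1 l2"
  have split: "as = as1 @ drop i (take j as) @ as3"
    using ij by (metis append_assoc append_take_drop_id min.absorb3 less_imp_le t1 t3 take_take min_def)
  have mid: "\<not> in_order (label cs x) UNIV (drop i (take j as))"
  proof
    assume "in_order (label cs x) UNIV (drop i (take j as))"
    then obtain N where N: "in_order (label cs x) {- int N..int N} (drop i (take j as))"
      using in_order_bounded by blast
    have "in_order (label cs x) ({- int N..int N} \<union> {int N<..}) (drop i (take j as) @ as3)"
      by (rule in_order_append[OF N R3]) auto
    then have "in_order (label cs x) ({..<- int N} \<union> ({- int N..int N} \<union> {int N<..}))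
        (as1 @ drop i (take j as) @ as3)"
      by (rule in_order_append[OF L1[of "- int N"]]) auto
    then have "in_order (label cs x) ({..<- int N} \<union> ({- int N..int N} \<union> {int N<..})) as"
      using split by simp
    then show False using none in_order_mono[OF _ subset_UNIV] by blast
  qed
  have "\<exists>l'. forced X cs p w W l' (N0 + l) (drop i (take j as)) False"
  proof (rule ex_forced)
    fix y assume y: "y \<in> X" "factor y p (length w) = w"
      "\<And>r t. r \<in> W \<Longrightarrow> factor y t (length r) \<noteq> r"
    then have "y \<in> limset everywhere x" using W unfolding excluded_def by blast
    then obtain m where "y = translate m x" using iso y(2) by blast
    then have "\<not> in_order (label cs y) UNIV (drop i (take j as))"
      using mid by (simp add: in_order_label_translate)
    then show "in_order (label cs y) {- int (N0 + l)..int (N0 + l)} (drop i (take j as)) = False"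
      using in_order_mono[OF _ subset_UNIV] by blast
  qed
  then show "\<exists>i j l l'. i < j \<and> j \<le> length as \<and>
       forced X cs 0 [] WL l 0 [as ! i] False \<and> forced X cs 0 [] WR l 0 [as ! (j - 1)] False \<and>
       forced X cs p w W l' (N0 + l) (drop i (take j as)) False"
    using ij jl forced_mono_radius[OF l1, of l] forced_mono_radius[OF l2, of l]
    by (auto simp: l_def)
next
  assume "\<exists>i j l l'. i < j \<and> j \<le> length as \<and>
       forced X cs 0 [] WL l 0 [as ! i] False \<and> forced X cs 0 [] WR l 0 [as ! (j - 1)] False \<and>
       forced X cs p w W l' (N0 + l) (drop i (take j as)) False"
  then obtain i j l l' where ij: "i < j" "j \<le> length as"
    and f: "forced X cs 0 [] WL l 0 [as ! i] False" "forced X cs 0 [] WR l 0 [as ! (j - 1)] False"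
      "forced X cs p w W l' (N0 + l) (drop i (take j as)) False" by blast
  have left: "label cs x n \<noteq> as ! i" if "n < - int (N0 + l)" for n
    by (rule forced_absence[OF f(1) x], rule WL(2)) (use that in auto)
  have right: "label cs x n \<noteq> as ! (j - 1)" if "n > int (N0 + l)" for n
    by (rule forced_absence[OF f(2) x], rule WR(2)) (use that in auto)
  show "\<not> in_order (label cs x) UNIV as"
  proof
    assume "in_order (label cs x) UNIV as"
    moreover have "as = take i as @ drop i (take j as) @ drop j as"
      using ij by (metis append_assoc append_take_drop_id less_imp_le min.absorb1 take_take)
    ultimately have "in_order (label cs x) UNIV (drop i (take j as))"
      using in_order_infix by metis
    then obtain ps where ps: "sorted_wrt (<) ps" "map (label cs x) ps = drop i (take j as)"
      unfolding in_order_def by blast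
    have len: "length ps = j - i" using arg_cong[OF ps(2), of length] ij by simp
    have lab: "label cs x (ps ! q) = as ! (i + q)" if "q < j - i" for q
      using arg_cong[OF ps(2), of "\<lambda>xs. xs ! q"] that len ij by simp
    have lo: "- int (N0 + l) \<le> ps ! 0" using left[of "ps ! 0"] lab[of 0] ij by force
    have hi: "ps ! (j - i - 1) \<le> int (N0 + l)"
      using right[of "ps ! (j - i - 1)"] lab[of "j - i - 1"] ij by force
    have "set ps \<subseteq> {- int (N0 + l)..int (N0 + l)}"
    proof
      fix q assume "q \<in> set ps"
      then obtain k where k: "k < j - i" "q = ps ! k" using len by (metis in_set_conv_nth)
      have "ps ! 0 \<le> ps ! k"
        using sorted_wrt_nth_less[OF ps(1), of 0 k] k len by (cases "k = 0") auto
      moreover have "ps ! k \<le> ps ! (j - i - 1)"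
      proof (cases "k = j - i - 1")
        case False
        then have "k < j - i - 1" using k(1) by linarith
        moreover have "j - i - 1 < length ps" using len ij(1) by linarith
        ultimately show ?thesis using sorted_wrt_nth_less[OF ps(1)] by force
      qed simp
      ultimately show "q \<in> {- int (N0 + l)..int (N0 + l)}" using lo hi k(2) by simp
    qed
    then have "in_order (label cs x) {- int (N0 + l)..int (N0 + l)} (drop i (take j as))"
      using ps unfolding in_order_def by blast
    moreover have "x \<in> limset everywhere x" using orbit_subset_limset_everywhere[of 0 x] by simp
    then have "factor x t (length r) \<noteq> r" if "r \<in> W" for r t
      using W that unfolding excluded_def by blast
    ultimately show False using forcedD[OF f(3) x w] by blast
  qed
qed

end

section \<open>Elementary piecewise testable languages\<close>

lemma in_order_if_elementary_pt:
  assumes "w \<in> elementary_pt T as"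
  shows "\<exists>ps. sorted_wrt (<) ps \<and> (\<forall>p\<in>set ps. p < length w) \<and> map (\<lambda>p. w ! p) ps = as"
  using assms
proof (induction T as arbitrary: w rule: elementary_pt.induct)
  case (1 T)
  then show ?case by (intro exI[of _ "[]"]) auto
next
  case (2 T a)
  then show ?case by (intro exI[of _ "[0]"]) auto
next
  case (3 T a b as)
  from "3.prems" obtain u v where w: "w = a # u @ v" and v: "v \<in> elementary_pt T (b # as)" by auto
  from "3.IH"[OF v] obtain ps where ps: "sorted_wrt (<) ps" "\<forall>p\<in>set ps. p < length v"
    "map (\<lambda>p. v ! p) ps = b # as"
    by (elim exE conjE)
  show ?case
  proof (intro exI conjI)
    let ?ps = "0 # map (\<lambda>p. Suc (length u + p)) ps"
    show "sorted_wrt (<) ?ps" using ps(1) by (simp add: sorted_wrt_map)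
    show "\<forall>p\<in>set ?ps. p < length w" using ps(2) by (auto simp: w)
    show "map ((!) w) ?ps = a # b # as" using ps(3) by (simp add: w nth_append o_def)
  qed
qed

lemma elementary_pt_lists: "set as \<subseteq> T \<Longrightarrow> w \<in> elementary_pt T as \<Longrightarrow> set w \<subseteq> T"
proof (induction T as arbitrary: w rule: elementary_pt.induct)
  case (3 T a b as)
  from "3.prems"(2) obtain u v where w: "w = a # u @ v" "set u \<subseteq> T" and v: "v \<in> elementary_pt T (b # as)" by auto
  have "set v \<subseteq> T" using "3.IH"[OF _ v] "3.prems"(1) by simp
  then show ?case using "3.prems"(1) w by simp
qed auto

text \<open>
  The labels from the first to the last position, with the labels in the gaps as the free words.
\<close>

lemma elementary_pt_if_in_order:
  assumes "sorted_wrt (<) ps" "ps \<noteq> []" "\<And>p. f p \<in> T"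
  shows "map f [hd ps..last ps] \<in> elementary_pt T (map f ps)"
  using assms(1,2)
proof (induction ps rule: induct_list012)
  case (3 p q ps)
  have "q \<le> last (q # ps)"
    using "3.prems"(1) last_in_set[of ps] by (cases "ps = []") (auto intro: less_imp_le)
  moreover have "p < q" using "3.prems"(1) by simp
  ultimately have pq: "p < q" "q \<le> last (q # ps)" by blast+
  have split: "[p..last (q # ps)] = p # [p + 1..q - 1] @ [q..last (q # ps)]"
    using upto_split1[of p q "last (q # ps)"] upto_rec1[of p "q - 1"] pq by simp
  have tail: "map f [q..last (q # ps)] \<in> elementary_pt T (f q # map f ps)"
    using 3 by simp
  have gap: "map f [p + 1..q - 1] \<in> lists T" using assms(3) by auto
  have "map f [p..last (q # ps)] \<in> elementary_pt T (f p # f q # map f ps)"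
    unfolding elementary_pt.simps split list.map map_append using tail gap by blast
  then show ?case by simp
qed auto

context labelled_subshift
begin

lemma models_iff_in_order:
  assumes as: "as \<noteq> []" "set as \<subseteq> {1..m}"
  shows "models X (elementary_pt {1..m} as) cs \<longleftrightarrow> (\<exists>x\<in>X. in_order (label cs x) UNIV as)"
proof
  assume "models X (elementary_pt {1..m} as) cs"
  then obtain w x where w: "w \<in> elementary_pt {1..m} as" and x: "x \<in> X"
    and m: "\<And>i. i < length w \<Longrightarrow> translate (int i) x \<in> part cs (w ! i)"
    unfolding models_def shift_power_eq_translate by blast
  have lab: "label cs x (int i) = w ! i" if "i < length w" for i
    using label_unique[OF x _ m[OF that]] elementary_pt_lists[OF as(2) w] that nth_mem by blast
  obtain ps where ps: "sorted_wrt (<) ps" "\<forall>p\<in>set ps. p < length w" "map (\<lambda>p. w ! p) ps = as"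
    using in_order_if_elementary_pt[OF w] by blast
  have "map (label cs x) (map int ps) = as"
    using ps(2,3) lab by (auto simp flip: ps(3))
  then have "in_order (label cs x) UNIV as" unfolding in_order_def
    using ps(1) by (intro exI[of _ "map int ps"]) (auto simp: sorted_wrt_map)
  then show "\<exists>x\<in>X. in_order (label cs x) UNIV as" using x by blast
next
  assume "\<exists>x\<in>X. in_order (label cs x) UNIV as"
  then obtain x ps where x: "x \<in> X" and ps: "sorted_wrt (<) ps" "map (label cs x) ps = as"
    unfolding in_order_def by blast
  then have ne: "ps \<noteq> []" using as(1) by auto
  let ?w = "map (label cs x) [hd ps..last ps]"
  let ?y = "translate (hd ps) x"
  have "?w \<in> elementary_pt {1..m} as"
    using elementary_pt_if_in_order[OF ps(1) ne, of "label cs x"] label_range[OF x]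
    unfolding ps(2) by blast
  moreover have "?y \<in> X" by (rule subshift_translate[OF subX x])
  moreover have "(shift ^^ i) ?y \<in> part cs (?w ! i)" if "i < length ?w" for i
    using label_part[OF x, of "int i + hd ps"] that
    by (simp add: shift_power_eq_translate add.commute nth_upto)
  ultimately show "models X (elementary_pt {1..m} as) cs"
    unfolding models_def by blast
qed

end

section \<open>Coding finite windows\<close>

text \<open>
  Words over \<open>{0..<b}\<close> of length \<open>k\<close> correspond to the numbers below \<open>b ^ k\<close>, so a quantifier over
  them is a bounded one.
\<close>

definition digit :: "nat \<Rightarrow> nat \<Rightarrow> nat \<Rightarrow> nat" where
  "digit b c i = (c div b ^ i) mod b"

lemma digit_less: "b > 0 \<Longrightarrow> digit b c i < b"
  by (simp add: digit_def)

lemma computable_digit [computable_intros]: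
  assumes "computable b" "computable c" "computable i" shows "computable (\<lambda>n. digit (b n) (c n) (i n))"
  unfolding digit_def by (intro computable_intros assms)

lemma ex_digits:
  assumes "\<And>i. i < k \<Longrightarrow> f i < b"
  shows "\<exists>c<b ^ k. \<forall>i<k. digit b c i = f i"
  using assms
proof (induction k arbitrary: f)
  case (Suc k)
  have f0: "f 0 < b" using Suc.prems by simp
  obtain c where c: "c < b ^ k" "\<forall>i<k. digit b c i = f (Suc i)"
    using Suc.IH[of "\<lambda>i. f (Suc i)"] Suc.prems by auto
  have "f 0 + b * c < b * Suc c" using f0 by simp
  also have "\<dots> \<le> b ^ Suc k" using c(1) by (simp only: power_Suc mult_le_mono2 Suc_le_eq)
  finally have "f 0 + b * c < b ^ Suc k" .
  moreover have "digit b (f 0 + b * c) i = f i" if "i < Suc k" for i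
  proof (cases i)
    case 0
    then show ?thesis using f0 by (simp add: digit_def)
  next
    case (Suc j)
    have "digit b (f 0 + b * c) i = digit b c j"
      using f0 by (simp add: digit_def Suc div_mult2_eq)
    then show ?thesis using c(2) that Suc by simp
  qed
  ultimately show ?case by blast
qed simp

text \<open>
  The digits of \<open>c\<close> fill the window from \<open>- s\<close> to \<open>s\<close>; values outside the window carry no
  information.
\<close>

definition window_point :: "nat \<Rightarrow> nat \<Rightarrow> nat \<Rightarrow> int \<Rightarrow> nat" where
  "window_point K s c = (\<lambda>t. digit K c (nat (t + int s)))"

lemma computable_window_point [computable_intros]:
  assumes "computable s" "computable c" "computable_int t" shows "computable (\<lambda>n. window_point K (s n) (c n) (t n))"
  unfolding window_point_def by (intro computable_intros assms)

definition spells :: "nat list \<Rightarrow> int \<Rightarrow> (int \<Rightarrow> nat) \<Rightarrow> bool" where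
  "spells u t y \<longleftrightarrow> (\<forall>q<length u. y (t + int q) = u ! q)"

lemma decidable_spells [computable_intros]:
  assumes "computable s" "computable c" "computable_int t"
  shows "decidable (\<lambda>n. spells u (t n) (window_point K (s n) (c n)))"
proof -
  have "decidable (\<lambda>n. \<forall>q<length u. window_point K (s n) (c n) (t n + int q) = code_nth (list_encode u) q)"
    by (intro computable_intros computable_comp[OF assms(1)] computable_comp[OF assms(2)] computable_int_comp[OF assms(3)])
  then show ?thesis by (rule decidable_cong) (simp add: spells_def)
qed

text \<open>
  Membership of the translate by \<open>n\<close> in the \<open>i\<close>-th part, read off from the code \<open>C\<close> of the list of
  clopen sets. All positions inspected must lie in the window of radius \<open>s\<close>; this makes the
  predicate depend on that window only and monotone in \<open>s\<close>.
\<close>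

definition code_matches :: "nat \<Rightarrow> nat \<Rightarrow> (int \<Rightarrow> nat) \<Rightarrow> int \<Rightarrow> nat \<Rightarrow> bool" where
  "code_matches C s y n i \<longleftrightarrow>
     (\<exists>q<code_length (psnd (code_nth C (i - 1))). \<forall>t<code_length (code_nth (psnd (code_nth C (i - 1))) q).
        - int s \<le> n + int_decode (pfst (code_nth C (i - 1))) + int t \<and>
        n + int_decode (pfst (code_nth C (i - 1))) + int t \<le> int s \<and>
        y (n + int_decode (pfst (code_nth C (i - 1))) + int t) = code_nth (code_nth (psnd (code_nth C (i - 1))) q) t)"

lemma decidable_code_matches [computable_intros]:
  assumes "computable C" "computable s" "computable c" "computable_int t" "computable i"
  shows "decidable (\<lambda>n. code_matches (C n) (s n) (window_point K (s n) (c n)) (t n) (i n))"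
  unfolding code_matches_def
  by (intro computable_intros computable_comp[OF assms(1)] computable_comp[OF assms(2)] computable_comp[OF assms(3)]
      computable_int_comp[OF assms(4)] computable_comp[OF assms(5)])

text \<open>
  The digits of \<open>v\<close> are the labels on the window of radius \<open>N\<close>, and those of \<open>g\<close> the positions, offset by
  \<open>N\<close>, at which the labels with indices from \<open>i\<close> to \<open>j - 1\<close> occur.
\<close>

definition code_in_order :: "nat \<Rightarrow> nat \<Rightarrow> nat \<Rightarrow> nat \<Rightarrow> nat \<Rightarrow> nat \<Rightarrow> bool" where
  "code_in_order B v N A i j \<longleftrightarrow>
     (\<exists>g<Suc (2 * N) ^ (j - i).
        (\<forall>q<j - i. digit B v (digit (Suc (2 * N)) g q) = code_nth A (i + q)) \<and>
        (\<forall>q<j - i - 1. digit (Suc (2 * N)) g q < digit (Suc (2 * N)) g (Suc q)))"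

lemma decidable_code_in_order [computable_intros]:
  assumes "computable B" "computable v" "computable N" "computable A" "computable i" "computable j"
  shows "decidable (\<lambda>n. code_in_order (B n) (v n) (N n) (A n) (i n) (j n))"
  unfolding code_in_order_def
  by (intro computable_intros computable_comp[OF assms(1)] computable_comp[OF assms(2)] computable_comp[OF assms(3)]
      computable_comp[OF assms(4)] computable_comp[OF assms(5)] computable_comp[OF assms(6)])

lemma code_in_order_iff:
  assumes j: "j \<le> length as"
  shows "code_in_order B v N (list_encode as) i j \<longleftrightarrow>
    in_order (\<lambda>t. digit B v (nat (t + int N))) {- int N..int N} (drop i (take j as))"
    (is "?l \<longleftrightarrow> in_order ?f ?D ?as")
proof
  assume ?l
  then obtain g where g: "\<And>q. q < j - i \<Longrightarrow> digit B v (digit (Suc (2 * N)) g q) = code_nth (list_encode as) (i + q)"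
    "\<And>q. q < j - i - 1 \<Longrightarrow> digit (Suc (2 * N)) g q < digit (Suc (2 * N)) g (Suc q)"
    unfolding code_in_order_def by blast
  define ps where "ps = map (\<lambda>q. int (digit (Suc (2 * N)) g q) - int N) [0..<j - i]"
  have tr: "transp ((<) :: int \<Rightarrow> int \<Rightarrow> bool)" by (simp add: transp_on_less)
  have "sorted_wrt (<) ps"
    unfolding sorted_wrt_iff_nth_Suc_transp[OF tr] using g(2) by (auto simp: ps_def)
  moreover have "set ps \<subseteq> ?D"
  proof
    fix p assume "p \<in> set ps"
    then obtain q where "p = int (digit (Suc (2 * N)) g q) - int N" by (auto simp: ps_def)
    then show "p \<in> ?D" using digit_less[of "Suc (2 * N)" g q] by simp
  qed
  moreover have "map ?f ps = ?as"
  proof (rule nth_equalityI)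
    show "length (map ?f ps) = length ?as" using j by (simp add: ps_def)
    fix q assume "q < length (map ?f ps)"
    then have q: "q < j - i" by (simp add: ps_def)
    then have "code_nth (list_encode as) (i + q) = as ! (i + q)" using j by (intro code_nth_encode) simp
    then show "map ?f ps ! q = ?as ! q" using q g(1)[OF q] j by (simp add: ps_def)
  qed
  ultimately show "in_order ?f ?D ?as" unfolding in_order_def by blast
next
  assume "in_order ?f ?D ?as"
  then obtain ps where ps: "sorted_wrt (<) ps" "set ps \<subseteq> ?D" "map ?f ps = ?as"
    unfolding in_order_def by (elim exE conjE)
  have len: "length ps = j - i" using arg_cong[OF ps(3), of length] j by simp
  have rng: "- int N \<le> ps ! q \<and> ps ! q \<le> int N" if "q < j - i" for q
  proof -
    have "ps ! q \<in> ?D" using ps(2) nth_mem[of q ps] that len by (metis subsetD)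
    then show ?thesis by simp
  qed
  have "nat (ps ! q + int N) < Suc (2 * N)" if "q < j - i" for q
    using rng[OF that] by linarith
  from ex_digits[of "j - i" "\<lambda>q. nat (ps ! q + int N)", OF this]
  obtain g where g: "g < Suc (2 * N) ^ (j - i)"
    "\<And>q. q < j - i \<Longrightarrow> digit (Suc (2 * N)) g q = nat (ps ! q + int N)" by blast
  have "digit B v (digit (Suc (2 * N)) g q) = code_nth (list_encode as) (i + q)" if q: "q < j - i" for q
  proof -
    have "?f (ps ! q) = as ! (i + q)"
      using arg_cong[OF ps(3), of "\<lambda>xs. xs ! q"] q len j by simp
    moreover have "code_nth (list_encode as) (i + q) = as ! (i + q)" using j q by (intro code_nth_encode) simp
    ultimately show ?thesis using g(2)[OF q] by simp
  qed
  moreover have "digit (Suc (2 * N)) g q < digit (Suc (2 * N)) g (Suc q)" if q: "q < j - i - 1" for q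
  proof -
    have q': "q < j - i" "Suc q < j - i" using q by simp_all
    have "ps ! q < ps ! Suc q" using sorted_wrt_nth_less[OF ps(1), of q "Suc q"] q' len by simp
    then show ?thesis using g(2)[OF q'(1)] g(2)[OF q'(2)] rng[OF q'(1)] by simp
  qed
  ultimately show ?l unfolding code_in_order_def using g(1) by blast
qed

text \<open>
  The arithmetical form of \<open>forced\<close> for the instance with code \<open>E\<close> and the pattern segment from \<open>i\<close> to
  \<open>j - 1\<close>, with the compactness radius \<open>s\<close> as the witness to search for. Labels enter
  only positively, through a guessed labelling \<open>v\<close>; as the parts are disjoint, the guess is unique
  on points of the subshift, and so the non-occurrence of the pattern is also a statement about \<open>v\<close>.
  The constant \<open>C0\<close> bounds the extent of the fixed words, so that \<open>s\<close> is large enough to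
  decide their occurrence inside the window.
\<close>

definition forced_code :: "nat \<Rightarrow> nat set \<Rightarrow> nat set \<Rightarrow> nat \<Rightarrow> int \<Rightarrow> nat list \<Rightarrow> nat list set \<Rightarrow>
    nat \<Rightarrow> nat \<Rightarrow> nat \<Rightarrow> nat \<Rightarrow> nat \<Rightarrow> bool \<Rightarrow> bool" where
  "forced_code K D NL C0 p w W E i j l N b \<longleftrightarrow>
     (\<exists>s. l + C0 \<le> s \<and> (\<forall>c<K ^ Suc (2 * s).
        (\<exists>q<Suc (2 * s). digit K c q \<notin> D) \<or>
        (\<exists>v. code_length v = Suc (2 * s) \<and> (\<forall>q<Suc (2 * s). code_nth v q = digit K c q) \<and> v \<in> NL) \<or>
        \<not> spells w p (window_point K s c) \<or>
        (\<exists>r\<in>W. \<exists>q<Suc (2 * l). spells r (int q - int l) (window_point K s c)) \<or>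
        (\<exists>v. (\<forall>q<Suc (2 * N). 1 \<le> digit (Suc (pfst E)) v q \<and> digit (Suc (pfst E)) v q \<le> pfst E \<and>
               code_matches (psnd (psnd E)) s (window_point K s c) (int q - int N) (digit (Suc (pfst E)) v q)) \<and>
             code_in_order (Suc (pfst E)) v N (pfst (psnd E)) i j = b)))"

lemma semidecidable_forced_code:
  assumes D: "finite D" and W: "finite W" and NL: "recursively_enumerable NL"
    and computable: "computable E" "computable i" "computable j" "computable l" "computable N"
  shows "semidecidable (\<lambda>n. forced_code K D NL C0 p w W (E n) (i n) (j n) (l n) (N n) b)"
  unfolding forced_code_def
  by (intro semidecidable_ex semidecidable_conj semidecidable_disj semidecidable_all_less semidecidable_finite_ex W
      semidecidable_mem_recursively_enumerable[OF NL] semidecidable_dec decidable_not decidable_conj decidable_all_less decidable_ex_less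
      decidable_finite_mem[OF D] decidable_spells decidable_code_matches decidable_code_in_order decidable_iff decidable_const decidable_le decidable_less decidable_eq
      computable_id computable_pfst computable_psnd computable_Suc computable_add computable_mult computable_power computable_const computable_digit computable_code_length computable_code_nth
      computable_int_diff computable_int_int computable_int_const
      computable_comp[OF computable(1)] computable_comp[OF computable(2)] computable_comp[OF computable(3)] computable_comp[OF computable(4)] computable_comp[OF computable(5)])

locale coded_subshift = labelled_subshift S X m cs
  for S :: "'a set" and X :: "(int \<Rightarrow> 'a) set" and m :: nat and cs :: "'a clopen list" +
  fixes enc :: "'a \<Rightarrow> nat" and K :: nat
  assumes inj: "inj_on enc S" and K: "\<And>a. a \<in> S \<Longrightarrow> enc a < K"
begin

lemma map_enc_inject:
  assumes "u \<in> lists S" "v \<in> lists S" "map enc u = map enc v" shows "u = v"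
proof -
  have "set u \<union> set v \<subseteq> S" using assms(1,2) by (simp add: in_lists_conv_set subset_iff)
  from inj_on_subset[OF inj this] show ?thesis using assms(3) inj_on_map_eq_map by blast
qed

lemma factor_lists: "y \<in> X \<Longrightarrow> factor y t n \<in> lists S"
  using language_lists[OF subX] unfolding language_def by blast

lemma Bex_nth_iff: "(\<exists>q<length us. Q (us ! q)) \<longleftrightarrow> (\<exists>u\<in>set us. Q u)"
  by (auto simp: set_conv_nth)

lemma spells_iff:
  assumes "y \<in> X" "w \<in> lists S"
  shows "spells (map enc w) p (enc \<circ> y) \<longleftrightarrow> factor y p (length w) = w"
proof -
  have "enc (y (p + int q)) = enc (w ! q) \<longleftrightarrow> y (p + int q) = w ! q" if "q < length w" for q
  proof -
    have "w ! q \<in> S" using assms(2) that by (simp add: in_lists_conv_set)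
    then show ?thesis using inj_on_eq_iff[OF inj subshift_value[OF subX assms(1)]] by blast
  qed
  then show ?thesis by (simp add: spells_def factor_eq_iff)
qed

lemma spells_agree:
  assumes "agree s y z" "\<bar>p\<bar> + int (length u) \<le> int s"
  shows "spells u p y = spells u p z"
proof -
  have "y (p + int q) = z (p + int q)" if "q < length u" for q
    using assms that by (auto simp: agree_def)
  then show ?thesis by (simp add: spells_def)
qed

abbreviation "C \<equiv> list_encode (map (encode_clopen enc) cs)"

lemma code_matches_iff:
  assumes "i \<in> {1..m}" "cs ! (i - 1) = (k, us)"
  shows "code_matches C s y n i \<longleftrightarrow> (\<exists>u\<in>set us. \<forall>t<length u.
    - int s \<le> n + k + int t \<and> n + k + int t \<le> int s \<and> y (n + k + int t) = enc (u ! t))"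
proof -
  have "code_nth C (i - 1) = prod_encode (int_encode k, list_encode (map (encode_word enc) us))"
  proof -
    have "i - 1 < length cs" using assms(1) len_cs by auto
    then have "code_nth C (i - 1) = encode_clopen enc (cs ! (i - 1))" by simp
    then show ?thesis unfolding assms(2) encode_clopen_def by simp
  qed
  then have "code_matches C s y n i \<longleftrightarrow> (\<exists>q<length us. \<forall>t<length (us ! q).
    - int s \<le> n + k + int t \<and> n + k + int t \<le> int s \<and> y (n + k + int t) = enc (us ! q ! t))"
    unfolding code_matches_def by (simp add: encode_word_def cong: conj_cong)
  also have "\<dots> \<longleftrightarrow> (\<exists>u\<in>set us. \<forall>t<length u.
    - int s \<le> n + k + int t \<and> n + k + int t \<le> int s \<and> y (n + k + int t) = enc (u ! t))"
    by (rule Bex_nth_iff)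
  finally show ?thesis .
qed

lemma code_matches_agree:
  assumes "agree s y z" "code_matches C s y n i"
  shows "code_matches C s z n i"
proof -
  have "y t = z t" if "- int s \<le> t" "t \<le> int s" for t using assms(1) that by (auto simp: agree_def)
  then show ?thesis using assms(2) unfolding code_matches_def by metis
qed

lemma part_words:
  assumes "i \<in> {1..m}" "cs ! (i - 1) = (k, us)" "u \<in> set us"
  shows "u \<in> lists S"
proof -
  have "cs ! (i - 1) \<in> set cs" using assms(1) len_cs by (intro nth_mem) auto
  then have "clopen_pres S (k, us)" using partition assms(2) by (auto simp: clopen_partition_def)
  then show ?thesis using assms(3) by (auto simp: clopen_pres_def)
qed

lemma code_matches_label:
  assumes "y \<in> X" "i \<in> {1..m}" "code_matches C s (enc \<circ> y) n i"
  shows "label cs y n = i"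
proof -
  obtain k us where c: "cs ! (i - 1) = (k, us)" by (cases "cs ! (i - 1)")
  then obtain u where u: "u \<in> set us" "\<And>t. t < length u \<Longrightarrow> enc (y (n + k + int t)) = enc (u ! t)"
    using assms(2,3) code_matches_iff by auto
  have "spells (map enc u) (k + n) (enc \<circ> y)"
    using u(2) by (auto simp: spells_def add_ac)
  then have "factor y (k + n) (length u) = u"
    using spells_iff[OF assms(1) part_words[OF assms(2) c u(1)]] by simp
  then have "translate n y \<in> part cs i"
    using u(1) c by (auto simp: part_def clopen_set_def)
  then show ?thesis by (rule label_unique[OF assms(1,2)])
qed

lemma code_matches_mono:
  assumes "s \<le> s'" "code_matches C s y n i"
  shows "code_matches C s' y n i"
proof -
  have "- int s' \<le> t \<and> t \<le> int s'" if "- int s \<le> t" "t \<le> int s" for t using assms(1) that by auto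
  then show ?thesis using assms(2) unfolding code_matches_def by metis
qed

lemma ex_code_matches_label:
  assumes "y \<in> X"
  shows "\<exists>s. code_matches C s (enc \<circ> y) n (label cs y n)"
proof -
  let ?i = "label cs y n"
  obtain k us where c: "cs ! (?i - 1) = (k, us)" by (cases "cs ! (?i - 1)")
  then obtain u where u: "u \<in> set us" "factor y (k + n) (length u) = u"
    using label_part[OF assms, of n] by (auto simp: part_def clopen_set_def)
  have "spells (map enc u) (k + n) (enc \<circ> y)"
    using spells_iff[OF assms part_words[OF label_range[OF assms] c u(1)]] u(2) by simp
  then have "enc (y (n + k + int t)) = enc (u ! t)" if "t < length u" for t
    using that by (auto simp: spells_def add_ac)
  then have "code_matches C (nat \<bar>n + k\<bar> + length u) (enc \<circ> y) n ?i"
    unfolding code_matches_iff[OF label_range[OF assms] c] using u(1) by (intro bexI[of _ u]) auto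
  then show ?thesis by blast
qed

text \<open>
  A window that reveals the labels near the origin for all points at once.
\<close>

lemma ex_code_matches_window:
  "\<exists>s. \<forall>y\<in>X. \<forall>n\<in>{- int N..int N}. code_matches C s (enc \<circ> y) n (label cs y n)"
proof (rule subshift_compact[OF subX finS])
  fix s s' :: nat and y :: "int \<Rightarrow> 'a"
  assume "s \<le> s'" "\<forall>n\<in>{- int N..int N}. code_matches C s (enc \<circ> y) n (label cs y n)"
  then show "\<forall>n\<in>{- int N..int N}. code_matches C s' (enc \<circ> y) n (label cs y n)"
    using code_matches_mono by blast
next
  fix s y assume y: "y \<in> X" "\<forall>n\<in>{- int N..int N}. code_matches C s (enc \<circ> y) n (label cs y n)"
  obtain s1 where s1: "\<forall>z\<in>X. agree s1 y z \<longrightarrow> (\<forall>n\<in>{- int N..int N}. label cs z n = label cs y n)"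
    using labels_agree[OF y(1) finite_atLeastAtMost_int] by blast
  have "\<forall>n\<in>{- int N..int N}. code_matches C s (enc \<circ> z) n (label cs z n)"
    if z: "z \<in> X" "agree (max s s1) y z" for z
  proof
    fix n assume n: "n \<in> {- int N..int N}"
    have "agree s (enc \<circ> y) (enc \<circ> z)" using agree_mono[OF _ z(2), of s] by (simp add: agree_def)
    moreover have "label cs z n = label cs y n"
      using s1 n z(1) agree_mono[OF _ z(2), of s1] by simp
    ultimately show "code_matches C s (enc \<circ> z) n (label cs z n)"
      using code_matches_agree y(2) n by metis
  qed
  then show "\<exists>t. \<forall>z\<in>X. agree t y z \<longrightarrow> (\<forall>n\<in>{- int N..int N}. code_matches C s (enc \<circ> z) n (label cs z n))"
    by blast
next
  fix y assume y: "y \<in> X"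
  obtain f where f: "\<And>n. code_matches C (f n) (enc \<circ> y) n (label cs y n)"
    using ex_code_matches_label[OF y] by metis
  have "f n \<le> Max (f ` {- int N..int N})" if "n \<in> {- int N..int N}" for n
    using that by (intro Max_ge) auto
  then show "\<exists>s. \<forall>n\<in>{- int N..int N}. code_matches C s (enc \<circ> y) n (label cs y n)"
    using code_matches_mono f by blast
qed

text \<open>
  From left to right, the window of any point of \<open>X\<close> is one of the words quantified over. Conversely, a window
  word over the alphabet that is not enumerated lies in the language, so it is the window of
  a point of \<open>X\<close>, to which \<^const>\<open>forced\<close> applies; the radius is the one at which the labels
  become visible.
\<close>

lemma forced_code_iff:
  assumes w: "w \<in> lists S" "nat \<bar>p\<bar> + length w \<le> C0"
    and W: "W \<subseteq> lists S" "\<And>r. r \<in> W \<Longrightarrow> length r \<le> C0"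
    and j: "j \<le> length as"
  shows "forced_code K (enc ` S) (encode_word enc ` (lists S - language X)) C0 p (map enc w) (map enc ` W)
      (encode_instance enc (m, as, cs)) i j l N b \<longleftrightarrow> forced X cs p w W l N (drop i (take j as)) b"
    (is "forced_code K ?D ?NL C0 p ?w ?W ?E i j l N b \<longleftrightarrow> _")
proof -
  have E: "pfst ?E = m" "pfst (psnd ?E) = list_encode as" "psnd (psnd ?E) = C"
    by (simp_all add: encode_instance_def)
  have iff: "code_in_order (Suc m) v N (list_encode as) i j \<longleftrightarrow>
      in_order (label cs y) {- int N..int N} (drop i (take j as))"
    if "\<And>q. q < Suc (2 * N) \<Longrightarrow> digit (Suc m) v q = label cs y (int q - int N)" for v y
    unfolding code_in_order_iff[OF j]
  proof (rule in_order_cong)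
    fix t assume "t \<in> {- int N..int N}"
    then have "nat (t + int N) < Suc (2 * N)" "int (nat (t + int N)) = t + int N" by auto
    then show "digit (Suc m) v (nat (t + int N)) = label cs y t" using that by simp
  qed
  have window: "{t. \<bar>t\<bar> \<le> int l} = (\<lambda>q. int q - int l) ` {..<Suc (2 * l)}"
  proof
    show "{t. \<bar>t\<bar> \<le> int l} \<subseteq> (\<lambda>q. int q - int l) ` {..<Suc (2 * l)}"
    proof
      fix t assume "t \<in> {t. \<bar>t\<bar> \<le> int l}"
      then have "nat (t + int l) \<in> {..<Suc (2 * l)}" "t = int (nat (t + int l)) - int l" by auto
      then show "t \<in> (\<lambda>q. int q - int l) ` {..<Suc (2 * l)}" by blast
    qed
  qed auto
  show ?thesis
  proof
    assume "forced_code K ?D ?NL C0 p ?w ?W ?E i j l N b"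
    then obtain s where s: "l + C0 \<le> s" and forced_code: "\<And>c. c < K ^ Suc (2 * s) \<Longrightarrow>
        (\<exists>q<Suc (2 * s). digit K c q \<notin> ?D) \<or>
        (\<exists>v. code_length v = Suc (2 * s) \<and> (\<forall>q<Suc (2 * s). code_nth v q = digit K c q) \<and> v \<in> ?NL) \<or>
        \<not> spells ?w p (window_point K s c) \<or>
        (\<exists>r\<in>?W. \<exists>q<Suc (2 * l). spells r (int q - int l) (window_point K s c)) \<or>
        (\<exists>v. (\<forall>q<Suc (2 * N). 1 \<le> digit (Suc m) v q \<and> digit (Suc m) v q \<le> m \<and>
               code_matches C s (window_point K s c) (int q - int N) (digit (Suc m) v q)) \<and>
             code_in_order (Suc m) v N (list_encode as) i j = b)"
      unfolding forced_code_def E by blast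
    show "forced X cs p w W l N (drop i (take j as)) b"
      unfolding forced_def
    proof (intro ballI impI)
      fix y assume y: "y \<in> X" and yw: "factor y p (length w) = w"
      have "enc (y (int q - int s)) < K" for q using K subshift_value[OF subX y] by blast
      from ex_digits[of "Suc (2 * s)" "\<lambda>q. enc (y (int q - int s))", OF this]
      obtain c where c: "c < K ^ Suc (2 * s)"
        "\<And>q. q < Suc (2 * s) \<Longrightarrow> digit K c q = enc (y (int q - int s))" by blast
      have ag: "agree s (enc \<circ> y) (window_point K s c)"
        unfolding agree_def
      proof (intro allI impI)
        fix t assume "\<bar>t\<bar> \<le> int s"
        then have "nat (t + int s) < Suc (2 * s)" "int (nat (t + int s)) = t + int s" by auto
        then show "(enc \<circ> y) t = window_point K s c t" using c(2) by (simp add: window_point_def)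
      qed
      have 1: "\<not> (\<exists>q<Suc (2 * s). digit K c q \<notin> ?D)"
        using c(2) subshift_value[OF subX y] by auto
      have 2: "\<not> (\<exists>v. code_length v = Suc (2 * s) \<and> (\<forall>q<Suc (2 * s). code_nth v q = digit K c q) \<and> v \<in> ?NL)"
      proof
        assume "\<exists>v. code_length v = Suc (2 * s) \<and> (\<forall>q<Suc (2 * s). code_nth v q = digit K c q) \<and> v \<in> ?NL"
        then obtain v where v: "code_length v = Suc (2 * s)" "\<And>q. q < Suc (2 * s) \<Longrightarrow> code_nth v q = digit K c q"
          "v \<in> ?NL" by blast
        then obtain u where u: "u \<in> lists S" "u \<notin> language X" and vu: "v = encode_word enc u"
          by blast
        have u3: "length u = Suc (2 * s)" using v(1) by (simp add: vu encode_word_def)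
        have u4: "enc (u ! q) = digit K c q" if "q < Suc (2 * s)" for q
          using v(2)[OF that] that u3 by (simp add: vu encode_word_def)
        have "map enc u = map enc (factor y (- int s) (Suc (2 * s)))"
          using u3 u4 c(2) by (intro nth_equalityI) (auto simp: factor_def simp del: upt_Suc)
        then have "u = factor y (- int s) (Suc (2 * s))"
          by (rule map_enc_inject[OF u(1) factor_lists[OF y]])
        then show False using u(2) y unfolding language_def by blast
      qed
      have 3: "spells ?w p (window_point K s c)"
      proof -
        have "spells ?w p (enc \<circ> y)" using spells_iff[OF y w(1)] yw by simp
        moreover have "\<bar>p\<bar> + int (length ?w) \<le> int s" using w(2) s by simp
        ultimately show ?thesis using spells_agree[OF ag] by blast
      qed
      show "(\<exists>r\<in>W. \<exists>t. \<bar>t\<bar> \<le> int l \<and> factor y t (length r) = r) \<or>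
          in_order (label cs y) {- int N..int N} (drop i (take j as)) = b"
        using forced_code[OF c(1)] 1 2 3
      proof (elim disjE)
        assume "\<exists>r\<in>?W. \<exists>q<Suc (2 * l). spells r (int q - int l) (window_point K s c)"
        then obtain r q where r: "r \<in> W" "q < Suc (2 * l)"
          "spells (map enc r) (int q - int l) (window_point K s c)" by blast
        have le: "\<bar>int q - int l\<bar> + int (length (map enc r)) \<le> int s"
          using W(2)[OF r(1)] r(2) s by simp
        have "spells (map enc r) (int q - int l) (enc \<circ> y)"
          using r(3) spells_agree[OF ag le] by simp
        then have "factor y (int q - int l) (length r) = r"
          using spells_iff[OF y] W(1) r(1) by blast
        moreover have "\<bar>int q - int l\<bar> \<le> int l" using r(2) by simp
        ultimately show ?thesis using r(1) by blast
      next
        assume "\<exists>v. (\<forall>q<Suc (2 * N). 1 \<le> digit (Suc m) v q \<and> digit (Suc m) v q \<le> m \<and>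
               code_matches C s (window_point K s c) (int q - int N) (digit (Suc m) v q)) \<and>
             code_in_order (Suc m) v N (list_encode as) i j = b"
        then obtain v where v: "\<And>q. q < Suc (2 * N) \<Longrightarrow> digit (Suc m) v q \<in> {1..m} \<and>
               code_matches C s (window_point K s c) (int q - int N) (digit (Suc m) v q)"
          "code_in_order (Suc m) v N (list_encode as) i j = b" by auto
        have "digit (Suc m) v q = label cs y (int q - int N)" if "q < Suc (2 * N)" for q
          using code_matches_label[OF y] v(1)[OF that] code_matches_agree[OF agree_sym[OF ag]] by metis
        then show ?thesis using iff v(2) by blast
      qed blast+
    qed
  next
    assume forced: "forced X cs p w W l N (drop i (take j as)) b"
    obtain s0 where s0: "\<And>y n. y \<in> X \<Longrightarrow> n \<in> {- int N..int N} \<Longrightarrow>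
        code_matches C s0 (enc \<circ> y) n (label cs y n)"
      using ex_code_matches_window by blast
    define s where "s = max s0 (l + C0)"
    have s: "l + C0 \<le> s" by (simp add: s_def)
    have mt: "code_matches C s (enc \<circ> y) n (label cs y n)" if "y \<in> X" "n \<in> {- int N..int N}" for y n
      using code_matches_mono[OF _ s0[OF that], of s] by (simp add: s_def)
    have "(\<exists>q<Suc (2 * s). digit K c q \<notin> ?D) \<or>
        (\<exists>v. code_length v = Suc (2 * s) \<and> (\<forall>q<Suc (2 * s). code_nth v q = digit K c q) \<and> v \<in> ?NL) \<or>
        \<not> spells ?w p (window_point K s c) \<or>
        (\<exists>r\<in>?W. \<exists>q<Suc (2 * l). spells r (int q - int l) (window_point K s c)) \<or>
        (\<exists>v. (\<forall>q<Suc (2 * N). 1 \<le> digit (Suc m) v q \<and> digit (Suc m) v q \<le> m \<and>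
               code_matches C s (window_point K s c) (int q - int N) (digit (Suc m) v q)) \<and>
             code_in_order (Suc m) v N (list_encode as) i j = b)" (is "?A1 \<or> ?A2 \<or> \<not> ?A3 \<or> ?A4 \<or> ?A5") for c
    proof (cases "?A1 \<or> ?A2 \<or> \<not> ?A3")
      case False
      then have D: "\<And>q. q < Suc (2 * s) \<Longrightarrow> digit K c q \<in> enc ` S" and n2: "\<not> ?A2" and sp: ?A3 by blast+
      define u where "u = map (\<lambda>q. inv_into S enc (digit K c q)) [0..<Suc (2 * s)]"
      have uq: "enc (u ! q) = digit K c q" "u ! q \<in> S" if "q < Suc (2 * s)" for q
        using D[OF that] that f_inv_into_f inv_into_into unfolding u_def
        by (metis (no_types, lifting) add_0 diff_zero length_upt nth_map nth_upt)+
      have lu: "length u = Suc (2 * s)" by (simp add: u_def)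
      have uS: "u \<in> lists S" using uq(2) lu by (metis in_listsI in_set_conv_nth)
      have "u \<in> language X"
      proof (rule ccontr)
        assume "u \<notin> language X"
        then have "encode_word enc u \<in> ?NL" using uS by blast
        moreover have "code_length (encode_word enc u) = Suc (2 * s)" by (simp add: encode_word_def lu)
        moreover have "\<forall>q<Suc (2 * s). code_nth (encode_word enc u) q = digit K c q"
          using uq(1) lu by (simp add: encode_word_def)
        ultimately show False using n2 by blast
      qed
      then obtain y where y: "y \<in> X" "factor y (- int s) (Suc (2 * s)) = u"
        using language_iff[OF subX, of u "- int s"] lu by auto
      have ag: "agree s (enc \<circ> y) (window_point K s c)"
        unfolding agree_def
      proof (intro allI impI)
        fix t assume "\<bar>t\<bar> \<le> int s"
        then have t: "nat (t + int s) < Suc (2 * s)" "int (nat (t + int s)) = t + int s" by auto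
        then have "y (- int s + int (nat (t + int s))) = u ! nat (t + int s)"
          using y(2) unfolding factor_eq_iff by blast
        then show "(enc \<circ> y) t = window_point K s c t" using uq(1)[OF t(1)] t(2) by (simp add: window_point_def)
      qed
      have le: "\<bar>p\<bar> + int (length ?w) \<le> int s" using w(2) s by simp
      have yw: "factor y p (length w) = w"
        using sp spells_agree[OF ag le] spells_iff[OF y(1) w(1)] by simp
      show ?thesis
      proof (cases "\<exists>r\<in>W. \<exists>t. \<bar>t\<bar> \<le> int l \<and> factor y t (length r) = r")
        case True
        then obtain r t where r: "r \<in> W" "\<bar>t\<bar> \<le> int l" "factor y t (length r) = r" by blast
        have le: "\<bar>t\<bar> + int (length (map enc r)) \<le> int s" using r(2) W(2)[OF r(1)] s by simp
        have "spells (map enc r) t (window_point K s c)"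
          using spells_agree[OF ag le] spells_iff[OF y(1), of r t] W(1) r by auto
        moreover obtain q where "q < Suc (2 * l)" "t = int q - int l"
          using r(2) window by blast
        ultimately have ?A4 using r(1) by blast
        then show ?thesis by blast
      next
        case False
        then have b: "in_order (label cs y) {- int N..int N} (drop i (take j as)) = b"
          using forced y(1) yw unfolding forced_def by blast
        have "label cs y (int q - int N) < Suc m" for q
          using label_range[OF y(1), of "int q - int N"] by simp
        from ex_digits[of "Suc (2 * N)" "\<lambda>q. label cs y (int q - int N)", OF this]
        obtain v where v: "\<And>q. q < Suc (2 * N) \<Longrightarrow> digit (Suc m) v q = label cs y (int q - int N)"
          by blast
        have "1 \<le> digit (Suc m) v q \<and> digit (Suc m) v q \<le> m \<and>
            code_matches C s (window_point K s c) (int q - int N) (digit (Suc m) v q)" if q: "q < Suc (2 * N)" for q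
        proof -
          have "int q - int N \<in> {- int N..int N}" using q by simp
          from code_matches_agree[OF ag mt[OF y(1) this]] label_range[OF y(1), of "int q - int N"]
          show ?thesis unfolding v[OF q] by simp
        qed
        then have ?A5 using iff[OF v] b by blast
        then show ?thesis by blast
      qed
    qed blast
    then show "forced_code K ?D ?NL C0 p ?w ?W ?E i j l N b"
      unfolding forced_code_def E using s by blast
  qed
qed

end

section \<open>Decidability\<close>

text \<open>
  The predicate \<open>F\<close> does not depend on the instance, only its first argument does: it
  applies to all partitions of the fixed subshift.
\<close>

definition recognizes_forced :: "'a set \<Rightarrow> ('a \<Rightarrow> nat) \<Rightarrow> (int \<Rightarrow> 'a) set \<Rightarrow> int \<Rightarrow> 'a list \<Rightarrow>
    'a list set \<Rightarrow> bool \<Rightarrow> (nat \<Rightarrow> nat \<Rightarrow> nat \<Rightarrow> nat \<Rightarrow> nat \<Rightarrow> bool) \<Rightarrow> bool" where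
  "recognizes_forced S enc X p w W b F \<longleftrightarrow>
     (\<forall>E i j l N. computable E \<longrightarrow> computable i \<longrightarrow> computable j \<longrightarrow> computable l \<longrightarrow> computable N \<longrightarrow>
        semidecidable (\<lambda>n. F (E n) (i n) (j n) (l n) (N n))) \<and>
     (\<forall>m as cs i j l N. clopen_partition S X m cs \<longrightarrow> j \<le> length as \<longrightarrow>
        F (encode_instance enc (m, as, cs)) i j l N = forced X cs p w W l N (drop i (take j as)) b)"

lemma recognizes_forcedD:
  assumes "recognizes_forced S enc X p w W b F"
  shows "computable E \<Longrightarrow> computable i \<Longrightarrow> computable j \<Longrightarrow> computable l \<Longrightarrow> computable N \<Longrightarrow> semidecidable (\<lambda>n. F (E n) (i n) (j n) (l n) (N n))"
    and "clopen_partition S X m cs \<Longrightarrow> j' \<le> length as \<Longrightarrow>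
      F (encode_instance enc (m, as, cs)) i' j' l' N' = forced X cs p w W l' N' (drop i' (take j' as)) b"
  using assms unfolding recognizes_forced_def by blast+

lemma ex_recognizes_forced:
  fixes S :: "'a set" and enc :: "'a \<Rightarrow> nat" and X :: "(int \<Rightarrow> 'a) set"
  assumes S: "finite S" "inj_on enc S" and X: "quasiminimal S X" "Pi01 enc S X"
    and w: "w \<in> lists S" and W: "finite W" "W \<subseteq> lists S"
  shows "\<exists>F. recognizes_forced S enc X p w W b F"
proof -
  define K where "K = Suc (Max (insert 0 (enc ` S)))"
  define C0 where "C0 = nat \<bar>p\<bar> + length w + Max (insert 0 (length ` W))"
  have K: "enc a < K" if "a \<in> S" for a
    using S(1) that unfolding K_def by (intro le_imp_less_Suc Max_ge) auto
  have C0: "length r \<le> C0" if "r \<in> W" for r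
  proof -
    have "length r \<le> Max (insert 0 (length ` W))" using W(1) that by (intro Max_ge) auto
    then show ?thesis by (simp add: C0_def)
  qed
  define NL where "NL = encode_word enc ` (lists S - language X)"
  define F where "F = (\<lambda>E i j l N. forced_code K (enc ` S) NL C0 p (map enc w) (map enc ` W) E i j l N b)"
  have NL: "recursively_enumerable NL" using X(2) by (simp add: Pi01_def NL_def)
  have "recognizes_forced S enc X p w W b F"
    unfolding recognizes_forced_def
  proof (intro conjI allI impI)
    show "semidecidable (\<lambda>n. F (E n) (i n) (j n) (l n) (N n))"
      if "computable E" "computable i" "computable j" "computable l" "computable N" for E i j l N
      unfolding F_def by (rule semidecidable_forced_code[OF _ _ NL that]) (use S(1) W(1) in simp_all)
    fix m and as :: "nat list" and cs :: "'a clopen list" and i j l N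
    assume cp: "clopen_partition S X m cs" and j: "j \<le> length as"
    interpret coded_subshift S X m cs enc K
      by unfold_locales (use S X(1) cp K in auto)
    show "F (encode_instance enc (m, as, cs)) i j l N = forced X cs p w W l N (drop i (take j as)) b"
      unfolding F_def NL_def by (rule forced_code_iff[OF w _ W(2) C0 j]) (simp_all add: C0_def)
  qed
  then show ?thesis by blast
qed

lemma infix_single: "i < length as \<Longrightarrow> drop i (take (Suc i) as) = [as ! i]"
  by (simp add: take_Suc_conv_app_nth)

lemma semidecidable_presence:
  fixes S :: "'a set" and enc :: "'a \<Rightarrow> nat" and X :: "(int \<Rightarrow> 'a) set"
  assumes S: "finite S" "inj_on enc S" and X: "quasiminimal S X" "Pi01 enc S X"
  shows "\<exists>Y. semidecidable Y \<and> (\<forall>m as cs. clopen_partition S X m cs \<longrightarrow>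
      Y (encode_instance enc (m, as, cs)) = (\<exists>x\<in>X. in_order (label cs x) UNIV as))"
proof -
  have sub: "subshift S X" using X(1) by (simp add: quasiminimal_def)
  obtain P where P: "finite P" "P \<subseteq> language X"
    "\<And>Y. subshift S Y \<Longrightarrow> Y \<subset> X \<Longrightarrow> \<exists>p\<in>P. p \<notin> language Y"
    using detecting_words[OF X(1)] by blast
  have "\<forall>p\<in>P. \<exists>F. recognizes_forced S enc X 0 p {} True F"
  proof
    fix p assume "p \<in> P"
    then have "p \<in> lists S" using P(2) language_lists[OF sub] by blast
    then show "\<exists>F. recognizes_forced S enc X 0 p {} True F"
      by (rule ex_recognizes_forced[OF S X]) simp_all
  qed
  then obtain F where "\<forall>p\<in>P. recognizes_forced S enc X 0 p {} True (F p)"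
    by (rule bchoice[THEN exE])
  then have F: "recognizes_forced S enc X 0 p {} True (F p)" if "p \<in> P" for p using that by blast
  define Y where "Y = (\<lambda>E. \<exists>p\<in>P. \<exists>N. F p E 0 (code_length (pfst (psnd E))) 0 N)"
  have "semidecidable Y" unfolding Y_def
    by (intro semidecidable_finite_ex semidecidable_ex recognizes_forcedD(1)[OF F] P(1) computable_pfst computable_psnd computable_code_length computable_const computable_id)
  moreover have "Y (encode_instance enc (m, as, cs)) = (\<exists>x\<in>X. in_order (label cs x) UNIV as)"
    if cp: "clopen_partition S X m cs" for m as cs
  proof -
    interpret labelled_subshift S X m cs by unfold_locales (use S X(1) cp in auto)
    have len: "code_length (pfst (psnd (encode_instance enc (m, as, cs)))) = length as"
      by (simp add: encode_instance_def)
    have eq: "F p (encode_instance enc (m, as, cs)) 0 (length as) 0 N = forced X cs 0 p {} 0 N as True"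
      if "p \<in> P" for p N
      using recognizes_forcedD(2)[OF F[OF that] cp order_refl, of as 0 0 N] by simp
    have "Y (encode_instance enc (m, as, cs)) = (\<exists>p\<in>P. \<exists>N. forced X cs 0 p {} 0 N as True)"
      unfolding Y_def len by (intro bex_cong refl iff_exI eq)
    also have "\<dots> = (\<exists>x\<in>X. in_order (label cs x) UNIV as)"
      by (rule occurrence_certificate[OF P(2,3), symmetric])
    finally show ?thesis .
  qed
  ultimately show ?thesis by blast
qed

lemma semidecidable_absence:
  fixes S :: "'a set" and enc :: "'a \<Rightarrow> nat" and X :: "(int \<Rightarrow> 'a) set"
  assumes S: "finite S" "inj_on enc S" and X: "quasiminimal S X" "Pi01 enc S X" and x: "x \<in> X"
  shows "\<exists>Q. semidecidable Q \<and> (\<forall>m as cs. clopen_partition S X m cs \<longrightarrow>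
      Q (encode_instance enc (m, as, cs)) = (\<not> in_order (label cs x) UNIV as))"
proof -
  have sub: "subshift S X" using X(1) by (simp add: quasiminimal_def)
  have excl: "\<exists>W. finite W \<and> W \<subseteq> lists S \<and> excluded X (limset F x) W" if "tails F" for F
    by (rule exclusion_words[OF X(1) limset_subshift[OF sub x that] limset_subset[OF sub x]])
  obtain W where W: "finite W" "W \<subseteq> lists S" "excluded X (limset everywhere x) W"
    using excl[of everywhere] by auto
  have len: "code_length (pfst (psnd (encode_instance enc (m, as, cs)))) = length as" for m as and cs :: "'a clopen list"
    by (simp add: encode_instance_def)
  show ?thesis
  proof (cases "x \<in> limset leftwards x \<or> x \<in> limset rightwards x")
    case True
    obtain F where F: "recognizes_forced S enc X 0 [] W False F"
      using ex_recognizes_forced[OF S X lists.Nil W(1,2)] by blast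
    define Q where "Q = (\<lambda>E. \<exists>i<code_length (pfst (psnd E)). \<exists>l. F E i (Suc i) l 0)"
    have "semidecidable Q" unfolding Q_def
      by (intro semidecidable_ex_less semidecidable_ex recognizes_forcedD(1)[OF F] computable_pfst computable_psnd computable_code_length computable_Suc computable_const computable_id)
    moreover have "Q (encode_instance enc (m, as, cs)) = (\<not> in_order (label cs x) UNIV as)"
      if cp: "clopen_partition S X m cs" for m as cs
    proof -
      interpret labelled_subshift S X m cs by unfold_locales (use S X(1) cp in auto)
      have "F (encode_instance enc (m, as, cs)) i (Suc i) l 0 = forced X cs 0 [] W l 0 [as ! i] False"
        if "i < length as" for i l
        using recognizes_forcedD(2)[OF F cp, of "Suc i" as i l 0] that by (simp add: infix_single)
      then show ?thesis
        unfolding recurrent_certificate[OF x True W(3)] Q_def len by (simp cong: conj_cong)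
    qed
    ultimately show ?thesis by blast
  next
    case False
    obtain n where n: "\<And>y. y \<in> limset everywhere x \<Longrightarrow> agree n y x \<Longrightarrow> \<exists>m. y = translate m x"
      using isolated_in_orbit_closure[of x] False by blast
    define p where "p = - int n"
    define w where "w = factor x p (Suc (2 * n))"
    have w_self: "factor x p (length w) = w" by (simp add: w_def)
    have wS: "w \<in> lists S" using language_lists[OF sub] x unfolding w_def language_def by blast
    have iso: "\<exists>m. y = translate m x"
      if "y \<in> limset everywhere x" "factor y p (length w) = w" for y
    proof -
      have "agree n y x" using that(2) factor_window_eq_iff[of y n x] by (simp add: w_def p_def)
      then show ?thesis by (rule n[OF that(1)])
    qed
    obtain WL where WL: "finite WL" "WL \<subseteq> lists S" "excluded X (limset leftwards x) WL"
      using excl[of leftwards] by auto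
    obtain WR where WR: "finite WR" "WR \<subseteq> lists S" "excluded X (limset rightwards x) WR"
      using excl[of rightwards] by auto
    obtain nl where nl: "\<And>r t. r \<in> WL \<Longrightarrow> t < - int nl \<Longrightarrow> factor x t (length r) \<noteq> r"
      using excluded_words_leave[OF sub S(1) x tails(2) WL(1,3)] by auto
    obtain nr where nr: "\<And>r t. r \<in> WR \<Longrightarrow> t > int nr \<Longrightarrow> factor x t (length r) \<noteq> r"
      using excluded_words_leave[OF sub S(1) x tails(3) WR(1,3)] by auto
    \<comment> \<open>Beyond \<open>N0\<close> the point shows no word that the limit set on that side avoids.\<close>
    define N0 where "N0 = max nl nr"
    have left: "factor x t (length r) \<noteq> r" if "r \<in> WL" "t < - int N0" for r t
      using nl[OF that(1), of t] that(2) by (simp add: N0_def)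
    have right: "factor x t (length r) \<noteq> r" if "r \<in> WR" "t > int N0" for r t
      using nr[OF that(1), of t] that(2) by (simp add: N0_def)
    obtain FL where FL: "recognizes_forced S enc X 0 [] WL False FL"
      using ex_recognizes_forced[OF S X lists.Nil WL(1,2)] by blast
    obtain FR where FR: "recognizes_forced S enc X 0 [] WR False FR"
      using ex_recognizes_forced[OF S X lists.Nil WR(1,2)] by blast
    obtain F where F: "recognizes_forced S enc X p w W False F"
      using ex_recognizes_forced[OF S X wS W(1,2)] by blast
    define Q where "Q = (\<lambda>E. \<exists>i j l l'. i < j \<and> j \<le> code_length (pfst (psnd E)) \<and>
        FL E i (Suc i) l 0 \<and> FR E (j - 1) j l 0 \<and> F E i j l' (N0 + l))"
    have "semidecidable Q" unfolding Q_def
      by (intro semidecidable_conj semidecidable_ex recognizes_forcedD(1)[OF F] recognizes_forcedD(1)[OF FL]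
          recognizes_forcedD(1)[OF FR] semidecidable_dec[OF decidable_less] semidecidable_dec[OF decidable_le]
          computable_pfst computable_psnd computable_code_length computable_Suc computable_add computable_diff computable_const computable_id)
    moreover have "Q (encode_instance enc (m, as, cs)) = (\<not> in_order (label cs x) UNIV as)"
      if cp: "clopen_partition S X m cs" for m as cs
    proof -
      interpret labelled_subshift S X m cs by unfold_locales (use S X(1) cp in auto)
      let ?E = "encode_instance enc (m, as, cs)"
      have eL: "FL ?E i (Suc i) l 0 = forced X cs 0 [] WL l 0 [as ! i] False"
        if "i < j" "j \<le> length as" for i j l
        using recognizes_forcedD(2)[OF FL cp, of "Suc i" as i l 0] that by (simp add: infix_single)
      have eR: "FR ?E (j - 1) j l 0 = forced X cs 0 [] WR l 0 [as ! (j - 1)] False"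
        if "i < j" "j \<le> length as" for i j l
      proof -
        have "drop (j - 1) (take j as) = [as ! (j - 1)]"
          using infix_single[of "j - 1" as] that by simp
        then show ?thesis using recognizes_forcedD(2)[OF FR cp that(2), of "j - 1" l 0] by simp
      qed
      have eF: "F ?E i j l' N = forced X cs p w W l' N (drop i (take j as)) False"
        if "j \<le> length as" for i j l' N
        by (rule recognizes_forcedD(2)[OF F cp that])
      have "\<not> in_order (label cs x) UNIV as \<longleftrightarrow> (\<exists>i j l l'. i < j \<and> j \<le> length as \<and>
          forced X cs 0 [] WL l 0 [as ! i] False \<and> forced X cs 0 [] WR l 0 [as ! (j - 1)] False \<and>
          forced X cs p w W l' (N0 + l) (drop i (take j as)) False)"
        by (rule isolated_certificate[OF x iso w_self W(3) WL(3) left WR(3) right])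
      then show ?thesis
        unfolding Q_def len using eL eR eF by (simp cong: conj_cong)
    qed
    ultimately show ?thesis by blast
  qed
qed

theorem theorem9:
  fixes S :: "'a set" and enc :: "'a \<Rightarrow> nat" and X :: "(int \<Rightarrow> 'a) set"
  assumes "finite S" and "inj_on enc S"
    and "quasiminimal S X" and "Pi01 enc S X"
  shows "decidable_problem (encode_instance enc) (ept_instances S X) (ept_models X)"
proof -
  obtain Y where Y: "semidecidable Y" "\<And>m as cs. clopen_partition S X m cs \<Longrightarrow>
      Y (encode_instance enc (m, as, cs)) = (\<exists>x\<in>X. in_order (label cs x) UNIV as)"
    using semidecidable_presence[OF assms] by blast
  obtain R where R: "finite R" "R \<subseteq> X"
    "\<And>x. x \<in> X \<Longrightarrow> \<exists>y\<in>R. limset everywhere y = limset everywhere x"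
    using finite_orbit_closure_representatives[OF assms(3)] by blast
  have "\<forall>x\<in>R. \<exists>Q. semidecidable Q \<and> (\<forall>m as cs. clopen_partition S X m cs \<longrightarrow>
      Q (encode_instance enc (m, as, cs)) = (\<not> in_order (label cs x) UNIV as))"
    using semidecidable_absence[OF assms] R(2) by blast
  from bchoice[OF this] obtain Q where Q: "\<And>x. x \<in> R \<Longrightarrow> semidecidable (Q x)"
    "\<And>x m as cs. x \<in> R \<Longrightarrow> clopen_partition S X m cs \<Longrightarrow>
      Q x (encode_instance enc (m, as, cs)) = (\<not> in_order (label cs x) UNIV as)"
    by blast
  have models: "ept_models X (m, as, cs) = (\<exists>x\<in>X. in_order (label cs x) UNIV as)"
    and absent: "(\<exists>x\<in>X. in_order (label cs x) UNIV as) = (\<exists>x\<in>R. in_order (label cs x) UNIV as)"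
    if "(m, as, cs) \<in> ept_instances S X" for m as cs
  proof -
    have i: "as \<noteq> []" "set as \<subseteq> {1..m}" "clopen_partition S X m cs"
      using that by (auto simp: ept_instances_def)
    interpret labelled_subshift S X m cs by unfold_locales (use assms i in auto)
    show "ept_models X (m, as, cs) = (\<exists>x\<in>X. in_order (label cs x) UNIV as)"
      using models_iff_in_order[OF i(1,2)] by (simp add: ept_models_def)
    show "(\<exists>x\<in>X. in_order (label cs x) UNIV as) = (\<exists>x\<in>R. in_order (label cs x) UNIV as)"
      by (rule representatives_suffice[OF R(2,3)])
  qed
  show ?thesis
  proof (rule decidable_problem_if_semidecidable[OF Y(1) semidecidable_finite_all[OF R(1) Q(1)]])
    fix I assume I: "I \<in> ept_instances S X"
    obtain m as cs where e: "I = (m, as, cs)" by (cases I)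
    have cp: "clopen_partition S X m cs" using I by (auto simp: e ept_instances_def)
    show "Y (encode_instance enc I) = ept_models X I"
      unfolding e models[OF I[unfolded e]] by (rule Y(2)[OF cp])
    show "(\<forall>x\<in>R. Q x (encode_instance enc I)) = (\<not> ept_models X I)"
      unfolding e models[OF I[unfolded e]] absent[OF I[unfolded e]] by (simp add: Q(2)[OF _ cp])
  qed
qed

end
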